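(* Let $m\ge 1$ and $c\ge 1$, and let $F$ be the free $m$-generated, $c$-nilpotent group. Let $H$ be a nontrivial subgroup of $F$. Then $H$ is undistorted in $F$ if and only if $H$ is a retract of a subgroup of finite index in $F$, i.e. if and only if there exist a subgroup $K\le F$ with $[F:K]<\infty$ and $H\le K$, and a homomorphism $\rho:K\to H$ with $\rho(h)=h$ for all $h\in H$.
   Context: The descending central series of a group $G$ is $\gamma_1(G)=G$, $\gamma_i(G)=[G,\gamma_{i-1}(G)]$. The free $m$-generated, $c$-nilpotent group is $R/\gamma_{c+1}(R)$, where $R$ is the (absolutely) free group of rank $m$. Distortion: let $G$ be a group generated by a finite set $T$ and $H\le G$ a subgroup generated by a finite set $S$. The distortion function of $H$ in $G$ is $\Delta^G_H:\mathbb N\to\mathbb N$, $\Delta^G_H(n)=\max\{|w|_S : w\in H,\ |w|_T\le n\}$, where $|w|_S$, $|w|_T$ denote word lengths with respect to $S$ and $T$. For functions $f,g$ on $\mathbb N$ write $f\preceq g$ if there is $C>0$ with $f(n)\le C\,g(Cn+C)$ for all $n\ge 0$, and $f\approx g$ if $f\preceq g$ and $g\preceq f$. Up to $\approx$, $\Delta_H^G$ does not depend on the choice of $S,T$. The subgroup $H$ is undistorted in $G$ if $\Delta^G_H(n)\approx n$. (Every subgroup of a finitely generated nilpotent group is finitely generated, so this applies to all $H\le F$.) *)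

theory Defs
  imports "HOL-Algebra.Generated_Groups"
begin

section \<open>Free groups\<close>

text \<open>A letter \<open>(x, True)\<close> stands for the generator \<open>x\<close> and \<open>(x, False)\<close> for its formal
  inverse. Elements of the free group on \<open>X\<close> are classes of words in these letters modulo
  insertion and deletion of adjacent mutually inverse letters.\<close>

type_synonym 'a fword = "('a \<times> bool) list"

abbreviation fwords :: "'a set \<Rightarrow> 'a fword set"
  where "fwords X \<equiv> lists (X \<times> UNIV)"

inductive free_eq :: "'a set \<Rightarrow> 'a fword \<Rightarrow> 'a fword \<Rightarrow> bool" for X :: "'a set" where
  cancel: "u \<in> fwords X \<Longrightarrow> v \<in> fwords X \<Longrightarrow> x \<in> X \<Longrightarrow>
             free_eq X (u @ [(x, b), (x, \<not> b)] @ v) (u @ v)"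
| refl: "u \<in> fwords X \<Longrightarrow> free_eq X u u"
| sym: "free_eq X u v \<Longrightarrow> free_eq X v u"
| trans: "free_eq X u v \<Longrightarrow> free_eq X v w \<Longrightarrow> free_eq X u w"

definition free_rel :: "'a set \<Rightarrow> 'a fword rel"
  where "free_rel X = {(u, v). free_eq X u v}"

definition free_group :: "'a set \<Rightarrow> 'a fword set monoid"
  where "free_group X =
    \<lparr> carrier = fwords X // free_rel X,
      mult = (\<lambda>A B. \<Union>a\<in>A. \<Union>b\<in>B. free_rel X `` {a @ b}),
      one = free_rel X `` {[]} \<rparr>"

lemma free_eq_in: "free_eq X u v \<Longrightarrow> u \<in> fwords X \<and> v \<in> fwords X"
  by (induction rule: free_eq.induct) auto

lemma equiv_free_rel: "equiv (fwords X) (free_rel X)"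
  unfolding equiv_def refl_on_def sym_def trans_def free_rel_def
  by (auto dest: free_eq_in intro: free_eq.intros)

lemma free_eq_append_left:
  assumes "free_eq X u v" "w \<in> fwords X"
  shows "free_eq X (w @ u) (w @ v)"
  using assms
proof (induction rule: free_eq.induct)
  case (cancel u v x b)
  then have "free_eq X ((w @ u) @ [(x, b), (x, \<not> b)] @ v) ((w @ u) @ v)"
    by (intro free_eq.cancel) auto
  then show ?case by simp
next
  case (refl u)
  then show ?case by (intro free_eq.refl) auto
qed (blast intro: free_eq.intros)+

lemma free_eq_append_right:
  assumes "free_eq X u v" "w \<in> fwords X"
  shows "free_eq X (u @ w) (v @ w)"
  using assms
proof (induction rule: free_eq.induct)
  case (cancel u v x b)
  then have "free_eq X (u @ [(x, b), (x, \<not> b)] @ (v @ w)) (u @ (v @ w))"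
    by (intro free_eq.cancel) auto
  then show ?case by simp
next
  case (refl u)
  then show ?case by (intro free_eq.refl) auto
qed (blast intro: free_eq.intros)+

lemma free_eq_append:
  assumes "free_eq X u u'" "free_eq X v v'"
  shows "free_eq X (u @ v) (u' @ v')"
  using free_eq_append_left[OF assms(2)] free_eq_append_right[OF assms(1)]
    free_eq_in[OF assms(1)] free_eq_in[OF assms(2)]
  by (blast intro: free_eq.trans)

lemma congruent2_free: "congruent2 (free_rel X) (free_rel X) (\<lambda>a b. free_rel X `` {a @ b})"
proof (rule congruent2I')
  fix a a' b b' assume "(a, a') \<in> free_rel X" "(b, b') \<in> free_rel X"
  then have "(a @ b, a' @ b') \<in> free_rel X"
    by (auto simp: free_rel_def intro: free_eq_append)
  then show "free_rel X `` {a @ b} = free_rel X `` {a' @ b'}"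
    by (rule equiv_class_eq[OF equiv_free_rel])
qed

lemma free_mult_class:
  assumes "u \<in> fwords X" "v \<in> fwords X"
  shows "free_rel X `` {u} \<otimes>\<^bsub>free_group X\<^esub> free_rel X `` {v} = free_rel X `` {u @ v}"
  using UN_equiv_class2[OF equiv_free_rel equiv_free_rel congruent2_free assms]
  by (simp add: free_group_def)

lemma free_class_in: "u \<in> fwords X \<Longrightarrow> free_rel X `` {u} \<in> carrier (free_group X)"
  by (simp add: free_group_def quotientI)

lemma free_carrierE:
  assumes "A \<in> carrier (free_group X)"
  obtains u where "u \<in> fwords X" "A = free_rel X `` {u}"
  using assms that unfolding free_group_def by (auto elim!: quotientE)

definition fword_inv :: "'a fword \<Rightarrow> 'a fword"
  where "fword_inv w = rev (map (\<lambda>(x, b). (x, \<not> b)) w)"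

lemma fword_inv_in: "w \<in> fwords X \<Longrightarrow> fword_inv w \<in> fwords X"
  by (auto simp: fword_inv_def)

lemma free_eq_inv: "w \<in> fwords X \<Longrightarrow> free_eq X (fword_inv w @ w) []"
proof (induction w)
  case Nil
  then show ?case by (simp add: fword_inv_def free_eq.refl)
next
  case (Cons a w)
  obtain x b where a: "a = (x, b)" by (cases a)
  have w: "w \<in> fwords X" "x \<in> X" using Cons.prems a by auto
  have "free_eq X (fword_inv w @ [(x, \<not> b), (x, \<not> \<not> b)] @ w) (fword_inv w @ w)"
    by (rule free_eq.cancel) (use w fword_inv_in in auto)
  then have "free_eq X (fword_inv (a # w) @ a # w) (fword_inv w @ w)"
    by (simp add: fword_inv_def a)
  then show ?case using Cons.IH[OF w(1)] by (rule free_eq.trans)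
qed

lemma free_group_is_group: "group (free_group X)"
proof (rule groupI)
  show one: "\<one>\<^bsub>free_group X\<^esub> \<in> carrier (free_group X)"
    using free_class_in[of "[]" X] by (simp add: free_group_def)
  have one_def: "\<one>\<^bsub>free_group X\<^esub> = free_rel X `` {[]}"
    by (simp add: free_group_def)
  fix A assume A: "A \<in> carrier (free_group X)"
  then obtain u where u: "u \<in> fwords X" "A = free_rel X `` {u}" by (rule free_carrierE)
  show "\<one>\<^bsub>free_group X\<^esub> \<otimes>\<^bsub>free_group X\<^esub> A = A"
    using u by (simp add: one_def free_mult_class)
  have "free_rel X `` {fword_inv u @ u} = free_rel X `` {[]}"
    by (rule equiv_class_eq[OF equiv_free_rel]) (simp add: free_rel_def free_eq_inv u)
  then show "\<exists>B\<in>carrier (free_group X). B \<otimes>\<^bsub>free_group X\<^esub> A = \<one>\<^bsub>free_group X\<^esub>"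
    using u fword_inv_in[OF u(1)]
    by (intro bexI[of _ "free_rel X `` {fword_inv u}"])
       (auto simp: one_def free_mult_class free_class_in)
  fix B assume "B \<in> carrier (free_group X)"
  then obtain v where v: "v \<in> fwords X" "B = free_rel X `` {v}" by (rule free_carrierE)
  show "A \<otimes>\<^bsub>free_group X\<^esub> B \<in> carrier (free_group X)"
    using u v by (simp add: free_mult_class free_class_in)
  fix C assume "C \<in> carrier (free_group X)"
  then obtain w where w: "w \<in> fwords X" "C = free_rel X `` {w}" by (rule free_carrierE)
  show "A \<otimes>\<^bsub>free_group X\<^esub> B \<otimes>\<^bsub>free_group X\<^esub> C = A \<otimes>\<^bsub>free_group X\<^esub> (B \<otimes>\<^bsub>free_group X\<^esub> C)"
    using u v w by (simp add: free_mult_class)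
qed


section \<open>Descending central series and free nilpotent groups\<close>

definition comm_subgroup :: "('a, 'b) monoid_scheme \<Rightarrow> 'a set \<Rightarrow> 'a set \<Rightarrow> 'a set"
  where "comm_subgroup G A B =
    generate G {a \<otimes>\<^bsub>G\<^esub> b \<otimes>\<^bsub>G\<^esub> inv\<^bsub>G\<^esub> a \<otimes>\<^bsub>G\<^esub> inv\<^bsub>G\<^esub> b | a b. a \<in> A \<and> b \<in> B}"

text \<open>The series is indexed from 1; the value at 0 is a dummy.\<close>

fun lower_central :: "('a, 'b) monoid_scheme \<Rightarrow> nat \<Rightarrow> 'a set" where
  "lower_central G 0 = carrier G"
| "lower_central G (Suc 0) = carrier G"
| "lower_central G (Suc (Suc i)) = comm_subgroup G (carrier G) (lower_central G (Suc i))"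

definition free_nilpotent :: "nat \<Rightarrow> nat \<Rightarrow> nat fword set set monoid"
  where "free_nilpotent m c =
    free_group {..<m} Mod lower_central (free_group {..<m}) (c + 1)"

lemma (in group) lower_central_normal: "lower_central G i \<lhd> G"
proof (induction i rule: induct_nat_012)
  case (ge2 i)
  let ?N = "lower_central G (Suc i)"
  interpret N: normal ?N G by (rule ge2)
  let ?c = "\<lambda>a b. a \<otimes> b \<otimes> inv a \<otimes> inv b"
  have N: "?N \<subseteq> carrier G" by (rule N.subset)
  have "generate G {?c a b | a b. a \<in> carrier G \<and> b \<in> ?N} \<lhd> G"
  proof (rule normal_generateI)
    show "{?c a b | a b. a \<in> carrier G \<and> b \<in> ?N} \<subseteq> carrier G"
      using N by auto
  next
    fix h g assume "h \<in> {?c a b | a b. a \<in> carrier G \<and> b \<in> ?N}" and g: "g \<in> carrier G"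
    then obtain a b where ab: "h = ?c a b" "a \<in> carrier G" "b \<in> ?N" by blast
    then have b: "b \<in> carrier G" using N by blast
    have "g \<otimes> h \<otimes> inv g = ?c (g \<otimes> a \<otimes> inv g) (g \<otimes> b \<otimes> inv g)"
    proof -
      have "inv g \<otimes> (g \<otimes> x) = x" if "x \<in> carrier G" for x
        using that g by (simp flip: m_assoc)
      then show ?thesis using ab(2) b g by (simp add: ab(1) inv_mult_group m_assoc)
    qed
    moreover have "g \<otimes> b \<otimes> inv g \<in> ?N" using N.inv_op_closed2[OF g ab(3)] .
    moreover have "g \<otimes> a \<otimes> inv g \<in> carrier G" using g ab by simp
    ultimately show "g \<otimes> h \<otimes> inv g \<in> {?c a b | a b. a \<in> carrier G \<and> b \<in> ?N}" by blast
  qed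
  then show ?case by (simp add: comm_subgroup_def)
qed (auto simp: normal_invI subgroup_self)

lemma free_nilpotent_is_group: "group (free_nilpotent m c)"
  unfolding free_nilpotent_def
  by (rule normal.factorgroup_is_group[OF group.lower_central_normal[OF free_group_is_group]])


section \<open>Word length and distortion\<close>

definition word_length :: "('a, 'b) monoid_scheme \<Rightarrow> 'a set \<Rightarrow> 'a \<Rightarrow> nat"
  where "word_length G S w =
    (LEAST n. \<exists>ws. length ws = n \<and> set ws \<subseteq> S \<union> m_inv G ` S \<and> foldr (mult G) ws \<one>\<^bsub>G\<^esub> = w)"

text \<open>The maximum below is over a finite nonempty set whenever \<open>T\<close> and \<open>S\<close> are finite generating
  sets: see \<open>distortion_set\<close>. Words over \<open>S\<close> are evaluated in \<open>G\<close>, which agrees with evaluating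
  them in the subgroup \<open>H\<close>.\<close>

definition distortion ::
    "('a, 'b) monoid_scheme \<Rightarrow> 'a set \<Rightarrow> 'a set \<Rightarrow> 'a set \<Rightarrow> nat \<Rightarrow> nat"
  where "distortion G T H S n = Max {word_length G S w | w. w \<in> H \<and> word_length G T w \<le> n}"

text \<open>Since the functions live on the naturals, so does the constant \<open>C\<close>; for a nondecreasing
  \<open>g\<close>, in particular for distortion functions, a positive real constant could be rounded up.\<close>

definition dominated :: "(nat \<Rightarrow> nat) \<Rightarrow> (nat \<Rightarrow> nat) \<Rightarrow> bool"  (infix \<open>\<preceq>\<^sub>g\<close> 50)
  where "f \<preceq>\<^sub>g g \<longleftrightarrow> (\<exists>C>0. \<forall>n. f n \<le> C * g (C * n + C))"

definition growth_equiv :: "(nat \<Rightarrow> nat) \<Rightarrow> (nat \<Rightarrow> nat) \<Rightarrow> bool"  (infix \<open>\<approx>\<^sub>g\<close> 50)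
  where "f \<approx>\<^sub>g g \<longleftrightarrow> f \<preceq>\<^sub>g g \<and> g \<preceq>\<^sub>g f"

definition finite_generators :: "('a, 'b) monoid_scheme \<Rightarrow> 'a set \<Rightarrow> 'a set \<Rightarrow> bool"
  where "finite_generators G H S \<longleftrightarrow> finite S \<and> S \<subseteq> carrier G \<and> generate G S = H"

text \<open>The choice of generating sets is immaterial: see \<open>undistorted_iff\<close> below.\<close>

definition undistorted :: "('a, 'b) monoid_scheme \<Rightarrow> 'a set \<Rightarrow> bool"
  where "undistorted G H \<longleftrightarrow>
    (\<exists>T S. finite_generators G (carrier G) T \<and> finite_generators G H S \<and>
           distortion G T H S \<approx>\<^sub>g (\<lambda>n. n))"

context group
begin

abbreviation letters_of :: "'a set \<Rightarrow> 'a set"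
  where "letters_of S \<equiv> S \<union> m_inv G ` S"

abbreviation wprod :: "'a list \<Rightarrow> 'a"
  where "wprod ws \<equiv> foldr (\<otimes>) ws \<one>"

lemma wprod_closed: "set ws \<subseteq> carrier G \<Longrightarrow> wprod ws \<in> carrier G"
  by (induction ws) auto

lemma wprod_append:
  "set us \<subseteq> carrier G \<Longrightarrow> set vs \<subseteq> carrier G \<Longrightarrow> wprod (us @ vs) = wprod us \<otimes> wprod vs"
  by (induction us) (auto simp: wprod_closed m_assoc simp del: foldr_append)

lemma letters_closed: "S \<subseteq> carrier G \<Longrightarrow> letters_of S \<subseteq> carrier G"
  by auto

lemma generate_word:
  assumes "S \<subseteq> carrier G" "w \<in> generate G S"
  shows "\<exists>ws. set ws \<subseteq> letters_of S \<and> wprod ws = w"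
  using assms(2)
proof (induction rule: generate.induct)
  case one
  then show ?case by (intro exI[of _ "[]"]) simp
next
  case (incl h)
  then show ?case using assms(1) by (intro exI[of _ "[h]"]) auto
next
  case (inv h)
  then show ?case using assms(1) by (intro exI[of _ "[inv h]"]) auto
next
  case (eng h1 h2)
  then obtain us vs where *: "set us \<subseteq> letters_of S" "wprod us = h1"
    "set vs \<subseteq> letters_of S" "wprod vs = h2" by blast
  then have "wprod (us @ vs) = h1 \<otimes> h2"
    using letters_closed[OF assms(1)] wprod_append[of us vs] by blast
  then show ?case using * by (intro exI[of _ "us @ vs"]) auto
qed

lemma word_length_word:
  assumes "S \<subseteq> carrier G" "w \<in> generate G S"
  obtains ws where "length ws = word_length G S w" "set ws \<subseteq> letters_of S" "wprod ws = w"
proof -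
  from generate_word[OF assms]
  have "\<exists>n ws. length ws = n \<and> set ws \<subseteq> letters_of S \<and> wprod ws = w" by blast
  then have "\<exists>ws. length ws = word_length G S w \<and> set ws \<subseteq> letters_of S \<and> wprod ws = w"
    unfolding word_length_def by (rule LeastI_ex)
  then show thesis using that by blast
qed

lemma word_length_le:
  "set ws \<subseteq> letters_of S \<Longrightarrow> word_length G S (wprod ws) \<le> length ws"
  unfolding word_length_def by (rule Least_le) blast

lemma word_length_mult_le:
  assumes "S \<subseteq> carrier G" "u \<in> generate G S" "v \<in> generate G S"
  shows "word_length G S (u \<otimes> v) \<le> word_length G S u + word_length G S v"
proof -
  obtain us where us: "length us = word_length G S u" "set us \<subseteq> letters_of S" "wprod us = u"
    using word_length_word[OF assms(1,2)] .
  obtain vs where vs: "length vs = word_length G S v" "set vs \<subseteq> letters_of S" "wprod vs = v"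
    using word_length_word[OF assms(1,3)] .
  have "wprod (us @ vs) = u \<otimes> v"
    using us vs letters_closed[OF assms(1)] wprod_append[of us vs] by blast
  then show ?thesis
    using word_length_le[of "us @ vs" S] us vs by (simp del: foldr_append)
qed

lemma finite_word_ball:
  assumes "finite T" "T \<subseteq> carrier G"
  shows "finite {w \<in> generate G T. word_length G T w \<le> n}"
proof -
  have "{w \<in> generate G T. word_length G T w \<le> n}
      \<subseteq> wprod ` {ws. set ws \<subseteq> letters_of T \<and> length ws \<le> n}"
    by (auto elim!: word_length_word[OF assms(2)])
  then show ?thesis
    using finite_lists_length_le[of "letters_of T" n] assms(1)
    by (meson finite_Un finite_imageI finite_subset)
qed

lemma word_length_change:
  assumes S: "finite_generators G H S" and S': "finite_generators G H S'"
  shows "\<exists>C. \<forall>w\<in>H. word_length G S' w \<le> C * word_length G S w"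
proof -
  note S = S[unfolded finite_generators_def] and S' = S'[unfolded finite_generators_def]
  define C where "C = Max (insert 0 (word_length G S' ` letters_of S))"
  have C: "word_length G S' s \<le> C" if "s \<in> letters_of S" for s
    unfolding C_def using that S by (intro Max_ge) auto
  have in_H: "letters_of S \<subseteq> H" using S by (auto intro: generate.incl generate.inv)
  have one_H: "\<one> \<in> H" using S generate.one by blast
  have "wprod ws \<in> H \<and> word_length G S' (wprod ws) \<le> C * length ws" if "set ws \<subseteq> letters_of S" for ws
    using that
  proof (induction ws)
    case Nil
    then show ?case using one_H word_length_le[of "[]" S'] by simp
  next
    case (Cons s ws)
    then have s: "s \<in> letters_of S" "s \<in> H" and IH: "wprod ws \<in> H"
      "word_length G S' (wprod ws) \<le> C * length ws" using in_H by auto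
    have "s \<otimes> wprod ws \<in> H" using s IH S generate.eng by metis
    moreover have "word_length G S' (s \<otimes> wprod ws) \<le> word_length G S' s + word_length G S' (wprod ws)"
      using S' s IH by (intro word_length_mult_le) auto
    ultimately show ?case using C[OF s(1)] IH by simp
  qed
  then show ?thesis using S word_length_word[of S] by metis
qed

lemma distortion_set:
  assumes "finite_generators G (carrier G) T" "finite_generators G H S"
  shows "finite {word_length G S w | w. w \<in> H \<and> word_length G T w \<le> n}"
    and "{word_length G S w | w. w \<in> H \<and> word_length G T w \<le> n} \<noteq> {}"
proof -
  have H: "H \<subseteq> carrier G" "\<one> \<in> H"
    using assms(2) generate_incl generate.one by (auto simp: finite_generators_def)
  have "finite {w \<in> carrier G. word_length G T w \<le> n}"
    using finite_word_ball[of T n] assms(1) by (simp add: finite_generators_def)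
  then have "finite {w. w \<in> H \<and> word_length G T w \<le> n}"
    by (rule rev_finite_subset) (use H in auto)
  then show "finite {word_length G S w | w. w \<in> H \<and> word_length G T w \<le> n}" by simp
  show "{word_length G S w | w. w \<in> H \<and> word_length G T w \<le> n} \<noteq> {}"
    using H(2) word_length_le[of "[]" T] by auto
qed

lemma distortion_mono:
  assumes "finite_generators G (carrier G) T" "finite_generators G H S" "n \<le> k"
  shows "distortion G T H S n \<le> distortion G T H S k"
  unfolding distortion_def
  by (rule Max_mono) (use distortion_set[OF assms(1,2)] assms(3) in \<open>auto intro: order.trans\<close>)

lemma distortion_change:
  assumes T: "finite_generators G (carrier G) T" and S: "finite_generators G H S"
    and T': "finite_generators G (carrier G) T'" and S': "finite_generators G H S'"
  shows "distortion G T H S \<preceq>\<^sub>g distortion G T' H S'"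
proof -
  obtain A where A: "\<And>w. w \<in> H \<Longrightarrow> word_length G S w \<le> A * word_length G S' w"
    using word_length_change[OF S' S] by blast
  obtain B where B: "\<And>w. w \<in> carrier G \<Longrightarrow> word_length G T' w \<le> B * word_length G T w"
    using word_length_change[OF T T'] by blast
  have H: "H \<subseteq> carrier G" using S generate_incl by (auto simp: finite_generators_def)
  define C where "C = A + B + 1"
  have "distortion G T H S n \<le> C * distortion G T' H S' (C * n + C)" for n
    unfolding distortion_def[of G T]
  proof (rule Max.boundedI[OF distortion_set[OF T S]])
    fix k assume "k \<in> {word_length G S w | w. w \<in> H \<and> word_length G T w \<le> n}"
    then obtain w where w: "k = word_length G S w" "w \<in> H" "word_length G T w \<le> n" by blast
    have "word_length G T' w \<le> B * word_length G T w" using B w H by blast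
    also have "\<dots> \<le> C * n" using w by (intro mult_le_mono) (auto simp: C_def)
    finally have "word_length G T' w \<le> C * n + C" by simp
    then have "word_length G S' w \<le> distortion G T' H S' (C * n + C)"
      unfolding distortion_def using w by (intro Max_ge[OF distortion_set(1)[OF T' S']]) blast
    then have "A * word_length G S' w \<le> C * distortion G T' H S' (C * n + C)"
      by (intro mult_le_mono) (auto simp: C_def)
    then show "k \<le> C * distortion G T' H S' (C * n + C)" using A[OF w(2)] w(1) by simp
  qed
  then show ?thesis unfolding dominated_def by (intro exI[of _ C]) (auto simp: C_def)
qed

end

lemma dominated_trans:
  assumes "f \<preceq>\<^sub>g g" "g \<preceq>\<^sub>g h" "mono h"
  shows "f \<preceq>\<^sub>g h"
proof -
  obtain C where C: "C > 0" "\<And>n. f n \<le> C * g (C * n + C)" using assms(1) by (auto simp: dominated_def)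
  obtain D where D: "D > 0" "\<And>n. g n \<le> D * h (D * n + D)" using assms(2) by (auto simp: dominated_def)
  define E where "E = C * D + D"
  have "f n \<le> E * h (E * n + E)" for n
  proof -
    have "f n \<le> C * g (C * n + C)" by (rule C)
    also have "\<dots> \<le> C * (D * h (D * (C * n + C) + D))" using D(2) by (rule mult_le_mono2)
    also have "\<dots> \<le> C * (D * h (E * n + E))"
      by (intro mult_le_mono2 monoD[OF assms(3)]) (simp add: E_def algebra_simps)
    also have "\<dots> \<le> E * h (E * n + E)" by (simp add: E_def algebra_simps)
    finally show ?thesis .
  qed
  then show ?thesis using D unfolding dominated_def by (intro exI[of _ E]) (auto simp: E_def)
qed

theorem (in group) undistorted_iff:
  assumes T: "finite_generators G (carrier G) T" and S: "finite_generators G H S"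
  shows "undistorted G H \<longleftrightarrow> distortion G T H S \<approx>\<^sub>g (\<lambda>n. n)"
proof
  assume "undistorted G H"
  then obtain T' S' where T': "finite_generators G (carrier G) T'"
    and S': "finite_generators G H S'" and eq: "distortion G T' H S' \<approx>\<^sub>g (\<lambda>n. n)"
    by (auto simp: undistorted_def)
  have "mono (distortion G T H S)" "mono (\<lambda>n::nat. n)"
    using distortion_mono[OF T S] by (auto simp: mono_def)
  then show "distortion G T H S \<approx>\<^sub>g (\<lambda>n. n)"
    using eq distortion_change[OF T S T' S'] distortion_change[OF T' S' T S] dominated_trans
    unfolding growth_equiv_def by blast
qed (use assms in \<open>auto simp: undistorted_def\<close>)


section \<open>Virtual retracts\<close>

definition retract_of :: "('a, 'b) monoid_scheme \<Rightarrow> 'a set \<Rightarrow> 'a set \<Rightarrow> bool"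
  where "retract_of G H K \<longleftrightarrow> H \<subseteq> K \<and>
    (\<exists>\<rho> \<in> hom (G\<lparr>carrier := K\<rparr>) (G\<lparr>carrier := H\<rparr>). \<forall>h\<in>H. \<rho> h = h)"

definition finite_index :: "('a, 'b) monoid_scheme \<Rightarrow> 'a set \<Rightarrow> bool"
  where "finite_index G K \<longleftrightarrow> finite (rcosets\<^bsub>G\<^esub> K)"

end

theory Submission
  imports Defs Complex_Main "HOL-Library.Multiset"
begin

text \<open>
  The Magnus map \<open>\<mu>\<close>, sending \<open>x\<^sub>i\<close> to \<open>1 + X\<^sub>i\<close>, embeds \<open>F\<close> into the units of the algebra of
  noncommutative power series over the rationals truncated above degree \<open>c\<close>, and
  it turns the degree filtration into the descending central series. This is proved by Lazard
  elimination of iterated commutators: the group becomes a product of cyclic groups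
  \<open>\<langle>z\<^sub>j\<rangle>\<close>, while ordered monomials in the leading terms of the \<open>z\<^sub>j\<close> span each homogeneous
  component; counting words shows that there are no more of them than the dimension, so that
  the leading terms are linearly independent.

  If \<open>H\<close> is undistorted, every additive function \<open>f\<close> from \<open>H\<close> to the rationals vanishes on
  \<open>H \<inter> [F, F]\<close>: elements of \<open>[F, F]\<close> have powers of sublinear length, and \<open>f\<close> is bounded by a
  multiple of the length in \<open>H\<close>. Choose generators \<open>x\<^sub>j\<close> completing the linear parts of \<open>H\<close> to a basis.
  A homomorphism \<open>\<phi>\<close> on \<open>F\<close> that agrees with \<open>\<mu>\<close> on \<open>H\<close> and kills these \<open>x\<^sub>j\<close> is built degree by
  degree, because the defect in the next degree is additive on \<open>H\<close>, hence a function of the linear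
  part. On the subgroup \<open>K\<close> of all \<open>a\<close> with \<open>\<phi>(a) \<in> \<mu>(H)\<close>, the map \<open>\<mu>\<inverse> \<circ> \<phi>\<close> is a retraction onto \<open>H\<close>,
  and \<open>K\<close> has finite index since its image in the abelianization of \<open>F\<close> has.

  Conversely, Schreier generators show that a subgroup of finite index is undistorted, a retraction
  does not increase lengths for suitable generators, and \<open>H\<close> is infinite because \<open>F\<close> is
  torsion-free.
\<close>

section \<open>Commutators and the descending central series\<close>

text \<open>The passage to a subgroup \<open>K\<close> comes from division. Correcting
  \<open>\<phi>\<close> means solving linear equations on a rational basis of linear parts, so the
  values of \<open>\<phi>\<close> lie in the rational algebra and in general leave the image of
  \<open>\<mu>\<close>. Only where a value falls into \<open>\<mu>(H)\<close> can it be pulled back,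
  and injectivity of \<open>\<mu>\<close> makes the pullback unique. The obstruction to a correction
  is an additive function on \<open>H\<close> that does not factor through the linear part, that is,
  one that is nonzero somewhere on \<open>H \<inter> [F, F]\<close>; this is what being undistorted
  excludes. Freeness lets a correction prescribed on the generators alone extend to a homomorphism.
  The length estimate on [F, F] and the step from the abelianization to the index of
  \<open>K\<close> share one mechanism: a claim about some positive power is carried along the
  descending central series, one central factor at a time, and on such a factor commutators are
  bilinear. The trivial subgroup has distortion constantly 0, which does not dominate the identity;
  a nontrivial one has elements of every length.\<close>

definition comm :: "('a, 'b) monoid_scheme \<Rightarrow> 'a \<Rightarrow> 'a \<Rightarrow> 'a"
  where "comm G a b = a \<otimes>\<^bsub>G\<^esub> b \<otimes>\<^bsub>G\<^esub> inv\<^bsub>G\<^esub> a \<otimes>\<^bsub>G\<^esub> inv\<^bsub>G\<^esub> b"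

context group
begin

lemma inv_mult_cancel:
  "a \<in> carrier G \<Longrightarrow> x \<in> carrier G \<Longrightarrow> inv a \<otimes> (a \<otimes> x) = x"
  "a \<in> carrier G \<Longrightarrow> x \<in> carrier G \<Longrightarrow> a \<otimes> (inv a \<otimes> x) = x"
  by (simp_all flip: m_assoc)

lemma commute_inv:
  assumes "a \<in> carrier G" "b \<in> carrier G" "a \<otimes> b = b \<otimes> a"
  shows "inv a \<otimes> b = b \<otimes> inv a"
proof -
  have "inv a \<otimes> (a \<otimes> b) \<otimes> inv a = inv a \<otimes> (b \<otimes> a) \<otimes> inv a" by (simp only: assms(3))
  then show ?thesis using assms(1,2) by (simp add: m_assoc inv_mult_cancel)
qed

lemma comm_closed [simp, intro]: "a \<in> carrier G \<Longrightarrow> b \<in> carrier G \<Longrightarrow> comm G a b \<in> carrier G"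
  by (simp add: comm_def)

lemma comm_inv: "a \<in> carrier G \<Longrightarrow> b \<in> carrier G \<Longrightarrow> inv (comm G a b) = comm G b a"
  by (simp add: comm_def inv_mult_group m_assoc)

lemma comm_mult: "a \<in> carrier G \<Longrightarrow> b \<in> carrier G \<Longrightarrow> comm G a b \<otimes> (b \<otimes> a) = a \<otimes> b"
  by (simp add: comm_def m_assoc inv_mult_cancel)

lemma comm_eq_one_iff:
  assumes "a \<in> carrier G" "b \<in> carrier G"
  shows "comm G a b = \<one> \<longleftrightarrow> a \<otimes> b = b \<otimes> a"
proof
  assume "comm G a b = \<one>"
  then show "a \<otimes> b = b \<otimes> a" using comm_mult[OF assms] assms by simp
next
  assume "a \<otimes> b = b \<otimes> a"
  then show "comm G a b = \<one>" using assms by (simp add: comm_def m_assoc inv_mult_cancel)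
qed

lemma comm_eqI:
  assumes "a \<in> carrier G" "b \<in> carrier G" "z \<in> carrier G" "a \<otimes> b = z \<otimes> (b \<otimes> a)"
  shows "comm G a b = z"
proof -
  have "comm G a b = (a \<otimes> b) \<otimes> (inv a \<otimes> inv b)" using assms(1,2) by (simp add: comm_def m_assoc)
  then show ?thesis using assms(1-3) by (simp add: assms(4) m_assoc inv_mult_cancel)
qed

text \<open>This replaces the Hall--Witt identity in the proof that \<open>[\<gamma>\<^sub>i, \<gamma>\<^sub>j] \<subseteq> \<gamma>\<^sub>i\<^sub>+\<^sub>j\<close>:
  conjugation by \<open>b\<close> multiplies \<open>y\<close> by a central element and \<open>x\<close> by one commuting with \<open>y\<close>,
  hence fixes \<open>[x, y]\<close>.\<close>

lemma comm_commutes: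
  assumes c: "x \<in> carrier G" "y \<in> carrier G" "b \<in> carrier G"
    and z: "\<And>u. u \<in> carrier G \<Longrightarrow> comm G b y \<otimes> u = u \<otimes> comm G b y"
    and d: "comm G (inv x) b \<otimes> y = y \<otimes> comm G (inv x) b"
  shows "comm G x y \<otimes> b = b \<otimes> comm G x y"
proof -
  define z where "z = comm G b y"
  define d where "d = comm G (inv x) b"
  have zc: "z \<in> carrier G" and dc: "d \<in> carrier G" using c by (simp_all add: z_def d_def)
  have by1: "b \<otimes> y = z \<otimes> (y \<otimes> b)" using c comm_mult[of b y] by (simp add: z_def)
  have bx: "b \<otimes> x = x \<otimes> (d \<otimes> b)"
    using c by (simp add: d_def comm_def m_assoc inv_mult_cancel)
  have zi: "inv z \<otimes> u = u \<otimes> inv z" if "u \<in> carrier G" for u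
    using commute_inv[OF zc that] z[OF that] by (simp add: z_def)
  have di: "y \<otimes> (inv d \<otimes> u) = inv d \<otimes> (y \<otimes> u)" if "u \<in> carrier G" for u
  proof -
    have "inv d \<otimes> (d \<otimes> y) \<otimes> inv d \<otimes> u = inv d \<otimes> (y \<otimes> d) \<otimes> inv d \<otimes> u"
      using d by (simp add: d_def)
    then show ?thesis using that dc c by (simp add: m_assoc inv_mult_cancel)
  qed
  have e1: "b \<otimes> inv x = inv d \<otimes> (inv x \<otimes> b)"
  proof -
    have "inv d \<otimes> inv x \<otimes> (b \<otimes> x) \<otimes> inv x = inv d \<otimes> inv x \<otimes> (x \<otimes> (d \<otimes> b)) \<otimes> inv x" by (simp add: bx)
    then show ?thesis using c dc by (simp add: m_assoc inv_mult_cancel)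
  qed
  have e2: "b \<otimes> inv y = inv y \<otimes> (inv z \<otimes> b)"
  proof -
    have "inv y \<otimes> inv z \<otimes> (b \<otimes> y) \<otimes> inv y = inv y \<otimes> inv z \<otimes> (z \<otimes> (y \<otimes> b)) \<otimes> inv y" by (simp add: by1)
    then show ?thesis using c zc by (simp add: m_assoc inv_mult_cancel)
  qed
  \<comment> \<open>\<open>b\<close> is moved to the right through \<open>x\<close>,
    \<open>y\<close>, \<open>inv x\<close>, \<open>inv y\<close> in turn, leaving behind
    \<open>d\<close>, \<open>z\<close>, \<open>inv d\<close>, \<open>inv z\<close>. These cancel
    because \<open>z\<close> is central and \<open>d\<close> commutes with \<open>y\<close>.\<close>
  have "b \<otimes> comm G x y = (b \<otimes> x) \<otimes> (y \<otimes> (inv x \<otimes> inv y))" using c by (simp add: comm_def m_assoc)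
  also have "\<dots> = x \<otimes> (d \<otimes> ((b \<otimes> y) \<otimes> (inv x \<otimes> inv y)))" using c dc by (simp add: bx m_assoc)
  also have "\<dots> = x \<otimes> (d \<otimes> (z \<otimes> (y \<otimes> ((b \<otimes> inv x) \<otimes> inv y))))" using c dc zc by (simp add: by1 m_assoc)
  also have "\<dots> = x \<otimes> (d \<otimes> (z \<otimes> (y \<otimes> (inv d \<otimes> (inv x \<otimes> (b \<otimes> inv y))))))" using c dc zc by (simp add: e1 m_assoc)
  also have "\<dots> = x \<otimes> (d \<otimes> (z \<otimes> (inv d \<otimes> (y \<otimes> (inv x \<otimes> (inv y \<otimes> (inv z \<otimes> b)))))))"
    using c dc zc by (simp add: e2 di)
  also have "\<dots> = x \<otimes> (d \<otimes> (z \<otimes> (inv d \<otimes> (y \<otimes> (inv x \<otimes> (inv y \<otimes> (b \<otimes> inv z)))))))"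
    using c zi by simp
  also have "\<dots> = x \<otimes> (d \<otimes> (z \<otimes> ((inv d \<otimes> (y \<otimes> (inv x \<otimes> (inv y \<otimes> b)))) \<otimes> inv z)))"
    using c dc zc by (simp add: m_assoc)
  also have "\<dots> = x \<otimes> (d \<otimes> (z \<otimes> (inv z \<otimes> (inv d \<otimes> (y \<otimes> (inv x \<otimes> (inv y \<otimes> b)))))))"
    using c dc zc by (subst zi) simp_all
  also have "\<dots> = comm G x y \<otimes> b" using c dc zc by (simp add: m_assoc inv_mult_cancel comm_def)
  finally show ?thesis by simp
qed

text \<open>Moving one \<open>a\<close> past one \<open>b\<close> costs one factor
  \<open>[a, b]\<close>, which is central and can be collected; there are \<open>n * k\<close> such
  moves.\<close>

lemma comm_pow:
  assumes c: "a \<in> carrier G" "b \<in> carrier G"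
    and z: "\<And>u. u \<in> carrier G \<Longrightarrow> comm G a b \<otimes> u = u \<otimes> comm G a b"
  shows "comm G (a [^] (n::nat)) (b [^] (k::nat)) = comm G a b [^] (n * k)"
proof -
  define z where "z = comm G a b"
  have zc: "z \<in> carrier G" using c by (simp add: z_def)
  have zp: "z [^] (i::nat) \<otimes> u = u \<otimes> z [^] i" if "u \<in> carrier G" for i u
    using group_commutes_pow[OF z[OF that, folded z_def] zc that] .
  have ab: "a \<otimes> b = z \<otimes> (b \<otimes> a)" using c by (simp add: z_def comm_mult)
  have 1: "a [^] n \<otimes> b = z [^] n \<otimes> (b \<otimes> a [^] n)" for n :: nat
  proof (induction n)
    case (Suc n)
    have "a [^] Suc n \<otimes> b = a [^] n \<otimes> (a \<otimes> b)" using c by (simp add: m_assoc)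
    also have "\<dots> = (a [^] n \<otimes> z) \<otimes> (b \<otimes> a)" using c zc by (simp add: ab m_assoc)
    also have "\<dots> = z \<otimes> (a [^] n \<otimes> b) \<otimes> a"
      using c zc z[of "a [^] n", folded z_def] by (simp flip: m_assoc)
    also have "\<dots> = (z [^] n \<otimes> z) \<otimes> (b \<otimes> (a [^] n \<otimes> a))"
      using c zc zp[of z n] by (simp add: Suc) (simp flip: m_assoc)
    finally show ?case by simp
  qed (use c in simp)
  have 2: "a [^] n \<otimes> b [^] k = z [^] (n * k) \<otimes> (b [^] k \<otimes> a [^] n)" for k :: nat
  proof (induction k)
    case (Suc k)
    have "a [^] n \<otimes> b [^] Suc k = (a [^] n \<otimes> b [^] k) \<otimes> b" using c by (simp add: m_assoc)
    also have "\<dots> = z [^] (n * k) \<otimes> (b [^] k \<otimes> (a [^] n \<otimes> b))" using c zc by (simp add: Suc m_assoc)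
    also have "\<dots> = z [^] (n * k) \<otimes> (z [^] n \<otimes> b [^] k \<otimes> (b \<otimes> a [^] n))"
      using c zc zp[of "b [^] k" n] by (simp add: 1 m_assoc)
    also have "\<dots> = (z [^] (n * k) \<otimes> z [^] n) \<otimes> (b [^] Suc k \<otimes> a [^] n)"
      using c zc by (simp add: m_assoc)
    finally show ?case using zc by (simp add: nat_pow_mult add.commute)
  qed (use c in simp)
  show ?thesis by (rule comm_eqI) (use c zc 2 in \<open>simp_all add: z_def\<close>)
qed

end

declare mult_FactGroup [simp del] one_FactGroup [simp del] lower_central.simps(3) [simp del]

section \<open>Calculating in a quotient through coset representatives\<close>

context normal
begin

lemma Mod_group: "group (G Mod H)" by (rule factorgroup_is_group)

lemma Mod_mult: "a \<in> carrier G \<Longrightarrow> b \<in> carrier G \<Longrightarrow>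
    (H #> a) \<otimes>\<^bsub>G Mod H\<^esub> (H #> b) = H #> (a \<otimes> b)"
  by (simp add: FactGroup_def rcos_sum)

lemma Mod_closed: "a \<in> carrier G \<Longrightarrow> H #> a \<in> carrier (G Mod H)"
  by (simp add: FactGroup_def rcosetsI subset)

lemma Mod_carrierE:
  assumes "A \<in> carrier (G Mod H)" obtains a where "a \<in> carrier G" "A = H #> a"
  using assms by (auto simp: FactGroup_def RCOSETS_def)

lemma Mod_hom: "group_hom G (G Mod H) (\<lambda>a. H #> a)"
  using r_coset_hom_Mod Mod_group is_group by (simp add: group_hom_def group_hom_axioms_def)

lemma Mod_eq_iff:
  assumes "a \<in> carrier G" "b \<in> carrier G"
  shows "H #> a = H #> b \<longleftrightarrow> a \<otimes> inv b \<in> H"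
proof
  assume "H #> a = H #> b"
  then have "a \<in> H #> b" using rcos_self[OF assms(1) is_subgroup] by simp
  then show "a \<otimes> inv b \<in> H" using rcos_module_imp[OF is_group assms(2)] by blast
next
  assume "a \<otimes> inv b \<in> H"
  then have "a \<in> H #> b" using rcos_module_rev[OF is_group assms(2,1)] by blast
  then show "H #> a = H #> b" using repr_independence[OF _ assms(2) is_subgroup] by blast
qed

lemma Mod_one: "\<one>\<^bsub>G Mod H\<^esub> = H #> \<one>"
  using coset_mult_one[OF subset] by (simp add: FactGroup_def)

lemma Mod_eq_one_iff: "a \<in> carrier G \<Longrightarrow> H #> a = \<one>\<^bsub>G Mod H\<^esub> \<longleftrightarrow> a \<in> H"
  using Mod_eq_iff[of a \<one>] by (simp add: Mod_one)

lemma Mod_inv: "a \<in> carrier G \<Longrightarrow> inv\<^bsub>G Mod H\<^esub> (H #> a) = H #> inv a"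
  using group_hom.hom_inv[OF Mod_hom] by simp

lemma Mod_pow: "a \<in> carrier G \<Longrightarrow> (H #> a) [^]\<^bsub>G Mod H\<^esub> (n::nat) = H #> (a [^] n)"
  using group_hom.hom_nat_pow[OF Mod_hom] by simp

lemma Mod_comm: "a \<in> carrier G \<Longrightarrow> b \<in> carrier G \<Longrightarrow>
    comm (G Mod H) (H #> a) (H #> b) = H #> comm G a b"
  by (simp add: comm_def Mod_inv Mod_mult)

lemma Mod_commute_iff:
  assumes "a \<in> carrier G" "b \<in> carrier G"
  shows "(H #> a) \<otimes>\<^bsub>G Mod H\<^esub> (H #> b) = (H #> b) \<otimes>\<^bsub>G Mod H\<^esub> (H #> a) \<longleftrightarrow> comm G a b \<in> H"
  using group.comm_eq_one_iff[OF Mod_group Mod_closed Mod_closed] assms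
  by (metis Mod_comm Mod_eq_one_iff comm_closed)

text \<open>The preimage of the centralizer of the class of \<open>b\<close>. As it is a subgroup, a
  commutator condition modulo \<open>H\<close> can be tested on generators of the first
  argument.\<close>

lemma centralizer_Mod_subgroup:
  assumes b: "b \<in> carrier G"
  shows "subgroup {a \<in> carrier G. comm G a b \<in> H} G"
proof (rule subgroupI)
  let ?C = "\<lambda>a. (H #> a) \<otimes>\<^bsub>G Mod H\<^esub> (H #> b) = (H #> b) \<otimes>\<^bsub>G Mod H\<^esub> (H #> a)"
  have eq: "a \<in> {a \<in> carrier G. comm G a b \<in> H} \<longleftrightarrow> a \<in> carrier G \<and> ?C a" for a
    using Mod_commute_iff b by blast
  interpret Q: group "G Mod H" by (rule Mod_group)
  have "comm G \<one> b = \<one>" using b by (simp add: comm_def)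
  then show "{a \<in> carrier G. comm G a b \<in> H} \<noteq> {}"
    by (auto intro!: exI[of _ \<one>])
  fix a assume "a \<in> {a \<in> carrier G. comm G a b \<in> H}"
  then have a: "a \<in> carrier G" "?C a" unfolding eq by auto
  have "?C (inv a)"
    using Q.commute_inv[OF Mod_closed Mod_closed a(2)] a b by (simp add: Mod_inv)
  then show "inv a \<in> {a \<in> carrier G. comm G a b \<in> H}" unfolding eq using a by simp
  fix a' assume "a' \<in> {a \<in> carrier G. comm G a b \<in> H}"
  then have a': "a' \<in> carrier G" "?C a'" unfolding eq by auto
  let ?a = "H #> a" and ?a' = "H #> a'" and ?b = "H #> b"
  have cl: "?a \<in> carrier (G Mod H)" "?a' \<in> carrier (G Mod H)" "?b \<in> carrier (G Mod H)"
    using a a' b Mod_closed by auto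
  have "?a \<otimes>\<^bsub>G Mod H\<^esub> ?a' \<otimes>\<^bsub>G Mod H\<^esub> ?b = ?a \<otimes>\<^bsub>G Mod H\<^esub> (?b \<otimes>\<^bsub>G Mod H\<^esub> ?a')"
    using cl by (simp add: Q.m_assoc a'(2))
  also have "\<dots> = ?b \<otimes>\<^bsub>G Mod H\<^esub> (?a \<otimes>\<^bsub>G Mod H\<^esub> ?a')"
    using cl by (simp add: a(2) flip: Q.m_assoc)
  finally have "?C (a \<otimes> a')" using a a' by (simp add: Mod_mult)
  then show "a \<otimes> a' \<in> {a \<in> carrier G. comm G a b \<in> H}" unfolding eq using a a' by simp
qed auto

end

section \<open>Commutators and powers along the descending central series\<close>

context group
begin

abbreviation "\<gamma> \<equiv> lower_central G"

lemma gamma_subgroup: "subgroup (\<gamma> i) G"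
  using lower_central_normal normal_imp_subgroup by blast

lemma gamma_carrier: "a \<in> \<gamma> i \<Longrightarrow> a \<in> carrier G"
  using gamma_subgroup subgroup.mem_carrier by metis

lemma gamma_Suc:
  "i \<ge> 1 \<Longrightarrow> \<gamma> (Suc i) = generate G {comm G a b | a b. a \<in> carrier G \<and> b \<in> \<gamma> i}"
  by (cases i) (simp_all add: lower_central.simps(3) comm_subgroup_def comm_def)

lemma comm_in_gamma_Suc:
  assumes "i \<ge> 1" "a \<in> carrier G" "b \<in> \<gamma> i"
  shows "comm G a b \<in> \<gamma> (Suc i)"
  unfolding gamma_Suc[OF assms(1)] using assms by (auto intro: generate.incl)

lemma comm_in_gamma_Suc':
  assumes "i \<ge> 1" "a \<in> \<gamma> i" "b \<in> carrier G"
  shows "comm G a b \<in> \<gamma> (Suc i)"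
  using comm_in_gamma_Suc[OF assms(1,3,2)] comm_inv[of b a] gamma_carrier[OF assms(2)] assms(3)
    subgroup.m_inv_closed[OF gamma_subgroup] by metis

lemma gamma_Suc_subset: "\<gamma> (Suc i) \<subseteq> \<gamma> i"
proof (cases "i = 0")
  case False
  interpret N: normal "\<gamma> i" G by (rule lower_central_normal)
  have "comm G a b \<in> \<gamma> i" if "a \<in> carrier G" "b \<in> \<gamma> i" for a b
    using N.inv_op_closed2[OF that] that N.m_inv_closed N.m_closed by (simp add: comm_def)
  then have sub: "{comm G a b | a b. a \<in> carrier G \<and> b \<in> \<gamma> i} \<subseteq> \<gamma> i" by auto
  show ?thesis
    using False generate_subgroup_incl[OF sub gamma_subgroup] by (simp add: gamma_Suc)
qed (use gamma_carrier in auto)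

lemma gamma_antimono: "i \<le> j \<Longrightarrow> \<gamma> j \<subseteq> \<gamma> i"
  by (induction rule: dec_induct) (use gamma_Suc_subset in blast)+

text \<open>Induction on \<open>i\<close> for all \<open>j\<close> at once. For a generator
  \<open>[x, y]\<close> of the next term, \<open>comm_commutes\<close> is applied modulo
  \<open>\<gamma> (Suc (i + j))\<close>: the hypothesis for \<open>i, j\<close> makes
  \<open>[b, y]\<close> central there, and the hypothesis for \<open>i, Suc j\<close> makes
  \<open>y\<close> commute with \<open>[inv x, b]\<close>.\<close>

lemma comm_in_gamma_add:
  assumes "i \<ge> 1" "j \<ge> 1" "a \<in> \<gamma> i" "b \<in> \<gamma> j"
  shows "comm G a b \<in> \<gamma> (i + j)"
  using assms
proof (induction i arbitrary: j a b rule: nat_induct_at_least)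
  case base
  then show ?case using comm_in_gamma_Suc[of j a b] gamma_carrier by simp
next
  case (Suc i)
  interpret N: normal "\<gamma> (Suc (i + j))" G by (rule lower_central_normal)
  interpret Q: group "G Mod \<gamma> (Suc (i + j))" by (rule N.Mod_group)
  have b: "b \<in> carrier G" using Suc.prems gamma_carrier by blast
  have "{comm G x y | x y. x \<in> carrier G \<and> y \<in> \<gamma> i}
      \<subseteq> {a \<in> carrier G. comm G a b \<in> \<gamma> (Suc (i + j))}"
  proof clarsimp
    fix x y assume x: "x \<in> carrier G" and yi: "y \<in> \<gamma> i"
    then have y: "y \<in> carrier G" using gamma_carrier by blast
    have 1: "comm G b y \<in> \<gamma> (i + j)"
      using Suc.IH[OF Suc.prems(1) yi Suc.prems(3)] comm_inv[OF y b]
        subgroup.m_inv_closed[OF gamma_subgroup] by metis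
    have z: "comm G (comm G b y) u \<in> \<gamma> (Suc (i + j))" if "u \<in> carrier G" for u
      using comm_in_gamma_Suc'[OF _ 1 that] Suc.hyps by simp
    have "comm G (inv x) b \<in> \<gamma> (Suc j)"
      using comm_in_gamma_Suc[OF Suc.prems(1) _ Suc.prems(3), of "inv x"] x by simp
    then have "comm G y (comm G (inv x) b) \<in> \<gamma> (i + Suc j)"
      by (intro Suc.IH yi) simp_all
    then have d: "comm G (comm G (inv x) b) y \<in> \<gamma> (Suc (i + j))"
      using comm_inv[of y "comm G (inv x) b"] x y b N.m_inv_closed by (metis add_Suc_right comm_closed inv_closed)
    show "comm G x y \<in> carrier G \<and> comm G (comm G x y) b \<in> \<gamma> (Suc (i + j))"
    proof
      let ?q = "\<lambda>a. \<gamma> (Suc (i + j)) #> a" and ?Q = "G Mod \<gamma> (Suc (i + j))"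
      have "comm ?Q (?q x) (?q y) \<otimes>\<^bsub>?Q\<^esub> ?q b = ?q b \<otimes>\<^bsub>?Q\<^esub> comm ?Q (?q x) (?q y)"
      proof (rule Q.comm_commutes)
        fix U assume "U \<in> carrier ?Q"
        then obtain u where u: "u \<in> carrier G" "U = ?q u" by (rule N.Mod_carrierE)
        then show "comm ?Q (?q b) (?q y) \<otimes>\<^bsub>?Q\<^esub> U = U \<otimes>\<^bsub>?Q\<^esub> comm ?Q (?q b) (?q y)"
          using z[OF u(1)] b y by (simp add: N.Mod_comm N.Mod_commute_iff)
      next
        show "comm ?Q (inv\<^bsub>?Q\<^esub> ?q x) (?q b) \<otimes>\<^bsub>?Q\<^esub> ?q y = ?q y \<otimes>\<^bsub>?Q\<^esub> comm ?Q (inv\<^bsub>?Q\<^esub> ?q x) (?q b)"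
          using d b x y by (simp add: N.Mod_comm N.Mod_inv N.Mod_commute_iff)
      qed (use x y b N.Mod_closed in auto)
      then show "comm G (comm G x y) b \<in> \<gamma> (Suc (i + j))"
        using b x y by (simp add: N.Mod_comm N.Mod_commute_iff)
    qed (use x y in simp)
  qed
  then have "\<gamma> (Suc i) \<subseteq> {a \<in> carrier G. comm G a b \<in> \<gamma> (Suc (i + j))}"
    using generate_subgroup_incl[OF _ N.centralizer_Mod_subgroup[OF b]] gamma_Suc[of i] Suc.hyps by simp
  then show ?case using Suc.prems(2) by auto
qed

text \<open>Removes the error factors when \<open>s \<otimes> k\<close> and
  \<open>t \<otimes> k'\<close> approximate powers. The conditions are asymmetric because in the
  application \<open>t\<close> is central, whereas \<open>s\<close> only lies in
  \<open>\<gamma> 2\<close> and need not commute with \<open>k\<close>.\<close>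

lemma comm_mult_mult:
  assumes c: "s \<in> carrier G" "k \<in> carrier G" "t \<in> carrier G" "k' \<in> carrier G"
    and t: "\<And>u. u \<in> carrier G \<Longrightarrow> t \<otimes> u = u \<otimes> t"
    and s: "s \<otimes> k' = k' \<otimes> s" "s \<otimes> comm G k k' = comm G k k' \<otimes> s"
  shows "comm G (s \<otimes> k) (t \<otimes> k') = comm G k k'"
proof (rule comm_eqI)
  let ?C = "comm G k k'"
  have "s \<otimes> k \<otimes> (t \<otimes> k') = (s \<otimes> k \<otimes> t) \<otimes> k'" using c by (simp add: m_assoc)
  also have "s \<otimes> k \<otimes> t = t \<otimes> (s \<otimes> k)" using t[of "s \<otimes> k"] c by simp
  also have "t \<otimes> (s \<otimes> k) \<otimes> k' = t \<otimes> (s \<otimes> (k \<otimes> k'))" using c by (simp add: m_assoc)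
  also have "k \<otimes> k' = ?C \<otimes> (k' \<otimes> k)" using c by (simp add: comm_mult)
  also have "s \<otimes> (?C \<otimes> (k' \<otimes> k)) = (s \<otimes> ?C) \<otimes> (k' \<otimes> k)" using c by (simp add: m_assoc)
  also have "\<dots> = ?C \<otimes> ((s \<otimes> k') \<otimes> k)" unfolding s(2) using c by (simp add: m_assoc)
  also have "\<dots> = ?C \<otimes> (k' \<otimes> (s \<otimes> k))" unfolding s(1) using c by (simp add: m_assoc)
  also have "t \<otimes> \<dots> = (t \<otimes> ?C) \<otimes> (k' \<otimes> (s \<otimes> k))" using c by (simp add: m_assoc)
  also have "\<dots> = ?C \<otimes> (t \<otimes> k' \<otimes> (s \<otimes> k))" using c t[of ?C] by (simp add: m_assoc)
  finally show "s \<otimes> k \<otimes> (t \<otimes> k') = ?C \<otimes> (t \<otimes> k' \<otimes> (s \<otimes> k))" .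
qed (use c in simp_all)

lemma gamma_central_Mod:
  assumes "i \<ge> 1" "z \<in> \<gamma> i" "U \<in> carrier (G Mod \<gamma> (Suc i))"
  shows "(\<gamma> (Suc i) #> z) \<otimes>\<^bsub>G Mod \<gamma> (Suc i)\<^esub> U = U \<otimes>\<^bsub>G Mod \<gamma> (Suc i)\<^esub> (\<gamma> (Suc i) #> z)"
proof -
  interpret N: normal "\<gamma> (Suc i)" G by (rule lower_central_normal)
  obtain u where "u \<in> carrier G" "U = \<gamma> (Suc i) #> u" using assms(3) by (rule N.Mod_carrierE)
  then show ?thesis
    using comm_in_gamma_Suc'[OF assms(1,2)] gamma_carrier[OF assms(2)] by (simp add: N.Mod_commute_iff)
qed

lemma gamma_pow_mult_Mod:
  assumes "i \<ge> 1" "z \<in> \<gamma> i" "u \<in> carrier G"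
  shows "\<gamma> (Suc i) #> (z \<otimes> u) [^] (k::nat) = \<gamma> (Suc i) #> (z [^] k \<otimes> u [^] k)"
proof -
  interpret N: normal "\<gamma> (Suc i)" G by (rule lower_central_normal)
  interpret Q: group "G Mod \<gamma> (Suc i)" by (rule N.Mod_group)
  have "z \<in> carrier G" using assms gamma_carrier by blast
  then show ?thesis
    using Q.pow_mult_distrib[OF gamma_central_Mod[OF assms(1,2) N.Mod_closed[OF assms(3)]], of k]
      assms(3) N.Mod_closed
    by (simp add: N.Mod_mult N.Mod_pow)
qed

text \<open>The relation \<open>R l n u\<close> reads "\<open>u\<close> is an admissible representative of an \<open>n\<close>-th power",
  with precision \<open>l\<close>. A power of \<open>g\<close> is admissible modulo the whole series once this can be
  arranged one central step at a time.\<close>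

lemma power_admissible_mod_gamma:
  fixes R :: "nat \<Rightarrow> nat \<Rightarrow> 'a \<Rightarrow> bool"
  assumes s: "s \<ge> 1" "g \<in> \<gamma> s"
    and carr: "\<And>l n u. R l n u \<Longrightarrow> u \<in> carrier G"
    and one: "\<And>l. R l 1 \<one>"
    and mult: "\<And>l. \<exists>l'. \<forall>n>0. \<forall>k>0. \<forall>u v. R l' n u \<longrightarrow> R l' k v \<longrightarrow> R l (n * k) (v \<otimes> u [^] k)"
    and step: "\<And>i z l. i \<ge> s \<Longrightarrow> z \<in> \<gamma> i \<Longrightarrow>
      \<exists>k>0. \<exists>v. R l k v \<and> \<gamma> (Suc i) #> z [^] k = \<gamma> (Suc i) #> v"
    and t: "t \<ge> s"
  shows "\<exists>n>0. \<exists>u. R l n u \<and> \<gamma> t #> g [^] n = \<gamma> t #> u"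
  using t
proof (induction t arbitrary: l rule: dec_induct)
  case base
  interpret N: normal "\<gamma> s" G by (rule lower_central_normal)
  have "\<gamma> s #> g [^] (1::nat) = \<gamma> s #> \<one>"
    using N.Mod_eq_iff[of g \<one>] s gamma_carrier by simp
  then show ?case using one by blast
next
  case (step t)
  interpret N: normal "\<gamma> t" G by (rule lower_central_normal)
  interpret M: normal "\<gamma> (Suc t)" G by (rule lower_central_normal)
  have g: "g \<in> carrier G" using s gamma_carrier by blast
  \<comment> \<open>The precision that both factors require is fixed before the induction hypothesis
    is used; for this reason the induction leaves \<open>l\<close> arbitrary.\<close>
  obtain l' where l': "\<forall>n>0. \<forall>k>0. \<forall>u v. R l' n u \<longrightarrow> R l' k v \<longrightarrow> R l (n * k) (v \<otimes> u [^] k)"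
    using mult[of l] by (rule exE)
  obtain n u where n: "n > 0" "R l' n u" "\<gamma> t #> g [^] n = \<gamma> t #> u"
    using step.IH by blast
  have u: "u \<in> carrier G" using carr n by blast
  \<comment> \<open>The error of the current approximation lies in \<open>\<gamma> t\<close>, hence
    is central modulo the next term, where the \<open>k\<close>-th power of
    \<open>z \<otimes> u\<close> splits and \<open>z [^] k\<close> can be replaced by an admissible
    \<open>v\<close>.\<close>
  define z where "z = g [^] n \<otimes> inv u"
  have z: "z \<in> \<gamma> t" using n(3) N.Mod_eq_iff[of "g [^] n" u] g u by (simp add: z_def)
  then have zc: "z \<in> carrier G" by (rule gamma_carrier)
  obtain k v where k: "k > 0" "R l' k v" "\<gamma> (Suc t) #> z [^] k = \<gamma> (Suc t) #> v"
    using assms(6)[OF step.hyps(1) z] by blast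
  have v: "v \<in> carrier G" using carr k by blast
  have "g [^] n = z \<otimes> u" using g u by (simp add: z_def m_assoc)
  then have "\<gamma> (Suc t) #> g [^] (n * k) = \<gamma> (Suc t) #> (z [^] k \<otimes> u [^] k)"
    using gamma_pow_mult_Mod[OF _ z u, of k] step.hyps s(1) nat_pow_pow[OF g, of n k] by simp
  also have "\<dots> = \<gamma> (Suc t) #> (v \<otimes> u [^] k)"
    using k(3) zc u v by (simp flip: M.Mod_mult)
  finally show ?case using l' n(1,2) k(1,2)
    by (intro exI[of _ "n * k"] conjI exI[of _ "v \<otimes> u [^] k"]) simp_all
qed

section \<open>Powers of sublinear length\<close>

lemma word_length_pow_le:
  assumes "finite_generators G (carrier G) T" "u \<in> carrier G"
  shows "word_length G T (u [^] (n::nat)) \<le> n * word_length G T u"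
proof (induction n)
  case 0
  then show ?case using word_length_le[of "[]" T] by simp
next
  case (Suc n)
  have "word_length G T (u [^] n \<otimes> u) \<le> word_length G T (u [^] n) + word_length G T u"
    using assms by (intro word_length_mult_le) (auto simp: finite_generators_def)
  then show ?case using Suc by simp
qed

lemma word_length_mult_le':
  assumes "finite_generators G (carrier G) T" "u \<in> carrier G" "v \<in> carrier G"
  shows "word_length G T (u \<otimes> v) \<le> word_length G T u + word_length G T v"
  using assms by (intro word_length_mult_le) (auto simp: finite_generators_def)

text \<open>Central commutators are bilinear: the \<open>n\<^sup>2\<close>-th power of \<open>[a, b]\<close> is the commutator of the \<open>n\<close>-th
  powers, whose length is linear in \<open>n\<close>.\<close>

lemma gamma_square_power_length:
  assumes T: "finite_generators G (carrier G) T" and i: "i \<ge> 1" and z: "z \<in> \<gamma> (Suc i)"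
  shows "\<exists>C. \<forall>n. \<exists>v\<in>carrier G. word_length G T v \<le> C * n \<and>
    \<gamma> (Suc (Suc i)) #> z [^] (n * n) = \<gamma> (Suc (Suc i)) #> v"
proof -
  let ?N = "\<gamma> (Suc (Suc i))" and ?Q = "G Mod \<gamma> (Suc (Suc i))"
  interpret N: normal ?N G by (rule lower_central_normal)
  interpret Q: group ?Q by (rule N.Mod_group)
  let ?P = "\<lambda>z. \<exists>C. \<forall>n. \<exists>v\<in>carrier G. word_length G T v \<le> C * n \<and> ?N #> z [^] (n * n) = ?N #> v"
  note len = word_length_mult_le'[OF T] and pow = word_length_pow_le[OF T]
  have comm: "?P (comm G a b)" if ab: "a \<in> carrier G" "b \<in> carrier G" "comm G a b \<in> \<gamma> (Suc i)" for a b
  proof (intro exI[of _ "word_length G T a + word_length G T b + word_length G T (inv a) + word_length G T (inv b)"] allI bexI conjI)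
    fix n :: nat
    have "word_length G T (comm G (a [^] n) (b [^] n)) \<le>
      word_length G T (a [^] n) + word_length G T (b [^] n) + word_length G T ((inv a) [^] n)
      + word_length G T ((inv b) [^] n)"
      unfolding comm_def nat_pow_inv[OF ab(1), symmetric] nat_pow_inv[OF ab(2), symmetric]
      using ab len[of "a [^] n \<otimes> b [^] n \<otimes> inv a [^] n" "inv b [^] n"]
        len[of "a [^] n \<otimes> b [^] n" "inv a [^] n"] len[of "a [^] n" "b [^] n"] by simp
    also have "\<dots> \<le> n * word_length G T a + n * word_length G T b + n * word_length G T (inv a) + n * word_length G T (inv b)"
      using ab by (intro add_mono pow) simp_all
    finally show "word_length G T (comm G (a [^] n) (b [^] n)) \<le>
      (word_length G T a + word_length G T b + word_length G T (inv a) + word_length G T (inv b)) * n"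
      by (simp add: algebra_simps)
    have "comm ?Q ((?N #> a) [^]\<^bsub>?Q\<^esub> n) ((?N #> b) [^]\<^bsub>?Q\<^esub> n) = comm ?Q (?N #> a) (?N #> b) [^]\<^bsub>?Q\<^esub> (n * n)"
      by (rule Q.comm_pow) (use ab gamma_central_Mod[OF _ ab(3)] N.Mod_closed in \<open>simp_all add: N.Mod_comm\<close>)
    then show "?N #> comm G a b [^] (n * n) = ?N #> comm G (a [^] n) (b [^] n)"
      using ab by (simp add: N.Mod_comm N.Mod_pow)
  qed (use ab in simp)
  have "z \<in> \<gamma> (Suc i) \<and> ?P z" if "z \<in> generate G {comm G a b | a b. a \<in> carrier G \<and> b \<in> \<gamma> i}" for z
    using that
  proof (induction rule: generate.induct)
    case one
    have "?P \<one>"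
      by (intro exI[of _ 0] allI bexI[of _ \<one>]) (use word_length_le[of "[]" T] in auto)
    then show ?case using subgroup.one_closed[OF gamma_subgroup] by blast
  next
    case (incl h)
    then obtain a b where "h = comm G a b" "a \<in> carrier G" "b \<in> \<gamma> i" by blast
    then show ?case using comm comm_in_gamma_Suc[OF i] gamma_carrier by metis
  next
    case (inv h)
    then obtain a b where "h = comm G a b" "a \<in> carrier G" "b \<in> \<gamma> i" by blast
    then show ?case using comm[of b a] comm_in_gamma_Suc'[OF i] gamma_carrier comm_inv by metis
  next
    case (eng h1 h2)
    then have h: "h1 \<in> carrier G" "h2 \<in> carrier G" using gamma_carrier by blast+
    obtain C1 where C1: "\<And>n. \<exists>v\<in>carrier G. word_length G T v \<le> C1 * n \<and> ?N #> h1 [^] (n * n) = ?N #> v"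
      using eng.IH by blast
    obtain C2 where C2: "\<And>n. \<exists>v\<in>carrier G. word_length G T v \<le> C2 * n \<and> ?N #> h2 [^] (n * n) = ?N #> v"
      using eng.IH by blast
    have "?P (h1 \<otimes> h2)"
    proof (intro exI[of _ "C1 + C2"] allI)
      fix n
      obtain v1 where v1: "v1 \<in> carrier G" "word_length G T v1 \<le> C1 * n" "?N #> h1 [^] (n * n) = ?N #> v1"
        using C1 by blast
      obtain v2 where v2: "v2 \<in> carrier G" "word_length G T v2 \<le> C2 * n" "?N #> h2 [^] (n * n) = ?N #> v2"
        using C2 by blast
      have "?N #> (h1 \<otimes> h2) [^] (n * n) = ?N #> (h1 [^] (n * n) \<otimes> h2 [^] (n * n))"
        using gamma_pow_mult_Mod[of "Suc i" h1 h2] eng.IH h by simp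
      also have "\<dots> = ?N #> (v1 \<otimes> v2)"
        using v1 v2 h by (simp flip: N.Mod_mult)
      finally show "\<exists>v\<in>carrier G. word_length G T v \<le> (C1 + C2) * n \<and> ?N #> (h1 \<otimes> h2) [^] (n * n) = ?N #> v"
        using v1 v2 len[of v1 v2] by (intro bexI[of _ "v1 \<otimes> v2"]) (auto simp: algebra_simps)
    qed
    then show ?case using eng.IH subgroup.m_closed[OF gamma_subgroup] by blast
  qed
  then show ?thesis using z gamma_Suc[OF i] by blast
qed

text \<open>The precision \<open>l\<close> is the inverse of a slope: admissible elements have
  length at most \<open>n / l\<close>. Every factor of the series beyond the first consists of
  products of commutators, whose square powers \<open>n * n\<close> have length linear in
  \<open>n\<close>.\<close>

lemma derived_sublinear_powers:
  assumes T: "finite_generators G (carrier G) T" and nil: "\<gamma> (Suc c) = {\<one>}"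
    and g: "g \<in> \<gamma> 2"
  shows "\<exists>n>0. l * word_length G T (g [^] (n::nat)) \<le> n"
proof -
  define R where "R = (\<lambda>l n u. u \<in> carrier G \<and> l * word_length G T u \<le> n)"
  note len = word_length_mult_le'[OF T] and pow = word_length_pow_le[OF T]
  \<comment> \<open>The climb starts at index 2, so its end must have index at least 2 also when
    \<open>c = 0\<close>.\<close>
  have nil': "\<gamma> (c + 2) = {\<one>}"
    using nil gamma_antimono[of "Suc c" "c + 2"] subgroup.one_closed[OF gamma_subgroup] by auto
  have "\<exists>n>0. \<exists>u. R l n u \<and> \<gamma> (c + 2) #> g [^] n = \<gamma> (c + 2) #> u"
  proof (rule power_admissible_mod_gamma[of 2])
    fix l
    show "R l 1 \<one>" using word_length_le[of "[]" T] by (simp add: R_def)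
    show "\<exists>l'. \<forall>n>0. \<forall>k>0. \<forall>u v. R l' n u \<longrightarrow> R l' k v \<longrightarrow> R l (n * k) (v \<otimes> u [^] k)"
    \<comment> \<open>The length of \<open>v \<otimes> u [^] k\<close> is at most
      \<open>k / (2 * l) + k * n / (2 * l)\<close>, and both summands are at most half of
      \<open>n * k / l\<close>.\<close>
    proof (intro exI[of _ "2 * l"] allI impI)
      fix n k :: nat and u v assume n: "n > 0" "k > 0" and u: "R (2 * l) n u" "R (2 * l) k v"
      then have c: "u \<in> carrier G" "v \<in> carrier G" by (simp_all add: R_def)
      have "2 * (l * word_length G T (v \<otimes> u [^] k)) \<le> 2 * (l * (word_length G T v + k * word_length G T u))"
        using len[of v "u [^] k"] pow[of u k] c by (intro mult_le_mono2) simp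
      also have "\<dots> = 2 * l * word_length G T v + k * (2 * l * word_length G T u)"
        by (simp add: algebra_simps)
      also have "\<dots> \<le> k + k * n" using u by (intro add_mono mult_le_mono2) (simp_all add: R_def)
      also have "\<dots> \<le> 2 * (n * k)" using n by (cases n) simp_all
      finally show "R l (n * k) (v \<otimes> u [^] k)" using c by (simp add: R_def)
    qed
    fix i z assume i: "2 \<le> i" and z: "z \<in> \<gamma> i"
    then obtain j where j: "i = Suc j" "j \<ge> 1" by (cases i) auto
    obtain C where C: "\<And>n. \<exists>v\<in>carrier G. word_length G T v \<le> C * n \<and>
      \<gamma> (Suc i) #> z [^] (n * n) = \<gamma> (Suc i) #> v"
      using gamma_square_power_length[OF T j(2)] z j(1) by blast
    \<comment> \<open>The exponent will be \<open>n * n\<close>, with length at most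
      \<open>C * n\<close>; the choice gives \<open>l * C * n \<le> n * n\<close>, and the summand 1
      keeps the exponent positive.\<close>
    define n where "n = l * C + 1"
    obtain v where v: "v \<in> carrier G" "word_length G T v \<le> C * n" "\<gamma> (Suc i) #> z [^] (n * n) = \<gamma> (Suc i) #> v"
      using C by blast
    have "l * word_length G T v \<le> l * (C * n)" using v by (intro mult_le_mono2)
    also have "\<dots> \<le> n * n" by (simp add: n_def algebra_simps)
    finally show "\<exists>k>0. \<exists>v. R l k v \<and> \<gamma> (Suc i) #> z [^] k = \<gamma> (Suc i) #> v"
      using v by (intro exI[of _ "n * n"]) (auto simp: R_def n_def)
  qed (use g in \<open>auto simp: R_def\<close>)
  then obtain n u where n: "n > 0" "R l n u" "\<gamma> (c + 2) #> g [^] n = \<gamma> (c + 2) #> u" by blast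
  then have "g [^] n = u"
    using gamma_carrier[OF g] nil' by (simp add: r_coset_def R_def)
  then show ?thesis using n by (auto simp: R_def)
qed

text \<open>If powers of \<open>x\<close> and \<open>y\<close> agree with \<open>k\<close> and
  \<open>k'\<close> in \<open>K\<close> up to terms one step further down, then by bilinearity a
  power of \<open>[x, y]\<close> agrees with \<open>[k, k']\<close>, again in \<open>K\<close>. So
  the condition on the abelianization spreads to every factor of the series.\<close>

lemma power_in_subgroup_mod_gamma:
  assumes K: "subgroup K G" and i: "i \<ge> 1"
    and ab: "\<And>g. g \<in> carrier G \<Longrightarrow> \<exists>N>0. \<exists>k\<in>K. g [^] (N::nat) \<otimes> inv k \<in> \<gamma> 2"
    and z: "z \<in> \<gamma> i"
  shows "\<exists>N>0. \<exists>k\<in>K. \<gamma> (Suc i) #> z [^] (N::nat) = \<gamma> (Suc i) #> k"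
  using i z
proof (induction i arbitrary: z rule: nat_induct_at_least)
  case base
  interpret N: normal "\<gamma> 2" G by (rule lower_central_normal)
  have "z \<in> carrier G" using base gamma_carrier by blast
  then show ?case
    using ab[of z] N.Mod_eq_iff subgroup.mem_carrier[OF K] by (metis Suc_1 nat_pow_closed)
next
  case (Suc i)
  let ?N = "\<gamma> (Suc (Suc i))" and ?Q = "G Mod \<gamma> (Suc (Suc i))"
  interpret N: normal ?N G by (rule lower_central_normal)
  interpret Q: group ?Q by (rule N.Mod_group)
  interpret K: subgroup K G by (rule K)
  let ?P = "\<lambda>z. \<exists>N>0. \<exists>k\<in>K. ?N #> z [^] (N::nat) = ?N #> k"
  have comm: "comm G x y \<in> \<gamma> (Suc i) \<and> ?P (comm G x y)" if x: "x \<in> carrier G" and y: "y \<in> \<gamma> i" for x y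
  proof -
    interpret M: normal "\<gamma> (Suc i)" G by (rule lower_central_normal)
    have yc: "y \<in> carrier G" using y by (rule gamma_carrier)
    have cxy: "comm G x y \<in> \<gamma> (Suc i)" using comm_in_gamma_Suc[OF Suc.hyps x y] .
    obtain N k where N: "N > 0" "k \<in> K" "x [^] (N::nat) \<otimes> inv k \<in> \<gamma> 2" using ab[OF x] by blast
    obtain M k' where M: "M > 0" "k' \<in> K" "\<gamma> (Suc i) #> y [^] (M::nat) = \<gamma> (Suc i) #> k'"
      using Suc.IH[OF y] by blast
    have kc: "k \<in> carrier G" "k' \<in> carrier G" using N M K.mem_carrier by auto
    define s where "s = x [^] N \<otimes> inv k"
    define t where "t = y [^] M \<otimes> inv k'"
    have s: "s \<in> \<gamma> 2" "s \<in> carrier G" "x [^] N = s \<otimes> k"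
      using N x kc by (simp_all add: s_def m_assoc)
    have t: "t \<in> \<gamma> (Suc i)" "t \<in> carrier G" "y [^] M = t \<otimes> k'"
      using M(3) M.Mod_eq_iff[of "y [^] M" k'] yc kc by (simp_all add: t_def m_assoc)
    \<comment> \<open>\<open>k'\<close> inherits the weight \<open>i\<close> of \<open>y\<close>;
      only then does \<open>s\<close>, of weight 2, commute with it modulo
      \<open>\<gamma> (Suc (Suc i))\<close>.\<close>
    have "k' = inv t \<otimes> y [^] M" using t kc yc by (simp add: inv_mult_cancel)
    moreover have "inv t \<in> \<gamma> i"
      using t(1) gamma_Suc_subset subgroup.m_inv_closed[OF gamma_subgroup] by blast
    moreover have ym: "y [^] M \<in> \<gamma> i" for M :: nat
      using y by (induction M) (auto intro: subgroup.one_closed[OF gamma_subgroup] subgroup.m_closed[OF gamma_subgroup])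
    ultimately have k': "k' \<in> \<gamma> i" using subgroup.m_closed[OF gamma_subgroup] by metis
    have sk': "comm G s k' \<in> ?N"
      using comm_in_gamma_add[of 2 i s k'] s k' Suc.hyps by simp
    have ckk: "comm G k k' \<in> \<gamma> (Suc i)" using comm_in_gamma_Suc[OF Suc.hyps kc(1) k'] .
    have "comm G s (comm G k k') \<in> ?N" using comm_in_gamma_Suc[OF _ s(2) ckk] by simp
    then have "comm ?Q ((?N #> s) \<otimes>\<^bsub>?Q\<^esub> (?N #> k)) ((?N #> t) \<otimes>\<^bsub>?Q\<^esub> (?N #> k')) = comm ?Q (?N #> k) (?N #> k')"
      using s t kc sk' gamma_central_Mod[OF _ t(1)] N.Mod_closed
      by (intro Q.comm_mult_mult) (simp_all add: N.Mod_comm N.Mod_commute_iff)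
    then have 1: "?N #> comm G (x [^] N) (y [^] M) = ?N #> comm G k k'"
      using s t kc x yc by (simp add: N.Mod_mult N.Mod_comm)
    have "comm ?Q ((?N #> x) [^]\<^bsub>?Q\<^esub> N) ((?N #> y) [^]\<^bsub>?Q\<^esub> M) = comm ?Q (?N #> x) (?N #> y) [^]\<^bsub>?Q\<^esub> (N * M)"
      by (rule Q.comm_pow) (use x yc gamma_central_Mod[OF _ cxy] N.Mod_closed in \<open>simp_all add: N.Mod_comm\<close>)
    then have "?N #> comm G x y [^] (N * M) = ?N #> comm G k k'"
      using x yc 1 by (simp add: N.Mod_comm N.Mod_pow)
    moreover have "comm G k k' \<in> K" using N M by (simp add: comm_def)
    ultimately show ?thesis using cxy N(1) M(1) by (metis nat_0_less_mult_iff)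
  qed
  have "z \<in> \<gamma> (Suc i) \<and> ?P z" if "z \<in> generate G {comm G a b | a b. a \<in> carrier G \<and> b \<in> \<gamma> i}" for z
    using that
  proof (induction rule: generate.induct)
    case one
    have "?P \<one>" by (intro exI[of _ 1] conjI bexI[of _ \<one>]) auto
    then show ?case using subgroup.one_closed[OF gamma_subgroup] by blast
  next
    case (incl h)
    then show ?case using comm by blast
  next
    case (inv h)
    then have h: "h \<in> \<gamma> (Suc i)" "?P h" using comm by blast+
    then obtain N k where N: "N > 0" "k \<in> K" "?N #> h [^] (N::nat) = ?N #> k" by blast
    have hc: "h \<in> carrier G" using h gamma_carrier by blast
    have "?N #> (inv h) [^] N = ?N #> inv k"
      using N(3) hc K.mem_carrier[OF N(2)] by (simp add: nat_pow_inv flip: N.Mod_inv)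
    then show ?case using h N subgroup.m_inv_closed[OF gamma_subgroup] K.m_inv_closed by blast
  next
    case (eng h1 h2)
    then have h: "h1 \<in> carrier G" "h2 \<in> carrier G" using gamma_carrier by blast+
    obtain N1 k1 where 1: "N1 > 0" "k1 \<in> K" "?N #> h1 [^] (N1::nat) = ?N #> k1" using eng.IH by blast
    obtain N2 k2 where 2: "N2 > 0" "k2 \<in> K" "?N #> h2 [^] (N2::nat) = ?N #> k2" using eng.IH by blast
    have kc: "k1 \<in> carrier G" "k2 \<in> carrier G" using 1 2 K.mem_carrier by auto
    have "?N #> (h1 \<otimes> h2) [^] (N1 * N2) = ?N #> (h1 [^] (N1 * N2) \<otimes> h2 [^] (N2 * N1))"
      using gamma_pow_mult_Mod[of "Suc i" h1 h2] eng.IH h by (simp add: mult.commute)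
    also have "\<dots> = (?N #> h1 [^] N1) [^]\<^bsub>?Q\<^esub> N2 \<otimes>\<^bsub>?Q\<^esub> (?N #> h2 [^] N2) [^]\<^bsub>?Q\<^esub> N1"
      using h by (simp add: N.Mod_mult N.Mod_pow nat_pow_pow)
    also have "\<dots> = ?N #> (k1 [^] N2 \<otimes> k2 [^] N1)"
      using 1 2 kc by (simp add: N.Mod_mult N.Mod_pow)
    finally have e: "?N #> (h1 \<otimes> h2) [^] (N1 * N2) = ?N #> (k1 [^] N2 \<otimes> k2 [^] N1)" .
    have "k [^] (n::nat) \<in> K" if "k \<in> K" for k n using that by (induction n) auto
    then have "?P (h1 \<otimes> h2)" using e 1 2 by (metis K.m_closed nat_0_less_mult_iff)
    then show ?case using eng.IH subgroup.m_closed[OF gamma_subgroup] by blast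
  qed
  then show ?case using Suc.prems gamma_Suc[OF Suc.hyps] by blast
qed

text \<open>The same climb along the series, with membership in \<open>K\<close> as admissibility;
  at the trivial term, congruence is equality.\<close>

lemma power_in_subgroup:
  assumes K: "subgroup K G" and nil: "\<gamma> (Suc c) = {\<one>}"
    and ab: "\<And>g. g \<in> carrier G \<Longrightarrow> \<exists>N>0. \<exists>k\<in>K. g [^] (N::nat) \<otimes> inv k \<in> \<gamma> 2"
    and g: "g \<in> carrier G"
  shows "\<exists>N>0. g [^] (N::nat) \<in> K"
proof -
  interpret K: subgroup K G by (rule K)
  have pow: "k [^] (n::nat) \<in> K" if "k \<in> K" for k n using that by (induction n) auto
  have step: "\<exists>k>0. \<exists>v. v \<in> K \<and> \<gamma> (Suc i) #> z [^] (k::nat) = \<gamma> (Suc i) #> v"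
    if "1 \<le> i" "z \<in> \<gamma> i" for i z
    using power_in_subgroup_mod_gamma[OF K that(1) ab that(2)] by (simp add: Bex_def)
  have "\<exists>n>0. \<exists>u. u \<in> K \<and> \<gamma> (Suc c) #> g [^] (n::nat) = \<gamma> (Suc c) #> u"
  proof (rule power_admissible_mod_gamma[where s = 1 and R = "\<lambda>l n u. u \<in> K"])
    show "\<exists>k>0. \<exists>v. v \<in> K \<and> \<gamma> (Suc i) #> z [^] (k::nat) = \<gamma> (Suc i) #> v"
      if "1 \<le> i" "z \<in> \<gamma> i" for i z using step[OF that] .
  qed (use g pow in auto)
  then obtain n u where "n > 0" "u \<in> K" "\<gamma> (Suc c) #> g [^] (n::nat) = \<gamma> (Suc c) #> u" by blast
  then have "g [^] n = u" using g K.mem_carrier by (simp add: nil r_coset_def)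
  then show ?thesis using \<open>n > 0\<close> \<open>u \<in> K\<close> by blast
qed

end

section \<open>Noncommutative formal power series\<close>

text \<open>Coefficients are indexed by words in the variables. Truncation is not built into the
  type: congruence modulo degree above \<open>c\<close> is written
  \<open>vanish (Suc c) (a - b)\<close>, so that one ring serves all \<open>c\<close> and equations
  can be proved by ring normalization.\<close>

typedef ncps = "UNIV :: (nat list \<Rightarrow> rat) set"
  morphisms coeff Ncps by simp

lemma coeff_Ncps [simp]: "coeff (Ncps f) = f"
  by (simp add: Ncps_inverse)

lemma ncps_eqI: "(\<And>w. coeff a w = coeff b w) \<Longrightarrow> a = b"
  by (metis coeff_inject ext)

instantiation ncps :: ring_1
begin

definition "0 = Ncps (\<lambda>w. 0)"
definition "1 = Ncps (\<lambda>w. if w = [] then 1 else 0)"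
definition "a + b = Ncps (\<lambda>w. coeff a w + coeff b w)"
definition "a - b = Ncps (\<lambda>w. coeff a w - coeff b w)"
definition "- a = Ncps (\<lambda>w. - coeff a w)"
definition "a * b = Ncps (\<lambda>w. \<Sum>i\<le>length w. coeff a (take i w) * coeff b (drop i w))"

instance
proof
  fix a b c :: ncps
  show "a * b * c = a * (b * c)"
  proof (rule ncps_eqI)
    fix w :: "nat list"
    let ?n = "length w"
    \<comment> \<open>Both sides are sums over pairs of cut points \<open>j \<le> i\<close> of the
      word.\<close>
    let ?t = "\<lambda>i j. coeff a (take j w) * coeff b (drop j (take i w)) * coeff c (drop i w)"
    let ?S = "{(i, j). j \<le> i \<and> i \<le> ?n}"
    have "coeff (a * b * c) w = (\<Sum>i\<le>?n. \<Sum>j\<le>i. ?t i j)"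
      by (auto simp: times_ncps_def sum_distrib_right min_def intro!: sum.cong)
    also have "\<dots> = (\<Sum>(i, j)\<in>(SIGMA i:{..?n}. {..i}). ?t i j)" by (subst sum.Sigma) auto
    also have "\<dots> = (\<Sum>(j, l)\<in>(SIGMA j:{..?n}. {..?n - j}). ?t (j + l) j)"
      by (rule sum.reindex_bij_witness[of _ "\<lambda>(j, l). (j + l, j)" "\<lambda>(i, j). (j, i - j)"]) auto
    also have "\<dots> = (\<Sum>j\<le>?n. \<Sum>l\<le>?n - j. ?t (j + l) j)" by (subst sum.Sigma) auto
    also have "\<dots> = coeff (a * (b * c)) w"
      by (auto simp: times_ncps_def sum_distrib_left mult.assoc drop_take add.commute intro!: sum.cong)
    finally show "coeff (a * b * c) w = coeff (a * (b * c)) w" .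
  qed
  show "1 * a = a"
  proof (rule ncps_eqI)
    fix w :: "nat list"
    have "coeff (1 * a) w = (\<Sum>i\<le>length w. if i = 0 then coeff a w else 0)"
      unfolding times_ncps_def one_ncps_def coeff_Ncps by (rule sum.cong) auto
    then show "coeff (1 * a) w = coeff a w" by simp
  qed
  show "a * 1 = a"
  proof (rule ncps_eqI)
    fix w :: "nat list"
    have "coeff (a * 1) w = (\<Sum>i\<le>length w. if i = length w then coeff a w else 0)"
      unfolding times_ncps_def one_ncps_def coeff_Ncps by (rule sum.cong) auto
    then show "coeff (a * 1) w = coeff a w" by simp
  qed
  show "(a + b) * c = a * c + b * c" "a * (b + c) = a * b + a * c"
    by (auto simp: times_ncps_def plus_ncps_def distrib_left distrib_right sum.distrib intro!: ncps_eqI)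
  show "(0::ncps) \<noteq> 1"
  proof
    assume "(0::ncps) = 1"
    then have "coeff 0 [] = coeff 1 []" by simp
    then show False by (simp add: zero_ncps_def one_ncps_def)
  qed
qed (auto simp: plus_ncps_def minus_ncps_def uminus_ncps_def zero_ncps_def intro!: ncps_eqI)

end

lemma coeff_simps [simp]:
  "coeff 0 w = 0" "coeff (a + b) w = coeff a w + coeff b w" "coeff (a - b) w = coeff a w - coeff b w"
  "coeff (- a) w = - coeff a w"
  by (simp_all add: zero_ncps_def plus_ncps_def minus_ncps_def uminus_ncps_def)

lemma coeff_one: "coeff 1 w = (if w = [] then 1 else 0)"
  by (simp add: one_ncps_def)

lemma coeff_mult: "coeff (a * b) w = (\<Sum>i\<le>length w. coeff a (take i w) * coeff b (drop i w))"
  by (simp add: times_ncps_def)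

lemma coeff_sum [simp]: "coeff (sum f A) w = (\<Sum>x\<in>A. coeff (f x) w)"
  by (induction A rule: infinite_finite_induct) auto

definition sc :: "rat \<Rightarrow> ncps \<Rightarrow> ncps"
  where "sc q a = Ncps (\<lambda>w. q * coeff a w)"

lemma coeff_sc [simp]: "coeff (sc q a) w = q * coeff a w"
  by (simp add: sc_def)

interpretation ncps: vector_space sc
  by unfold_locales (auto intro!: ncps_eqI simp: algebra_simps)

interpretation ncps2: vector_space_pair sc sc ..

lemma sc_mult_left: "sc q a * b = sc q (a * b)"
  by (rule ncps_eqI) (simp add: coeff_mult sum_distrib_left mult.assoc)

lemma sc_mult_right: "a * sc q b = sc q (a * b)"
  by (rule ncps_eqI) (simp add: coeff_mult sum_distrib_left algebra_simps)

lemma linear_mult_left: "Vector_Spaces.linear sc sc (\<lambda>x. a * x)"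
  and linear_mult_right: "Vector_Spaces.linear sc sc (\<lambda>x. x * a)"
  by unfold_locales (simp_all add: algebra_simps sc_mult_left sc_mult_right)

subsection \<open>The degree filtration\<close>

text \<open>The ideal of series of order at least \<open>k\<close>; \<open>vanish 1 (a - 1)\<close>
  says that the constant term of \<open>a\<close> is 1.\<close>

definition vanish :: "nat \<Rightarrow> ncps \<Rightarrow> bool"
  where "vanish k a \<longleftrightarrow> (\<forall>w. length w < k \<longrightarrow> coeff a w = 0)"

definition hpart :: "nat \<Rightarrow> ncps \<Rightarrow> ncps"
  where "hpart n a = Ncps (\<lambda>w. if length w = n then coeff a w else 0)"

lemma coeff_hpart [simp]: "coeff (hpart n a) w = (if length w = n then coeff a w else 0)"
  by (simp add: hpart_def)

lemma vanish_0 [simp]: "vanish 0 a" "vanish k 0"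
  by (simp_all add: vanish_def)

lemma vanish_antimono: "vanish k a \<Longrightarrow> j \<le> k \<Longrightarrow> vanish j a"
  by (auto simp: vanish_def)

lemma vanish_add: "vanish k a \<Longrightarrow> vanish k b \<Longrightarrow> vanish k (a + b)"
  and vanish_diff: "vanish k a \<Longrightarrow> vanish k b \<Longrightarrow> vanish k (a - b)"
  and vanish_minus: "vanish k a \<Longrightarrow> vanish k (- a)"
  and vanish_diff_commute: "vanish k (a - b) \<longleftrightarrow> vanish k (b - a)"
  by (auto simp: vanish_def)

lemma vanish_trans: "vanish k (a - b) \<Longrightarrow> vanish k (b - c) \<Longrightarrow> vanish k (a - c)"
  by (auto simp: vanish_def)

lemma vanish_mult: "vanish i a \<Longrightarrow> vanish j b \<Longrightarrow> vanish (i + j) (a * b)"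
  unfolding vanish_def coeff_mult
proof (intro allI impI sum.neutral ballI)
  fix w :: "nat list" and k
  assume *: "\<forall>w. length w < i \<longrightarrow> coeff a w = 0" "\<forall>w. length w < j \<longrightarrow> coeff b w = 0"
    "length w < i + j" "k \<in> {..length w}"
  show "coeff a (take k w) * coeff b (drop k w) = 0"
    using * by (cases "k < i") auto
qed

lemma vanish_mult_left: "vanish k b \<Longrightarrow> vanish k (a * b)"
  and vanish_mult_right: "vanish k a \<Longrightarrow> vanish k (a * b)"
  using vanish_mult[of 0 a k b] vanish_mult[of k a 0 b] by simp_all

lemma vanish_hpart: "vanish n (hpart n a)"
  by (simp add: vanish_def)

lemma hpart_simps:
  "hpart n 0 = 0" "hpart n (a + b) = hpart n a + hpart n b" "hpart n (a - b) = hpart n a - hpart n b"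
  "hpart n (- a) = - hpart n a" "hpart n (sc q a) = sc q (hpart n a)" "hpart n (hpart n a) = hpart n a"
  by (auto intro!: ncps_eqI)

lemma hpart_eq_0: "vanish (Suc n) a \<Longrightarrow> hpart n a = 0"
  by (auto simp: vanish_def intro!: ncps_eqI)

lemma hpart_cong: "vanish (Suc n) (a - b) \<Longrightarrow> hpart n a = hpart n b"
  using hpart_eq_0[of n "a - b"] by (simp add: hpart_simps)

lemma vanish_Suc_hpart: "vanish n a \<Longrightarrow> vanish (Suc n) (a - hpart n a)"
  by (auto simp: vanish_def less_Suc_eq)

lemma vanish_Suc_iff: "vanish (Suc n) a \<longleftrightarrow> vanish n a \<and> hpart n a = 0"
  using hpart_eq_0[of n a] vanish_Suc_hpart[of n a] vanish_antimono[of "Suc n" a n] by auto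

text \<open>In a word of length \<open>i + j\<close> only the cut after \<open>i\<close> letters
  contributes; any other cut makes one of the two pieces shorter than the order of its
  factor.\<close>

lemma hpart_mult:
  assumes "vanish i a" "vanish j b"
  shows "hpart (i + j) (a * b) = hpart i a * hpart j b"
proof (rule ncps_eqI)
  fix w :: "nat list"
  have 1: "coeff a (take k w) * coeff b (drop k w) = (if k = i then coeff a (take i w) * coeff b (drop i w) else 0)"
    if "length w = i + j" "k \<le> length w" for k
    using assms that by (cases "k < i") (auto simp: vanish_def)
  have 2: "coeff (hpart i a) (take k w) * coeff (hpart j b) (drop k w) =
    (if length w = i + j \<and> k = i then coeff a (take i w) * coeff b (drop i w) else 0)" if "k \<le> length w" for k
    using that by auto
  have 3: "coeff (hpart i a * hpart j b) w = (\<Sum>k\<le>length w. if length w = i + j \<and> k = i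
      then coeff a (take i w) * coeff b (drop i w) else 0)"
    unfolding coeff_mult by (rule sum.cong) (use 2 in auto)
  show "coeff (hpart (i + j) (a * b)) w = coeff (hpart i a * hpart j b) w"
  proof (cases "length w = i + j")
    case True
    have "coeff (a * b) w = (\<Sum>k\<le>length w. if k = i then coeff a (take i w) * coeff b (drop i w) else 0)"
      unfolding coeff_mult by (rule sum.cong) (use 1[OF True] in auto)
    then show ?thesis unfolding 3 using True by simp
  qed (simp add: 3)
qed

text \<open>In \<open>a = a * b - a * (b - 1)\<close> the last product has order one more than what
  is already known of \<open>a\<close>, so the order of \<open>a\<close> can be raised step by step
  up to \<open>k\<close>.\<close>

lemma vanish_cancel_right:
  assumes "vanish k (a * b)" "vanish 1 (b - 1)"
  shows "vanish k a"
proof -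
  have "vanish j a" if "j \<le> k" for j
    using that
  proof (induction j)
    case (Suc j)
    have "vanish (j + 1) (a * (b - 1))" using Suc assms(2) by (intro vanish_mult) auto
    then have "vanish (Suc j) (a * b - a * (b - 1))"
      using vanish_antimono[OF assms(1) Suc.prems] by (intro vanish_diff) simp_all
    then show ?case by (simp add: algebra_simps)
  qed simp
  then show ?thesis by simp
qed

lemma vanish_one_diff_pow: "vanish 1 (a - 1) \<Longrightarrow> vanish n ((1 - a) ^ n)"
proof (induction n)
  case (Suc n)
  then show ?case using vanish_mult[of 1 "1 - a" n "(1 - a) ^ n"] by (simp add: vanish_diff_commute)
qed simp

text \<open>The geometric series for the inverse of \<open>a\<close>, cut off at degree
  \<open>c\<close>; it makes sense because \<open>1 - a\<close> has order at least 1 whenever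
  \<open>a\<close> has constant term 1.\<close>

definition tinv :: "nat \<Rightarrow> ncps \<Rightarrow> ncps"
  where "tinv c a = (\<Sum>k\<le>c. (1 - a) ^ k)"

lemma tinv:
  assumes "vanish 1 (a - 1)"
  shows "vanish (Suc c) (a * tinv c a - 1)" "vanish (Suc c) (tinv c a * a - 1)" "vanish 1 (tinv c a - 1)"
proof -
  have 1: "tinv c a - (1 - a) * tinv c a = 1 - (1 - a) ^ Suc c"
  proof -
    have "(\<Sum>k\<le>c. b ^ k) - b * (\<Sum>k\<le>c. b ^ k) = 1 - b ^ Suc c" for b :: ncps
    proof (induction c)
      case (Suc c)
      let ?S = "\<Sum>k\<le>c. b ^ k"
      have "?S + b ^ Suc c - b * (?S + b ^ Suc c) = (?S - b * ?S) + b ^ Suc c - b * b ^ Suc c"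
        by (simp add: distrib_left)
      then show ?case using Suc by simp
    qed simp
    then show ?thesis by (simp add: tinv_def)
  qed
  have "tinv c a * (1 - a) = (1 - a) * tinv c a"
    unfolding tinv_def sum_distrib_left sum_distrib_right
    by (rule sum.cong) (simp_all add: power_commutes)
  then have 2: "tinv c a - tinv c a * (1 - a) = 1 - (1 - a) ^ Suc c" using 1 by simp
  have 3: "a * tinv c a - 1 = - ((1 - a) ^ Suc c)"
    using 1 by (simp only: left_diff_distrib mult_1_left) simp
  have 4: "tinv c a * a - 1 = - ((1 - a) ^ Suc c)"
    using 2 by (simp only: right_diff_distrib mult_1_right) simp
  show "vanish (Suc c) (a * tinv c a - 1)" "vanish (Suc c) (tinv c a * a - 1)"
    unfolding 3 4 by (intro vanish_minus vanish_one_diff_pow assms)+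
  have "vanish 1 (tinv c a * a - 1)"
    by (rule vanish_antimono[OF \<open>vanish (Suc c) (tinv c a * a - 1)\<close>]) simp
  from vanish_diff[OF this vanish_mult_left[OF assms, of "tinv c a"]]
  show "vanish 1 (tinv c a - 1)" by (simp add: algebra_simps)
qed

subsection \<open>Monomials\<close>

definition var :: "nat \<Rightarrow> ncps"
  where "var i = Ncps (\<lambda>w. if w = [i] then 1 else 0)"

definition mon :: "nat list \<Rightarrow> ncps"
  where "mon u = Ncps (\<lambda>w. if w = u then 1 else 0)"

lemma coeff_mon [simp]: "coeff (mon u) w = (if w = u then 1 else 0)"
  by (simp add: mon_def)

lemma var_eq_mon: "var i = mon [i]"
  by (simp add: var_def mon_def)

lemma hpart_var: "hpart 1 (var i) = var i"
  by (rule ncps_eqI) (auto simp: var_eq_mon)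

lemma mon_Nil: "mon [] = 1"
  by (rule ncps_eqI) (simp add: coeff_one)

lemma mon_mult: "mon u * mon v = mon (u @ v)"
proof (rule ncps_eqI)
  fix w
  have "coeff (mon u) (take k w) * coeff (mon v) (drop k w) = (if k = length u then if w = u @ v then 1 else 0 else 0)"
    if "k \<le> length w" for k
  proof (cases "k = length u")
    case True
    have "take k w = u \<and> drop k w = v \<longleftrightarrow> w = u @ v"
      using append_eq_conv_conj[of u v w] True by auto
    then show ?thesis using True by auto
  next
    case False
    then have "take k w \<noteq> u" using that by auto
    then show ?thesis using False by simp
  qed
  then have "coeff (mon u * mon v) w = (\<Sum>k\<le>length w. if k = length u then if w = u @ v then 1 else 0 else 0)"
    unfolding coeff_mult by (intro sum.cong) simp_all
  then show "coeff (mon u * mon v) w = coeff (mon (u @ v)) w" by simp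
qed

lemma inj_mon: "inj mon"
proof (rule injI)
  fix u v assume "mon u = mon v"
  then have "coeff (mon u) u = coeff (mon v) u" by simp
  then show "u = v" by (simp split: if_splits)
qed

lemma inj_var: "inj var"
  using inj_mon by (auto simp: inj_def var_eq_mon)

lemma prod_list_var: "prod_list (map var w) = mon w"
  by (induction w) (simp_all add: mon_Nil var_eq_mon mon_mult)

lemma independent_mon: "ncps.independent (mon ` A)"
  unfolding ncps.independent_explicit_module
proof (intro allI impI)
  fix t u v assume t: "finite t" "t \<subseteq> mon ` A" "(\<Sum>v\<in>t. sc (u v) v) = 0" "v \<in> t"
  then obtain w where w: "v = mon w" by blast
  have "coeff (\<Sum>v\<in>t. sc (u v) v) w = (\<Sum>x\<in>t. if x = v then u v else 0)"
    unfolding coeff_sum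
  proof (rule sum.cong)
    fix x assume "x \<in> t"
    then obtain w' where "x = mon w'" using t by blast
    then show "coeff (sc (u x) x) w = (if x = v then u v else 0)" using inj_mon by (auto simp: w inj_eq)
  qed simp
  then show "u v = 0" using t by simp
qed

lemma card_mon_words: "card (mon ` {w. set w \<subseteq> {..<m} \<and> length w = n}) = m ^ n"
  using card_lists_length_eq[of "{..<m}" n] inj_mon
  by (subst card_image) (auto intro: inj_on_subset)

text \<open>A repetition or a redundant entry would leave fewer than \<open>card B\<close> vectors
  spanning the independent set \<open>B\<close>. Lists instead of sets keep track of multiplicity,
  which the counting of monomials requires.\<close>

lemma (in vector_space) spanning_list_basis:
  assumes "independent B" "B \<subseteq> span (set xs)" "length xs \<le> card B"
  shows "distinct xs" "independent (set xs)"
proof -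
  have c: "card B \<le> card (set xs)" using independent_span_bound[OF _ assms(1,2)] by simp
  then have "card (set xs) = length xs" using assms(3) card_length[of xs] by simp
  then show "distinct xs" by (rule card_distinct)
  show "independent (set xs)"
  proof
    assume "dependent (set xs)"
    then obtain x where x: "x \<in> set xs" "x \<in> span (set xs - {x})" by (auto simp: dependent_def)
    then have "span (set xs - {x}) = span (set xs)"
      using span_redundant[OF x(2)] by (simp add: insert_absorb)
    then have "card B \<le> card (set xs - {x})"
      using independent_span_bound[OF _ assms(1), of "set xs - {x}"] assms(2) by simp
    then show False using x(1) c \<open>card (set xs) = length xs\<close> assms(3)
      by (metis List.finite_set card_Diff1_less leD le_trans)
  qed
qed

section \<open>Homomorphisms into truncated power series\<close>

text \<open>Homomorphisms into the units with constant term 1, modulo degree above \<open>c\<close>.\<close>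

definition mhom :: "('a, 'b) monoid_scheme \<Rightarrow> nat \<Rightarrow> ('a \<Rightarrow> ncps) \<Rightarrow> bool"
  where "mhom G c \<phi> \<longleftrightarrow> (\<forall>a\<in>carrier G. vanish 1 (\<phi> a - 1)) \<and>
    (\<forall>a\<in>carrier G. \<forall>b\<in>carrier G. vanish (Suc c) (\<phi> (a \<otimes>\<^bsub>G\<^esub> b) - \<phi> a * \<phi> b))"

lemma mhom_antimono: "mhom G c \<phi> \<Longrightarrow> d \<le> c \<Longrightarrow> mhom G d \<phi>"
  unfolding mhom_def by (blast intro: vanish_antimono Suc_le_mono[THEN iffD2])

lemma of_int_mult_sc: "of_int z * (a :: ncps) = sc (of_int z) a"
proof -
  have nat: "of_nat n * a = sc (of_nat n) a" for n
    by (induction n) (simp_all add: ncps.scale_left_distrib distrib_right)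
  show ?thesis by (cases z rule: int_cases2) (simp_all add: nat)
qed

context group
begin

text \<open>The target is any ring, to serve rational-valued functions as well as leading terms and
  defects with values in \<open>ncps\<close>.\<close>

lemma additive_int_pow:
  fixes f :: "'a \<Rightarrow> 'c :: ring_1"
  assumes H: "subgroup H G" and f: "\<And>a b. a \<in> H \<Longrightarrow> b \<in> H \<Longrightarrow> f (a \<otimes> b) = f a + f b"
  shows "f \<one> = 0" "a \<in> H \<Longrightarrow> f (inv a) = - f a" "a \<in> H \<Longrightarrow> f (a [^] (n::nat)) = of_nat n * f a"
    "a \<in> H \<Longrightarrow> f (a [^] (z::int)) = of_int z * f a"
proof -
  interpret H: subgroup H G by (rule H)
  show one: "f \<one> = 0" using f[of \<one> \<one>] by simp
  show inv: "f (inv a) = - f a" if "a \<in> H" for a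
    using f[of "inv a" a] that one by (simp add: eq_neg_iff_add_eq_0)
  show nat: "f (a [^] (n::nat)) = of_nat n * f a" if "a \<in> H" for a n
  proof (induction n)
    case (Suc n)
    have "a [^] n \<in> H" using that by (induction n) auto
    then show ?case using Suc f that by (simp add: algebra_simps)
  qed (simp add: one)
  show "f (a [^] (z::int)) = of_int z * f a" if "a \<in> H"
  proof (cases "z \<ge> 0")
    case True
    then obtain n where "z = int n" using nonneg_eq_int by blast
    then show ?thesis using nat[OF that] by (simp add: int_pow_int)
  next
    case False
    then obtain n where z: "z = - int n" by (metis int_cases2 of_nat_0_le_iff)
    have "a [^] n \<in> H" using that by (induction n) auto
    then show ?thesis using nat[OF that] inv that by (simp add: z int_pow_neg_int)
  qed
qed

lemma mhomD:
  assumes "mhom G c \<phi>"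
  shows "a \<in> carrier G \<Longrightarrow> vanish 1 (\<phi> a - 1)"
    "a \<in> carrier G \<Longrightarrow> b \<in> carrier G \<Longrightarrow> vanish (Suc c) (\<phi> (a \<otimes> b) - \<phi> a * \<phi> b)"
  using assms by (simp_all add: mhom_def)

lemma mhom_one:
  assumes "mhom G c \<phi>"
  shows "vanish (Suc c) (\<phi> \<one> - 1)"
proof -
  have "vanish (Suc c) (\<phi> \<one> * \<phi> \<one> - \<phi> \<one>)"
    using mhomD(2)[OF assms, of \<one> \<one>] by (simp add: vanish_diff_commute)
  then have "vanish (Suc c) ((\<phi> \<one> - 1) * \<phi> \<one>)" by (simp add: left_diff_distrib)
  then show ?thesis by (rule vanish_cancel_right) (simp add: mhomD(1)[OF assms, simplified])
qed

lemma mhom_inv: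
  assumes "mhom G c \<phi>" "a \<in> carrier G"
  shows "vanish (Suc c) (\<phi> (inv a) * \<phi> a - 1)" "vanish (Suc c) (\<phi> a * \<phi> (inv a) - 1)"
proof -
  have "vanish (Suc c) (\<phi> (inv a) * \<phi> a - \<phi> \<one>)" "vanish (Suc c) (\<phi> a * \<phi> (inv a) - \<phi> \<one>)"
    using mhomD(2)[OF assms(1), of "inv a" a] mhomD(2)[OF assms(1), of a "inv a"] assms(2)
    by (simp_all add: vanish_diff_commute)
  then show "vanish (Suc c) (\<phi> (inv a) * \<phi> a - 1)" "vanish (Suc c) (\<phi> a * \<phi> (inv a) - 1)"
    using mhom_one[OF assms(1)] by (blast intro: vanish_trans)+
qed

lemma vanish_mult_cong:
  assumes "vanish k (a - a')" "vanish k (b - b')"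
  shows "vanish k (a * b - a' * b')"
proof -
  have "a * b - a' * b' = (a - a') * b + a' * (b - b')" by (simp add: algebra_simps)
  then show ?thesis using assms by (simp add: vanish_add vanish_mult_left vanish_mult_right)
qed

lemma mhom_inv_cong:
  assumes \<phi>: "mhom G c \<phi>" and \<psi>: "mhom G c \<psi>" and c: "a \<in> carrier G" "b \<in> carrier G"
    and eq: "vanish (Suc c) (\<phi> a - \<psi> b)"
  shows "vanish (Suc c) (\<phi> (inv a) - \<psi> (inv b))"
proof -
  have 1: "vanish (Suc c) (\<phi> (inv a) * 1 - \<phi> (inv a) * (\<psi> b * \<psi> (inv b)))"
    using mhom_inv[OF \<psi> c(2)] by (intro vanish_mult_cong) (simp_all add: vanish_diff_commute)
  have 2: "vanish (Suc c) (\<phi> (inv a) * \<psi> b * \<psi> (inv b) - \<phi> (inv a) * \<phi> a * \<psi> (inv b))"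
    using eq by (intro vanish_mult_cong) (simp_all add: vanish_diff_commute)
  have 3: "vanish (Suc c) (\<phi> (inv a) * \<phi> a * \<psi> (inv b) - 1 * \<psi> (inv b))"
    using mhom_inv[OF \<phi> c(1)] by (intro vanish_mult_cong) simp_all
  from vanish_trans[OF vanish_trans[OF 1[folded mult.assoc] 2] 3] show ?thesis by simp
qed

lemma mhom_agree:
  assumes \<phi>: "mhom G c \<phi>" and \<psi>: "mhom G c \<psi>" and S: "S \<subseteq> carrier G"
    and eq: "\<And>s. s \<in> S \<Longrightarrow> vanish (Suc c) (\<phi> s - \<psi> s)" and g: "g \<in> generate G S"
  shows "vanish (Suc c) (\<phi> g - \<psi> g)"
  using g
proof (induction rule: generate.induct)
  case one
  show ?case using mhom_one[OF \<phi>] mhom_one[OF \<psi>] by (blast intro: vanish_trans vanish_diff_commute[THEN iffD1])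
next
  case (incl h)
  then show ?case by (rule eq)
next
  case (inv h)
  then have h: "h \<in> carrier G" using S by blast
  then show ?case using mhom_inv_cong[OF \<phi> \<psi> h h] eq[OF inv] by blast
next
  case (eng h1 h2)
  then have h: "h1 \<in> carrier G" "h2 \<in> carrier G" using generate_in_carrier[OF S] by blast+
  have "vanish (Suc c) (\<phi> h1 * \<phi> h2 - \<psi> h1 * \<psi> h2)"
    using eng.IH by (rule vanish_mult_cong)
  then show ?case
    using mhomD(2)[OF \<phi> h] mhomD(2)[OF \<psi> h] by (metis vanish_diff_commute vanish_trans)
qed

lemma level_subgroup:
  assumes \<phi>: "mhom G c \<phi>" and d: "d \<le> Suc c"
  shows "subgroup {a \<in> carrier G. vanish d (\<phi> a - 1)} G"
proof (rule subgroupI)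
  have "vanish d (\<phi> \<one> - 1)" using mhom_one[OF \<phi>] d by (rule vanish_antimono)
  then show "{a \<in> carrier G. vanish d (\<phi> a - 1)} \<noteq> {}" by blast
  fix a assume a: "a \<in> {a \<in> carrier G. vanish d (\<phi> a - 1)}"
  have "vanish d (\<phi> (inv a) * \<phi> a - 1)"
    using mhom_inv(1)[OF \<phi>] a d by (blast intro: vanish_antimono)
  moreover have "vanish d (1 - \<phi> a)" using a by (simp add: vanish_diff_commute)
  ultimately have "vanish d (\<phi> (inv a) * \<phi> a - \<phi> a)" by (rule vanish_trans)
  then have "vanish d ((\<phi> (inv a) - 1) * \<phi> a)" by (simp add: left_diff_distrib)
  then have "vanish d (\<phi> (inv a) - 1)" by (rule vanish_cancel_right) (use mhomD(1)[OF \<phi>] a in auto)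
  then show "inv a \<in> {a \<in> carrier G. vanish d (\<phi> a - 1)}" using a by simp
  fix b assume b: "b \<in> {a \<in> carrier G. vanish d (\<phi> a - 1)}"
  have "vanish d (\<phi> (a \<otimes> b) - \<phi> a * \<phi> b)"
    using mhomD(2)[OF \<phi>] a b d by (blast intro: vanish_antimono)
  moreover have "vanish d (\<phi> a * \<phi> b - 1 * 1)" by (rule vanish_mult_cong) (use a b in auto)
  ultimately have "vanish d (\<phi> (a \<otimes> b) - 1 * 1)" by (rule vanish_trans)
  then show "a \<otimes> b \<in> {a \<in> carrier G. vanish d (\<phi> a - 1)}" using a b by simp
qed auto

text \<open>In \<open>(1 + x) * (1 + y) = 1 + x + y + x * y\<close> the last term has order
  \<open>2 * d\<close>, which exceeds \<open>d\<close>.\<close>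

lemma lead_additive:
  assumes \<phi>: "mhom G c \<phi>" and d: "1 \<le> d" "d \<le> c"
    and a: "a \<in> carrier G" "vanish d (\<phi> a - 1)" and b: "b \<in> carrier G" "vanish d (\<phi> b - 1)"
  shows "hpart d (\<phi> (a \<otimes> b) - 1) = hpart d (\<phi> a - 1) + hpart d (\<phi> b - 1)"
proof -
  have "vanish (Suc d) (\<phi> (a \<otimes> b) - \<phi> a * \<phi> b)"
    by (rule vanish_antimono[OF mhomD(2)[OF \<phi> a(1) b(1)]]) (use d in simp)
  moreover have "vanish (Suc d) ((\<phi> a - 1) * (\<phi> b - 1))"
    by (rule vanish_antimono[OF vanish_mult[OF a(2) b(2)]]) (use d in simp)
  ultimately have "vanish (Suc d) (\<phi> (a \<otimes> b) - \<phi> a * \<phi> b + (\<phi> a - 1) * (\<phi> b - 1))"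
    by (rule vanish_add)
  moreover have "\<phi> (a \<otimes> b) - \<phi> a * \<phi> b + (\<phi> a - 1) * (\<phi> b - 1) = (\<phi> (a \<otimes> b) - 1) - ((\<phi> a - 1) + (\<phi> b - 1))"
    by (simp add: algebra_simps)
  ultimately show ?thesis by (metis hpart_cong hpart_simps(2))
qed

text \<open>From \<open>[a, b] b a = a b\<close>: with \<open>x = \<phi> a - 1\<close> and
  \<open>y = \<phi> b - 1\<close>, the product \<open>(\<phi> [a, b] - 1) * \<phi> (b a)\<close> is
  congruent to \<open>x * y - y * x\<close>. The factor \<open>\<phi> (b a)\<close> has constant
  term 1, so it affects neither the order nor the lowest component.\<close>

lemma
  assumes \<phi>: "mhom G c \<phi>" and ij: "1 \<le> i" "1 \<le> j"
    and a: "a \<in> carrier G" "vanish i (\<phi> a - 1)" and b: "b \<in> carrier G" "vanish j (\<phi> b - 1)"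
  shows vanish_comm: "i + j \<le> Suc c \<Longrightarrow> vanish (i + j) (\<phi> (comm G a b) - 1)"
    and lead_comm: "i + j \<le> c \<Longrightarrow> hpart (i + j) (\<phi> (comm G a b) - 1) =
      hpart i (\<phi> a - 1) * hpart j (\<phi> b - 1) - hpart j (\<phi> b - 1) * hpart i (\<phi> a - 1)"
proof -
  let ?C = "\<phi> (comm G a b) - 1" and ?x = "\<phi> a - 1" and ?y = "\<phi> b - 1" and ?w = "\<phi> (b \<otimes> a)"
  have 1: "vanish (Suc c) (\<phi> (a \<otimes> b) - \<phi> (comm G a b) * ?w)"
    using mhomD(2)[OF \<phi>, of "comm G a b" "b \<otimes> a"] a b by (simp add: comm_mult)
  have "?C * ?w - (?x * ?y - ?y * ?x) =
    (\<phi> (a \<otimes> b) - \<phi> a * \<phi> b) - (\<phi> (a \<otimes> b) - \<phi> (comm G a b) * ?w) - (?w - \<phi> b * \<phi> a)"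
    by (simp add: algebra_simps)
  moreover have "vanish (Suc c) \<dots>"
    using vanish_diff[OF vanish_diff[OF mhomD(2)[OF \<phi> a(1) b(1)] 1] mhomD(2)[OF \<phi> b(1) a(1)]] .
  ultimately have 2: "vanish (Suc c) (?C * ?w - (?x * ?y - ?y * ?x))" by simp
  have xy: "vanish (i + j) (?x * ?y - ?y * ?x)"
    using vanish_mult[OF a(2) b(2)] vanish_mult[OF b(2) a(2)] by (simp add: add.commute vanish_diff)
  have w: "vanish 1 (?w - 1)" using mhomD(1)[OF \<phi>] a b by simp
  show C: "vanish (i + j) ?C" if "i + j \<le> Suc c"
  proof -
    have "vanish (i + j) (?C * ?w - (?x * ?y - ?y * ?x) + (?x * ?y - ?y * ?x))"
      by (rule vanish_add[OF vanish_antimono[OF 2 that] xy])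
    then have "vanish (i + j) (?C * ?w)" by simp
    then show ?thesis using w by (rule vanish_cancel_right)
  qed
  assume le: "i + j \<le> c"
  then have "vanish (Suc (i + j)) (?C * (?w - 1))" using vanish_mult[OF C w] by simp
  from vanish_diff[OF vanish_antimono[OF 2] this]
  have "vanish (Suc (i + j)) (?C - (?x * ?y - ?y * ?x))"
    using le by (simp add: algebra_simps)
  then have "hpart (i + j) ?C = hpart (i + j) (?x * ?y - ?y * ?x)" by (rule hpart_cong)
  also have "\<dots> = hpart (i + j) (?x * ?y) - hpart (j + i) (?y * ?x)"
    by (simp only: hpart_simps(3) add.commute)
  finally have "hpart (i + j) ?C = hpart (i + j) (?x * ?y) - hpart (j + i) (?y * ?x)" .
  then show "hpart (i + j) ?C = hpart i ?x * hpart j ?y - hpart j ?y * hpart i ?x"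
    by (simp add: hpart_mult a b)
qed

text \<open>The easy half of Magnus' theorem, for an arbitrary truncated homomorphism. It is also
  the reason why such a homomorphism on the free group descends to the nilpotent quotient.\<close>

lemma vanish_gamma:
  assumes \<phi>: "mhom G c \<phi>" and i: "1 \<le> i" "i \<le> Suc c" and a: "a \<in> \<gamma> i"
  shows "vanish i (\<phi> a - 1)"
  using i a
proof (induction i arbitrary: a rule: nat_induct_at_least)
  case base
  then show ?case using mhomD(1)[OF \<phi>] gamma_carrier by simp
next
  case (Suc i)
  have "{comm G a b | a b. a \<in> carrier G \<and> b \<in> \<gamma> i} \<subseteq> {a \<in> carrier G. vanish (Suc i) (\<phi> a - 1)}"
  proof clarify
    fix a b assume a: "a \<in> carrier G" and b: "b \<in> \<gamma> i"
    have bc: "b \<in> carrier G" using b by (rule gamma_carrier)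
    have "vanish i (\<phi> b - 1)" using Suc.IH[OF _ b] Suc.prems by simp
    then have "vanish (1 + i) (\<phi> (comm G a b) - 1)"
      using Suc.prems by (intro vanish_comm[OF \<phi> order.refl Suc.hyps a mhomD(1)[OF \<phi> a] bc]) simp_all
    then show "comm G a b \<in> carrier G \<and> vanish (Suc i) (\<phi> (comm G a b) - 1)" using a bc by simp
  qed
  then show ?case
    using generate_subgroup_incl[OF _ level_subgroup[OF \<phi>, of "Suc i"]] Suc.prems gamma_Suc[OF Suc.hyps]
    by blast
qed

text \<open>Both conjugations are assumed, since conjugation can map a subgroup properly into
  itself.\<close>

lemma normalized_product_subgroup:
  assumes H: "subgroup H G" and z: "z \<in> carrier G"
    and n1: "\<And>n. n \<in> H \<Longrightarrow> z \<otimes> n \<otimes> inv z \<in> H" and n2: "\<And>n. n \<in> H \<Longrightarrow> inv z \<otimes> n \<otimes> z \<in> H"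
  shows "subgroup {n \<otimes> z [^] (k::int) | n k. n \<in> H} G"
proof -
  interpret H: subgroup H G by (rule H)
  have nat: "z [^] (k::nat) \<otimes> n \<otimes> inv (z [^] k) \<in> H \<and> inv (z [^] k) \<otimes> n \<otimes> z [^] k \<in> H" if "n \<in> H" for n k
  proof (induction k)
    case (Suc k)
    have nc: "n \<in> carrier G" using that by simp
    have 1: "z [^] Suc k \<otimes> n \<otimes> inv (z [^] Suc k) = z \<otimes> (z [^] k \<otimes> n \<otimes> inv (z [^] k)) \<otimes> inv z"
      by (subst (1 2) nat_pow_Suc2) (use nc z in \<open>simp_all add: inv_mult_group m_assoc\<close>)
    have 2: "inv (z [^] Suc k) \<otimes> n \<otimes> z [^] Suc k = inv z \<otimes> (inv (z [^] k) \<otimes> n \<otimes> z [^] k) \<otimes> z"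
      using nc z by (simp add: inv_mult_group m_assoc)
    show ?case unfolding 1 2 using Suc n1 n2 by blast
  qed (use that in simp)
  have conj: "z [^] (k::int) \<otimes> n \<otimes> z [^] (-k) \<in> H" if "n \<in> H" for n k
  proof (cases "k \<ge> 0")
    case True
    then obtain i where "k = int i" using nonneg_eq_int by blast
    then show ?thesis using nat[OF that, of i] z by (simp add: int_pow_int int_pow_neg_int)
  next
    case False
    then obtain i where "k = - int i" by (metis int_cases2 of_nat_0_le_iff)
    then show ?thesis using nat[OF that, of i] z by (simp add: int_pow_int int_pow_neg_int)
  qed
  have can: "z [^] (-k) \<otimes> (z [^] (k::int) \<otimes> u) = u" if "u \<in> carrier G" for k u
    using that z by (simp flip: m_assoc int_pow_mult)
  have can': "z [^] k \<otimes> (z [^] (-k::int) \<otimes> u) = u" if "u \<in> carrier G" for k u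
    using that z by (simp flip: m_assoc int_pow_mult)
  show ?thesis
  proof (rule subgroupI)
    show "{n \<otimes> z [^] (k::int) | n k. n \<in> H} \<subseteq> carrier G" using z by auto
    show "{n \<otimes> z [^] (k::int) | n k. n \<in> H} \<noteq> {}" using H.one_closed by blast
    fix a assume "a \<in> {n \<otimes> z [^] (k::int) | n k. n \<in> H}"
    then obtain n k where a: "a = n \<otimes> z [^] (k::int)" "n \<in> H" by blast
    have "inv a = (z [^] (-k) \<otimes> inv n \<otimes> z [^] (-(-k))) \<otimes> z [^] (-k)"
    proof -
      have "(z [^] (-k) \<otimes> inv n \<otimes> z [^] (-(-k))) \<otimes> z [^] (-k) = z [^] (-k) \<otimes> inv n \<otimes> (z [^] k \<otimes> z [^] (-k))"
        using a z by (simp add: m_assoc)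
      also have "\<dots> = inv a" using a z by (simp add: inv_mult_group int_pow_neg)
      finally show ?thesis by simp
    qed
    then show "inv a \<in> {n \<otimes> z [^] (k::int) | n k. n \<in> H}"
      using conj[of "inv n" "-k"] a by blast
    fix b assume "b \<in> {n \<otimes> z [^] (k::int) | n k. n \<in> H}"
    then obtain n' k' where b: "b = n' \<otimes> z [^] (k'::int)" "n' \<in> H" by blast
    have "a \<otimes> b = n \<otimes> (z [^] k \<otimes> n' \<otimes> z [^] (-k)) \<otimes> z [^] (k + k')"
    proof -
      have "z [^] (-k) \<otimes> z [^] (k + k') = z [^] k'" using z by (simp flip: int_pow_mult)
      then have "n \<otimes> (z [^] k \<otimes> n' \<otimes> z [^] (-k)) \<otimes> z [^] (k + k') = n \<otimes> (z [^] k \<otimes> (n' \<otimes> z [^] k'))"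
        using a b z by (simp add: m_assoc)
      then show ?thesis using a b z by (simp add: m_assoc)
    qed
    then show "a \<otimes> b \<in> {n \<otimes> z [^] (k::int) | n k. n \<in> H}"
      using conj[OF b(2), of k] a(2) by blast
  qed
qed

end

section \<open>Iterated commutators\<close>

text \<open>Formal bracketings, evaluated below by \<open>av\<close> as Lie brackets in the
  associative algebra and by \<open>gv\<close> as group commutators. Keeping them formal lets both
  evaluations follow one and the same elimination.\<close>

datatype (leaves: 'a) ctree = Leaf 'a | Node "'a ctree" "'a ctree"

fun wt :: "'a ctree \<Rightarrow> nat" where
  "wt (Leaf i) = 1"
| "wt (Node s t) = wt s + wt t"

fun av :: "nat ctree \<Rightarrow> ncps" where
  "av (Leaf i) = var i"
| "av (Node s t) = av s * av t - av t * av s"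

fun gv :: "('g, 'b) monoid_scheme \<Rightarrow> ('a \<Rightarrow> 'g) \<Rightarrow> 'a ctree \<Rightarrow> 'g" where
  "gv G x (Leaf i) = x i"
| "gv G x (Node s t) = comm G (gv G x s) (gv G x t)"

lemma wt_pos: "wt t \<ge> 1"
  by (induction t) auto

lemma wt_gt0: "wt t > 0"
  using wt_pos[of t] by simp

text \<open>The bracketing \<open>[z, [z, ... [z, y]]]\<close> with \<open>k\<close> copies of
  \<open>z\<close>, in Lie notation \<open>ad(z)\<close> applied \<open>k\<close> times to
  \<open>y\<close>.\<close>

fun iter_node :: "'a ctree \<Rightarrow> 'a ctree \<Rightarrow> nat \<Rightarrow> 'a ctree" where
  "iter_node z y 0 = y"
| "iter_node z y (Suc k) = Node z (iter_node z y k)"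

lemma wt_iter_node: "wt (iter_node z y k) = k * wt z + wt y"
  by (induction k) auto

lemma leaves_iter_node: "leaves z \<subseteq> A \<Longrightarrow> leaves y \<subseteq> A \<Longrightarrow> leaves (iter_node z y k) \<subseteq> A"
  by (induction k) auto

text \<open>Lazard elimination of \<open>z\<close> from the letters \<open>Z\<close>, truncated at weight \<open>c\<close>.\<close>

definition elim :: "nat \<Rightarrow> 'a ctree \<Rightarrow> 'a ctree set \<Rightarrow> 'a ctree set"
  where "elim c z Z = {iter_node z y k | y k. y \<in> Z - {z} \<and> wt (iter_node z y k) \<le> c}"

lemma finite_elim:
  assumes "finite Z"
  shows "finite (elim c z Z)"
proof -
  have "elim c z Z \<subseteq> (\<lambda>(y, k). iter_node z y k) ` (Z \<times> {..c})"
  proof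
    fix t assume "t \<in> elim c z Z"
    then obtain y k where t: "t = iter_node z y k" "y \<in> Z" "wt t \<le> c" by (auto simp: elim_def)
    have "k \<le> k * wt z" using wt_pos[of z] by (cases "wt z") auto
    moreover have "k * wt z + wt y \<le> c" using t by (simp add: wt_iter_node)
    ultimately have "k \<le> c" by linarith
    then show "t \<in> (\<lambda>(y, k). iter_node z y k) ` (Z \<times> {..c})" using t by force
  qed
  then show ?thesis using assms by (meson finite_SigmaI finite_atMost finite_imageI finite_subset)
qed

lemma Node_in_elim:
  assumes "t \<in> elim c z Z" "wt z + wt t \<le> c"
  shows "Node z t \<in> elim c z Z"
proof -
  obtain y k where t: "t = iter_node z y k" "y \<in> Z - {z}" using assms by (auto simp: elim_def)
  then have "Node z t = iter_node z y (Suc k)" by simp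
  then show ?thesis using assms(2) t unfolding elim_def
    by (intro CollectI exI[of _ y] exI[of _ "Suc k"]) simp
qed

lemma in_elim: "y \<in> Z \<Longrightarrow> y \<noteq> z \<Longrightarrow> wt y \<le> c \<Longrightarrow> y \<in> elim c z Z"
  unfolding elim_def by (auto intro!: exI[of _ y] exI[of _ 0])

subsection \<open>Counting words by weight\<close>

text \<open>The number of words of total weight \<open>n\<close> over the alphabet \<open>Z\<close>,
  split according to the first letter.\<close>

function cnt :: "'a ctree set \<Rightarrow> nat \<Rightarrow> nat" where
  "cnt Z n = (if n = 0 then 1 else (\<Sum>y\<in>{y \<in> Z. wt y \<le> n}. cnt Z (n - wt y)))"
  by pat_completeness auto
termination
  by (relation "measure snd") (use wt_pos in \<open>auto simp: Suc_le_eq intro!: diff_less\<close>)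

declare cnt.simps [simp del]

text \<open>With \<open>w\<close> the weight of \<open>z\<close> and \<open>Y\<close> the weight
  series of the other letters, \<open>1 / (1 - t^w - Y)\<close> equals
  \<open>1 / (1 - Y / (1 - t^w))\<close> times \<open>1 / (1 - t^w)\<close>. Here
  \<open>Y / (1 - t^w)\<close> is the series of the letters \<open>iter_node z y k\<close>, and the
  last factor accounts for the powers of \<open>z\<close>. Truncation at weight \<open>c\<close>
  leaves an inequality.\<close>

lemma cnt_elim:
  assumes Z: "finite Z" and z: "z \<in> Z"
  shows "(\<Sum>k\<in>{k. k * wt z \<le> n}. cnt (elim c z Z) (n - k * wt z)) \<le> cnt Z n"
proof (induction n rule: less_induct)
  case (less n)
  let ?Z' = "elim c z Z" and ?w = "wt z"
  define s where "s = (\<lambda>n. \<Sum>k\<in>{k. k * ?w \<le> n}. cnt ?Z' (n - k * ?w))"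
  have w: "?w \<ge> 1" by (rule wt_pos)
  have fin: "finite {k. k * ?w \<le> n}" for n
  proof (rule finite_subset)
    show "{k. k * ?w \<le> n} \<subseteq> {..n}"
    proof
      fix k assume "k \<in> {k. k * ?w \<le> n}"
      moreover have "k \<le> k * ?w" using w by (cases ?w) auto
      ultimately show "k \<in> {..n}" unfolding mem_Collect_eq atMost_iff by linarith
    qed
  qed simp
  have IH: "s k \<le> cnt Z k" if "k < n" for k using less[OF that] by (simp add: s_def)
  show ?case
  proof (cases "n = 0")
    case True
    have "{k. k * ?w \<le> 0} = {0}" using w by auto
    then show ?thesis by (simp add: True cnt.simps)
  next
    case False
    \<comment> \<open>The summand \<open>k = 0\<close> is split off; the others form the same sum
      for \<open>n - ?w\<close>.\<close>
    have rec: "s n = cnt ?Z' n + (if ?w \<le> n then s (n - ?w) else 0)"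
    proof (cases "?w \<le> n")
      case True
      have *: "{k. k * ?w \<le> n} = insert 0 (Suc ` {k. k * ?w \<le> n - ?w})"
      proof (rule Set.set_eqI)
        fix k show "k \<in> {k. k * ?w \<le> n} \<longleftrightarrow> k \<in> insert 0 (Suc ` {k. k * ?w \<le> n - ?w})"
          using True by (cases k) auto
      qed
      show ?thesis unfolding s_def *
        by (subst sum.insert) (use fin True in \<open>auto simp: sum.reindex intro!: sum.cong\<close>)
    next
      case False
      then have "{k. k * ?w \<le> n} = {0}"
        by (auto simp: not_le) (metis False le_trans mult_eq_0_iff mult_le_mono1 nat_mult_1 not_less_eq_eq One_nat_def bot_nat_0.extremum_uniqueI le_0_eq)
      then show ?thesis using False by (simp add: s_def)
    qed
    let ?Y = "{y \<in> Z - {z}. wt y \<le> n}"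
    have "cnt ?Z' n = (\<Sum>t\<in>{t \<in> ?Z'. wt t \<le> n}. cnt ?Z' (n - wt t))"
      using False by (subst cnt.simps) simp
    also have "\<dots> \<le> (\<Sum>t\<in>(\<lambda>(y, k). iter_node z y k) ` (SIGMA y:?Y. {k. k * ?w \<le> n - wt y}). cnt ?Z' (n - wt t))"
    proof (rule sum_mono2)
      show "finite ((\<lambda>(y, k). iter_node z y k) ` (SIGMA y:?Y. {k. k * ?w \<le> n - wt y}))"
        using Z fin by (intro finite_imageI finite_SigmaI) auto
      show "{t \<in> ?Z'. wt t \<le> n} \<subseteq> (\<lambda>(y, k). iter_node z y k) ` (SIGMA y:?Y. {k. k * ?w \<le> n - wt y})"
      proof
        fix t assume "t \<in> {t \<in> ?Z'. wt t \<le> n}"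
        then obtain y k where t: "t = iter_node z y k" "y \<in> Z - {z}" "wt t \<le> n" by (auto simp: elim_def)
        then have "(y, k) \<in> (SIGMA y:?Y. {k. k * ?w \<le> n - wt y})" by (auto simp: wt_iter_node)
        then show "t \<in> (\<lambda>(y, k). iter_node z y k) ` (SIGMA y:?Y. {k. k * ?w \<le> n - wt y})"
          using t(1) by force
      qed
    qed simp
    \<comment> \<open>Distinct pairs \<open>(y, k)\<close> may give the same tree, for instance when
      \<open>Z\<close> contains both \<open>y\<close> and \<open>Node z y\<close>; passing from
      trees to pairs can only increase the sum.\<close>
    also have "\<dots> \<le> (\<Sum>p\<in>(SIGMA y:?Y. {k. k * ?w \<le> n - wt y}). cnt ?Z' (n - wt (iter_node z (fst p) (snd p))))"
      using sum_image_le[of "SIGMA y:?Y. {k. k * ?w \<le> n - wt y}" "\<lambda>t. cnt ?Z' (n - wt t)" "\<lambda>(y, k). iter_node z y k"] Z fin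
      by (simp add: comp_def case_prod_unfold)
    also have "\<dots> = (\<Sum>y\<in>?Y. \<Sum>k\<in>{k. k * ?w \<le> n - wt y}. cnt ?Z' (n - wt y - k * ?w))"
      using Z fin by (subst sum.Sigma) (auto simp: wt_iter_node case_prod_unfold intro!: sum.cong arg_cong[of _ _ "cnt ?Z'"])
    also have "\<dots> = (\<Sum>y\<in>?Y. s (n - wt y))" by (simp add: s_def)
    also have "\<dots> \<le> (\<Sum>y\<in>?Y. cnt Z (n - wt y))"
      using False by (intro sum_mono IH diff_less wt_gt0) simp
    finally have 1: "cnt ?Z' n \<le> (\<Sum>y\<in>?Y. cnt Z (n - wt y))" .
    have "cnt Z n = (\<Sum>y\<in>{y \<in> Z. wt y \<le> n}. cnt Z (n - wt y))"
      using False by (subst cnt.simps) simp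
    also have "\<dots> = (\<Sum>y\<in>?Y. cnt Z (n - wt y)) + (if ?w \<le> n then cnt Z (n - ?w) else 0)"
    proof (cases "?w \<le> n")
      case True
      then have "{y \<in> Z. wt y \<le> n} = insert z ?Y" using z by auto
      then show ?thesis using True Z by simp
    next
      case False
      then have "{y \<in> Z. wt y \<le> n} = ?Y" by auto
      then show ?thesis using False by simp
    qed
    finally have "s n \<le> cnt Z n"
      using 1 rec IH[of "n - ?w"] w False by auto
    then show ?thesis by (simp add: s_def)
  qed
qed

lemma cnt_Leaf: "cnt (Leaf ` {..<m}) n = m ^ n"
proof (induction n)
  case (Suc n)
  have "{y \<in> Leaf ` {..<m}. wt y \<le> Suc n} = Leaf ` {..<m}" by auto
  then have "cnt (Leaf ` {..<m}) (Suc n) = (\<Sum>y\<in>Leaf ` {..<m}. cnt (Leaf ` {..<m}) (Suc n - wt y))"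
    by (subst cnt.simps) simp
  also have "\<dots> = (\<Sum>i<m. m ^ n)" using Suc by (subst sum.reindex) (auto simp: inj_on_def)
  finally show ?case by simp
qed (simp add: cnt.simps)

subsection \<open>Spanning monomials\<close>

lemma span_linear_image:
  assumes "Vector_Spaces.linear sc sc f" "\<And>v. v \<in> A \<Longrightarrow> f v \<in> ncps.span B" "v \<in> ncps.span A"
  shows "f v \<in> ncps.span B"
proof -
  interpret f: Vector_Spaces.linear sc sc f by fact
  show ?thesis using assms(3)
    by (induction rule: ncps.span_induct_alt)
      (simp_all add: f.zero f.add f.scale assms(2) ncps.span_zero ncps.span_add ncps.span_scale)
qed

abbreviation wts :: "'a ctree list \<Rightarrow> nat" where "wts u \<equiv> sum_list (map wt u)"
abbreviation avs :: "nat ctree list \<Rightarrow> ncps" where "avs u \<equiv> prod_list (map av u)"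

definition words_span :: "nat ctree set \<Rightarrow> nat \<Rightarrow> ncps set"
  where "words_span Z n = ncps.span {avs u | u. set u \<subseteq> Z \<and> wts u = n}"

text \<open>The shape that elimination aims at: all occurrences of \<open>z\<close> itself are
  collected at the right end.\<close>

definition elim_span :: "nat \<Rightarrow> nat ctree \<Rightarrow> nat ctree set \<Rightarrow> nat \<Rightarrow> ncps set"
  where "elim_span c z Z n = ncps.span {avs u * av z ^ k | u k. set u \<subseteq> elim c z Z \<and> wts u + k * wt z = n}"

lemma elim_span_mult_letter:
  assumes "t \<in> elim c z Z" "v \<in> elim_span c z Z n"
  shows "av t * v \<in> elim_span c z Z (wt t + n)"
  using assms(2) unfolding elim_span_def
proof (rule span_linear_image[OF linear_mult_left, rotated])
  fix v assume "v \<in> {avs u * av z ^ k | u k. set u \<subseteq> elim c z Z \<and> wts u + k * wt z = n}"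
  then obtain u k where u: "v = avs u * av z ^ k" "set u \<subseteq> elim c z Z" "wts u + k * wt z = n" by blast
  then have "av t * v = avs (t # u) * av z ^ k" "set (t # u) \<subseteq> elim c z Z" "wts (t # u) + k * wt z = wt t + n"
    using assms(1) by (auto simp: mult.assoc)
  then show "av t * v \<in> ncps.span {avs u * av z ^ k | u k. set u \<subseteq> elim c z Z \<and> wts u + k * wt z = wt t + n}"
    by (intro ncps.span_base CollectI exI[of _ "t # u"] exI[of _ k]) simp
qed

lemma elim_span_mult_power:
  assumes "v \<in> elim_span c z Z n"
  shows "v * av z ^ j \<in> elim_span c z Z (n + j * wt z)"
  using assms unfolding elim_span_def
proof (rule span_linear_image[OF linear_mult_right, rotated])
  fix v assume "v \<in> {avs u * av z ^ k | u k. set u \<subseteq> elim c z Z \<and> wts u + k * wt z = n}"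
  then obtain u k where u: "v = avs u * av z ^ k" "set u \<subseteq> elim c z Z" "wts u + k * wt z = n" by blast
  then have "v * av z ^ j = avs u * av z ^ (k + j)" "wts u + (k + j) * wt z = n + j * wt z"
    by (simp_all add: mult.assoc power_add distrib_right)
  then show "v * av z ^ j \<in> ncps.span {avs u * av z ^ k | u k. set u \<subseteq> elim c z Z \<and> wts u + k * wt z = n + j * wt z}"
    using u by (intro ncps.span_base CollectI exI[of _ u] exI[of _ "k + j"]) simp
qed

text \<open>\<open>z t = [z, t] + t z\<close> moves \<open>z\<close> to the right past a letter
  \<open>t\<close>, and the bracket is again an eliminated letter as long as its weight is at most
  \<open>c\<close>.\<close>

lemma eliminated_mult_avs:
  assumes "set u \<subseteq> elim c z Z" "wt z + wts u \<le> c"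
  shows "av z * avs u \<in> elim_span c z Z (wt z + wts u)"
  using assms
proof (induction u)
  case Nil
  have "av z = avs [] * av z ^ 1" "wts ([] :: nat ctree list) + 1 * wt z = wt z" by simp_all
  then have "av z \<in> elim_span c z Z (wt z)"
    unfolding elim_span_def by (intro ncps.span_base CollectI exI[of _ "[]"] exI[of _ 1]) simp
  then show ?case by simp
next
  case (Cons t u)
  have t: "t \<in> elim c z Z" using Cons.prems by simp
  have n: "Node z t \<in> elim c z Z" using Node_in_elim[OF t] Cons.prems by simp
  have "avs u = avs u * av z ^ 0" by simp
  then have "avs u \<in> elim_span c z Z (wts u)"
    unfolding elim_span_def using Cons.prems
    by (intro ncps.span_base CollectI exI[of _ u] exI[of _ 0]) simp
  from elim_span_mult_letter[OF n this]
  have 1: "av (Node z t) * avs u \<in> elim_span c z Z (wt z + wts (t # u))" by (simp add: add.assoc)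
  have 2: "av t * (av z * avs u) \<in> elim_span c z Z (wt z + wts (t # u))"
    using elim_span_mult_letter[OF t Cons.IH] Cons.prems by (simp add: ac_simps)
  have "av z * avs (t # u) = av (Node z t) * avs u + av t * (av z * avs u)"
    by (simp add: algebra_simps)
  then show ?case using 1 2 unfolding elim_span_def by (simp add: ncps.span_add)
qed

lemma words_span_elim:
  assumes "set w \<subseteq> Z" "wts w \<le> c"
  shows "avs w \<in> elim_span c z Z (wts w)"
  using assms
proof (induction w)
  case Nil
  have "1 \<in> elim_span c z Z 0"
    unfolding elim_span_def by (intro ncps.span_base CollectI exI[of _ "[]"] exI[of _ 0]) simp
  then show ?case by simp
next
  case (Cons y w)
  have IH: "avs w \<in> elim_span c z Z (wts w)" using Cons by simp
  show ?case
  proof (cases "y = z")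
    case False
    then have "y \<in> elim c z Z" using Cons.prems by (intro in_elim) simp_all
    then show ?thesis using elim_span_mult_letter IH by simp
  next
    case True
    have "av z * avs w \<in> ncps.span {avs u * av z ^ k | u k. set u \<subseteq> elim c z Z \<and> wts u + k * wt z = wt z + wts w}"
      using IH[unfolded elim_span_def]
    proof (rule span_linear_image[OF linear_mult_left, rotated])
      fix v assume "v \<in> {avs u * av z ^ k | u k. set u \<subseteq> elim c z Z \<and> wts u + k * wt z = wts w}"
      then obtain u k where u: "v = avs u * av z ^ k" "set u \<subseteq> elim c z Z" "wts u + k * wt z = wts w" by blast
      then have "av z * avs u \<in> elim_span c z Z (wt z + wts u)"
        using Cons.prems True by (intro eliminated_mult_avs) simp_all
      from elim_span_mult_power[OF this, of k]
      show "av z * v \<in> ncps.span {avs u * av z ^ k | u k. set u \<subseteq> elim c z Z \<and> wts u + k * wt z = wt z + wts w}"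
        using u by (simp add: elim_span_def mult.assoc add.assoc)
    qed
    then show ?thesis using True by (simp add: elim_span_def)
  qed
qed

text \<open>The Poincare--Birkhoff--Witt monomials of weight \<open>n\<close>, listed with multiplicity.\<close>

fun pbw :: "nat ctree list \<Rightarrow> nat \<Rightarrow> ncps list" where
  "pbw [] n = (if n = 0 then [1] else [])"
| "pbw (z # zs) n = concat (map (\<lambda>k. map (\<lambda>v. v * av z ^ k) (pbw zs (n - k * wt z)))
    (filter (\<lambda>k. k * wt z \<le> n) [0..<Suc n]))"

lemma mult_wt_le_imp_le: "k * wt z \<le> n \<Longrightarrow> k \<le> n"
  using wt_pos[of z] by (cases "wt z") (auto intro: le_trans[of k "k + k * _"])

lemma length_pbw_elim:
  assumes "finite Z" "z \<in> Z" "\<And>n. n \<le> c \<Longrightarrow> length (pbw zs n) \<le> cnt (elim c z Z) n" "n \<le> c"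
  shows "length (pbw (z # zs) n) \<le> cnt Z n"
proof -
  have "length (pbw (z # zs) n) = (\<Sum>k\<leftarrow>filter (\<lambda>k. k * wt z \<le> n) [0..<Suc n]. length (pbw zs (n - k * wt z)))"
    by (simp add: length_concat comp_def del: upt_Suc)
  also have "\<dots> = (\<Sum>k\<in>set (filter (\<lambda>k. k * wt z \<le> n) [0..<Suc n]). length (pbw zs (n - k * wt z)))"
    by (rule sum_list_distinct_conv_sum_set) simp
  also have "set (filter (\<lambda>k. k * wt z \<le> n) [0..<Suc n]) = {k. k * wt z \<le> n}"
    by (auto simp: less_Suc_eq_le simp del: upt_Suc dest: mult_wt_le_imp_le)
  also have "(\<Sum>k\<in>{k. k * wt z \<le> n}. length (pbw zs (n - k * wt z))) \<le>
      (\<Sum>k\<in>{k. k * wt z \<le> n}. cnt (elim c z Z) (n - k * wt z))"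
    using assms by (intro sum_mono) simp
  also have "\<dots> \<le> cnt Z n" by (rule cnt_elim) fact+
  finally show ?thesis .
qed

lemma words_span_pbw_elim:
  assumes IH: "\<And>n. n \<le> c \<Longrightarrow> words_span (elim c z Z) n \<subseteq> ncps.span (set (pbw zs n))" and n: "n \<le> c"
  shows "words_span Z n \<subseteq> ncps.span (set (pbw (z # zs) n))"
proof -
  have "elim_span c z Z n \<subseteq> ncps.span (set (pbw (z # zs) n))"
    unfolding elim_span_def
  proof (rule ncps.span_minimal)
    show "{avs u * av z ^ k | u k. set u \<subseteq> elim c z Z \<and> wts u + k * wt z = n} \<subseteq> ncps.span (set (pbw (z # zs) n))"
    proof clarify
      fix u k assume u: "set u \<subseteq> elim c z Z" and nk: "n = wts u + k * wt z"
      have "avs u \<in> words_span (elim c z Z) (n - k * wt z)"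
        unfolding words_span_def using u nk by (intro ncps.span_base) auto
      then have "avs u \<in> ncps.span (set (pbw zs (n - k * wt z)))" using IH n by (meson diff_le_self le_trans subsetD)
      then show "avs u * av z ^ k \<in> ncps.span (set (pbw (z # zs) (wts u + k * wt z)))"
      proof (rule span_linear_image[OF linear_mult_right, rotated])
        fix v assume v: "v \<in> set (pbw zs (n - k * wt z))"
        have k: "k \<in> set (filter (\<lambda>k. k * wt z \<le> n) [0..<Suc n])"
          using nk mult_wt_le_imp_le[of k z n] by (simp add: less_Suc_eq_le del: upt_Suc)
        have "v * av z ^ k \<in> set (pbw (z # zs) n)"
          unfolding pbw.simps set_concat
        proof (rule UN_I)
          show "map (\<lambda>v. v * av z ^ k) (pbw zs (n - k * wt z)) \<in>
            set (map (\<lambda>k. map (\<lambda>v. v * av z ^ k) (pbw zs (n - k * wt z))) (filter (\<lambda>k. k * wt z \<le> n) [0..<Suc n]))"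
            unfolding set_map[of _ "filter _ _"] by (rule imageI[OF k])
          show "v * av z ^ k \<in> set (map (\<lambda>v. v * av z ^ k) (pbw zs (n - k * wt z)))" using v by simp
        qed
        then show "v * av z ^ k \<in> ncps.span (set (pbw (z # zs) (wts u + k * wt z)))"
          unfolding nk by (rule ncps.span_base)
      qed
    qed
  qed (rule ncps.subspace_span)
  moreover have "words_span Z n \<subseteq> elim_span c z Z n"
    unfolding words_span_def
  proof (rule ncps.span_minimal)
    show "{avs u | u. set u \<subseteq> Z \<and> wts u = n} \<subseteq> elim_span c z Z n"
      using words_span_elim n by blast
    show "ncps.subspace (elim_span c z Z n)" unfolding elim_span_def by (rule ncps.subspace_span)
  qed
  ultimately show ?thesis by blast
qed

lemma pbw_0: "pbw zs 0 = [1]"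
  by (induction zs) simp_all

text \<open>Exponent 1 at one letter and 0 at all others gives the letter itself as a monomial. The
  inclusion of multisets is what transfers the absence of repetitions from the monomials to the
  letters.\<close>

lemma letters_in_pbw:
  assumes "n \<ge> 1"
  shows "mset (map av (filter (\<lambda>z. wt z = n) zs)) \<subseteq># mset (pbw zs n)"
proof (induction zs)
  case (Cons z zs)
  define f where "f = (\<lambda>k. map (\<lambda>v. v * av z ^ k) (pbw zs (n - k * wt z)))"
  have upt: "[0..<Suc n] = 0 # 1 # [2..<Suc n]"
    using assms by (simp add: upt_conv_Cons numeral_2_eq_2 del: upt_Suc)
  have "mset (pbw (z # zs) n) = mset (f 0) + (if wt z \<le> n then mset (f 1) else {#}) +
    mset (concat (map f (filter (\<lambda>k. k * wt z \<le> n) [2..<Suc n])))"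
    unfolding pbw.simps upt f_def by simp
  moreover have "mset (f 0) = mset (pbw zs n)" by (simp add: f_def)
  ultimately have 1: "mset (pbw zs n) + (if wt z = n then mset (f 1) else {#}) \<subseteq># mset (pbw (z # zs) n)"
    by (auto simp: subset_mset.add_increasing2)
  have "wt z = n \<Longrightarrow> f 1 = [av z]" by (simp add: f_def pbw_0)
  then have "mset (map av (filter (\<lambda>z. wt z = n) (z # zs))) \<subseteq># mset (pbw zs n) + (if wt z = n then mset (f 1) else {#})"
    using Cons by auto
  then show ?case using 1 by (rule subset_mset.order_trans)
qed simp

text \<open>Linear independence for lists: \<open>distinct\<close> prevents equal vectors at
  different positions from cancelling each other.\<close>

lemma sum_independent_eq_0:
  assumes "length es = length zs" "distinct (map av (filter P zs))" "ncps.independent (set (map av (filter P zs)))"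
    "(\<Sum>(z, e)\<leftarrow>zip zs es. if P z then sc (of_int e) (av z) else 0) = 0" "(z, e) \<in> set (zip zs es)" "P z"
  shows "e = 0"
  using assms
proof (induction es zs rule: list_induct2)
  case (Cons e' es z' zs)
  let ?s = "\<Sum>(z, e)\<leftarrow>zip zs es. if P z then sc (of_int e) (av z) else 0"
  show ?case
  proof (cases "P z'")
    case True
    let ?S = "set (map av (filter P zs))"
    have av: "av z' \<notin> ?S" "ncps.independent ?S" "av z' \<notin> ncps.span ?S"
      using Cons.prems(1,2) True ncps.independent_insert[of "av z'" ?S] by (auto split: if_splits)
    have "?s \<in> ncps.span ?S"
      unfolding sum_list_sum_nth
    proof (rule ncps.span_sum)
      fix i assume i: "i \<in> {0..<length (map (\<lambda>(z, e). if P z then sc (of_int e) (av z) else 0) (zip zs es))}"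
      then have "sc (of_int (es ! i)) (av (zs ! i)) \<in> ncps.span ?S" if "P (zs ! i)"
        using that by (intro ncps.span_scale ncps.span_base) auto
      then show "map (\<lambda>(z, e). if P z then sc (of_int e) (av z) else 0) (zip zs es) ! i \<in> ncps.span ?S"
        using i by (auto intro: ncps.span_zero)
    qed
    moreover have s: "sc (of_int e') (av z') = - ?s" using Cons.prems(3) True by (simp add: eq_neg_iff_add_eq_0)
    ultimately have "sc (of_int e') (av z') \<in> ncps.span ?S" by (simp add: ncps.span_neg)
    then have "sc (inverse (of_int e')) (sc (of_int e') (av z')) \<in> ncps.span ?S" by (rule ncps.span_scale)
    then have e': "e' = 0" using av(3) by (cases "e' = 0") simp_all
    then have "?s = 0" using s by simp
    then show ?thesis using Cons.IH[OF _ av(2)] Cons.prems True e' by auto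
  next
    case False
    then show ?thesis using Cons by auto
  qed
qed simp

section \<open>Normal forms in a nilpotent group\<close>

fun nf_set :: "('g, 'b) monoid_scheme \<Rightarrow> ('a \<Rightarrow> 'g) \<Rightarrow> 'a ctree list \<Rightarrow> 'g set" where
  "nf_set G x [] = {\<one>\<^bsub>G\<^esub>}"
| "nf_set G x (z # zs) = {n \<otimes>\<^bsub>G\<^esub> (gv G x z [^]\<^bsub>G\<^esub> (k::int)) | n k. n \<in> nf_set G x zs}"

text \<open>A series with cyclic steps: each tail of the list gives a subgroup, which the next
  letter conjugates into itself. This one-sided form suffices for counting cosets, where only
  conjugation by nonnegative powers occurs.\<close>

fun nf_chain :: "('g, 'b) monoid_scheme \<Rightarrow> ('a \<Rightarrow> 'g) \<Rightarrow> 'a ctree list \<Rightarrow> bool" where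
  "nf_chain G x [] = True"
| "nf_chain G x (z # zs) \<longleftrightarrow> nf_chain G x zs \<and> subgroup (nf_set G x zs) G \<and>
    (\<forall>n\<in>nf_set G x zs. gv G x z \<otimes>\<^bsub>G\<^esub> n \<otimes>\<^bsub>G\<^esub> inv\<^bsub>G\<^esub> gv G x z \<in> nf_set G x zs)"

fun nf :: "('g, 'b) monoid_scheme \<Rightarrow> ('a \<Rightarrow> 'g) \<Rightarrow> 'a ctree list \<Rightarrow> int list \<Rightarrow> 'g" where
  "nf G x (z # zs) (e # es) = nf G x zs es \<otimes>\<^bsub>G\<^esub> (gv G x z [^]\<^bsub>G\<^esub> e)"
| "nf G x _ _ = \<one>\<^bsub>G\<^esub>"

lemma nf_setE:
  assumes "g \<in> nf_set G x zs"
  obtains es where "length es = length zs" "g = nf G x zs es"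
proof -
  have "\<exists>es. length es = length zs \<and> g = nf G x zs es"
    using assms
  proof (induction zs arbitrary: g)
    case (Cons z zs)
    then obtain n k where "g = n \<otimes>\<^bsub>G\<^esub> (gv G x z [^]\<^bsub>G\<^esub> (k::int))" "n \<in> nf_set G x zs" by auto
    moreover then obtain es where "length es = length zs" "n = nf G x zs es" using Cons.IH by blast
    ultimately show ?case by (intro exI[of _ "k # es"]) simp
  qed simp
  then show thesis using that by blast
qed

locale nilpotent_generated = group G for G (structure) +
  fixes x :: "nat \<Rightarrow> 'a" and m c :: nat
  assumes c_pos: "c \<ge> 1"
    and x_closed: "i < m \<Longrightarrow> x i \<in> carrier G"
    and gen: "generate G (x ` {..<m}) = carrier G"
    and nil: "\<gamma> (Suc c) = {\<one>}"
begin

abbreviation "g \<equiv> gv G x"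

lemma gv_gamma: "leaves t \<subseteq> {..<m} \<Longrightarrow> g t \<in> \<gamma> (wt t)"
proof (induction t)
  case (Node s t)
  then show ?case using comm_in_gamma_add[OF wt_pos wt_pos, of "g s" s "g t" t] by simp
qed (simp add: x_closed)

lemma gv_closed: "leaves t \<subseteq> {..<m} \<Longrightarrow> g t \<in> carrier G"
  using gv_gamma gamma_carrier by blast

lemma gv_trivial: "leaves t \<subseteq> {..<m} \<Longrightarrow> wt t > c \<Longrightarrow> g t = \<one>"
  using gv_gamma[of t] gamma_antimono[of "Suc c" "wt t"] nil by auto

text \<open>Writing \<open>y\<^sub>k\<close> for the value of \<open>iter_node z y k\<close>,
  conjugation by \<open>z\<close> sends \<open>y\<^sub>k\<close> to
  \<open>y\<^sub>k\<^sub>+\<^sub>1 y\<^sub>k\<close>. Hence \<open>z\<close> normalizes the subgroup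
  generated by the eliminated letters; those of weight above \<open>c\<close> can be left out
  because nilpotency makes their values trivial.\<close>

lemma generate_elim:
  assumes Z: "\<And>t. t \<in> Z \<Longrightarrow> leaves t \<subseteq> {..<m}" and z: "z \<in> Z"
  shows "generate G (g ` Z) = {n \<otimes> g z [^] (k::int) | n k. n \<in> generate G (g ` elim c z Z)}"
    and "n \<in> generate G (g ` elim c z Z) \<Longrightarrow> g z \<otimes> n \<otimes> inv g z \<in> generate G (g ` elim c z Z)"
proof -
  let ?H = "generate G (g ` elim c z Z)" and ?y = "\<lambda>y k. g (iter_node z y k)"
  have lv: "leaves (iter_node z y k) \<subseteq> {..<m}" if "y \<in> Z" for y k
    using leaves_iter_node[OF Z[OF z] Z[OF that]] .
  have elim_lv: "leaves t \<subseteq> {..<m}" if "t \<in> elim c z Z" for t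
    using that lv by (auto simp: elim_def)
  have cl: "g ` elim c z Z \<subseteq> carrier G" using elim_lv gv_closed by blast
  have zc: "g z \<in> carrier G" using Z z gv_closed by blast
  interpret H: subgroup ?H G using generate_is_subgroup[OF cl] .
  have yc: "?y y k \<in> carrier G" if "y \<in> Z" for y k using gv_closed[OF lv[OF that]] .
  have y: "?y y k \<in> ?H" if "y \<in> Z - {z}" for y k
  proof (cases "wt (iter_node z y k) \<le> c")
    case True
    then have "iter_node z y k \<in> elim c z Z" using that by (auto simp: elim_def)
    then show ?thesis by (blast intro: generate.incl)
  next
    case False
    then show ?thesis using gv_trivial[OF lv] that H.one_closed by simp
  qed
  have conj_y: "g z \<otimes> ?y y k \<otimes> inv g z = ?y y (Suc k) \<otimes> ?y y k" if "y \<in> Z" for y k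
    using yc[OF that, of k] zc by (simp add: comm_def m_assoc)
  have 1: "g z \<otimes> n \<otimes> inv g z \<in> ?H" if "n \<in> ?H" for n
    using that
  proof (induction rule: generate.induct)
    case (incl h)
    then obtain y k where "h = ?y y k" "y \<in> Z - {z}" by (auto simp: elim_def)
    then have "g z \<otimes> h \<otimes> inv g z = ?y y (Suc k) \<otimes> ?y y k" using conj_y by blast
    then show ?case using H.m_closed[OF y y] \<open>y \<in> Z - {z}\<close> by presburger
  next
    case (inv h)
    then obtain y k where h: "h = ?y y k" "y \<in> Z - {z}" by (auto simp: elim_def)
    have "g z \<otimes> inv h \<otimes> inv g z = inv (g z \<otimes> h \<otimes> inv g z)"
      using h yc[of y k] zc by (simp add: inv_mult_group m_assoc)
    also have "\<dots> = inv (?y y (Suc k) \<otimes> ?y y k)"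
      using conj_y[of y k] h by (metis DiffD1)
    finally show ?case using H.m_inv_closed[OF H.m_closed[OF y y]] h(2) by presburger
  next
    case (eng h1 h2)
    then have "h1 \<in> carrier G" "h2 \<in> carrier G" using H.mem_carrier by auto
    then have "g z \<otimes> (h1 \<otimes> h2) \<otimes> inv g z = (g z \<otimes> h1 \<otimes> inv g z) \<otimes> (g z \<otimes> h2 \<otimes> inv g z)"
      using zc by (simp add: m_assoc inv_mult_cancel)
    then show ?case using eng.IH by simp
  qed (use zc in simp)
  show "n \<in> generate G (g ` elim c z Z) \<Longrightarrow> g z \<otimes> n \<otimes> inv g z \<in> generate G (g ` elim c z Z)"
    by (rule 1)
  text \<open>Downward induction on \<open>k\<close>, from \<open>y\<^sub>k = (z\<inverse> y\<^sub>k\<^sub>+\<^sub>1 z) (z\<inverse> y\<^sub>k z)\<close>.\<close>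
  have inv_y: "inv g z \<otimes> ?y y k \<otimes> g z \<in> ?H" if "y \<in> Z - {z}" "k \<le> Suc c" for y k
    using that(2)
  proof (induction k rule: inc_induct)
    case base
    have "wt (iter_node z y (Suc c)) > c"
      using wt_pos[of y] wt_pos[of z] by (cases "wt z") (auto simp: wt_iter_node)
    then show ?case using gv_trivial[OF lv] that zc H.one_closed by (simp del: iter_node.simps)
  next
    case (step k)
    have yk: "?y y k \<in> carrier G" "?y y (Suc k) \<in> carrier G" using that yc by blast+
    have "?y y k = inv g z \<otimes> (g z \<otimes> ?y y k \<otimes> inv g z) \<otimes> g z"
      using yk zc by (simp add: m_assoc inv_mult_cancel)
    also have "\<dots> = (inv g z \<otimes> ?y y (Suc k) \<otimes> g z) \<otimes> (inv g z \<otimes> ?y y k \<otimes> g z)"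
      using conj_y[of y k] that yk zc by (simp add: m_assoc inv_mult_cancel)
    finally have "inv g z \<otimes> ?y y k \<otimes> g z = inv (inv g z \<otimes> ?y y (Suc k) \<otimes> g z) \<otimes> ?y y k"
      using yk zc by (metis inv_closed inv_mult_cancel(1) m_closed)
    then show ?case using step.IH y[OF that(1), of k] by simp
  qed
  have 2: "inv g z \<otimes> n \<otimes> g z \<in> ?H" if "n \<in> ?H" for n
    using that
  proof (induction rule: generate.induct)
    case (incl h)
    then obtain y k where h: "h = ?y y k" "y \<in> Z - {z}" "wt (iter_node z y k) \<le> c" by (auto simp: elim_def)
    then have "k \<le> Suc c" using mult_wt_le_imp_le[of k z c] by (simp add: wt_iter_node)
    then show ?case using inv_y h by blast
  next
    case (inv h)
    then obtain y k where h: "h = ?y y k" "y \<in> Z - {z}" "wt (iter_node z y k) \<le> c" by (auto simp: elim_def)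
    then have "k \<le> Suc c" using mult_wt_le_imp_le[of k z c] by (simp add: wt_iter_node)
    moreover have "inv g z \<otimes> inv h \<otimes> g z = inv (inv g z \<otimes> h \<otimes> g z)"
      using h yc[of y k] zc by (simp add: inv_mult_group m_assoc)
    ultimately show ?case using inv_y h by simp
  next
    case (eng h1 h2)
    then have "h1 \<in> carrier G" "h2 \<in> carrier G" using H.mem_carrier by auto
    then have "inv g z \<otimes> (h1 \<otimes> h2) \<otimes> g z = (inv g z \<otimes> h1 \<otimes> g z) \<otimes> (inv g z \<otimes> h2 \<otimes> g z)"
      using zc by (simp add: m_assoc inv_mult_cancel)
    then show ?case using eng.IH by simp
  qed (use zc in simp)
  let ?R = "{n \<otimes> g z [^] (k::int) | n k. n \<in> ?H}"
  have Zc: "g ` Z \<subseteq> carrier G" using Z gv_closed by blast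
  have "subgroup ?R G" using normalized_product_subgroup[OF H.subgroup_axioms zc 1 2] .
  moreover have "g ` Z \<subseteq> ?R"
  proof
    fix h assume "h \<in> g ` Z"
    then obtain y' where y': "h = g y'" "y' \<in> Z" by blast
    show "h \<in> ?R"
    proof (cases "y' = z")
      case True
      then have "h = \<one> \<otimes> g z [^] (1::int)" using zc y' by simp
      then show ?thesis using H.one_closed by blast
    next
      case False
      have "h = h \<otimes> g z [^] (0::int)" using y' Z gv_closed by simp
      moreover have "h \<in> ?H" using y[of y' 0] y' False by simp
      ultimately show ?thesis by blast
    qed
  qed
  ultimately have "generate G (g ` Z) \<subseteq> ?R" by (rule generate_subgroup_incl[rotated])
  moreover have "?R \<subseteq> generate G (g ` Z)"
  proof -
    interpret Z: subgroup "generate G (g ` Z)" G using generate_is_subgroup[OF Zc] .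
    have it: "?y y k \<in> generate G (g ` Z)" if "y \<in> Z" for y k
    proof (induction k)
      case 0
      then show ?case using that by (auto intro: generate.incl)
    next
      case (Suc k)
      have "g z \<in> generate G (g ` Z)" using z by (auto intro: generate.incl)
      then show ?case using Suc Z.m_closed Z.m_inv_closed by (simp add: comm_def)
    qed
    then have "g ` elim c z Z \<subseteq> generate G (g ` Z)" by (auto simp: elim_def)
    then have "?H \<subseteq> generate G (g ` Z)" using Z.subgroup_axioms by (rule generate_subgroup_incl)
    moreover have "g z [^] (k::int) \<in> generate G (g ` Z)" for k
      using subgroup_int_pow_closed[OF Z.subgroup_axioms] generate.incl[of "g z" "g ` Z"] z by blast
    ultimately show ?thesis by blast
  qed
  ultimately show "generate G (g ` Z) = ?R" by blast
qed

text \<open>Eliminating letters of minimal weight one after the other, until none of weight at most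
  \<open>c\<close> is left.\<close>

lemma elimination:
  assumes "finite Z" "\<And>t. t \<in> Z \<Longrightarrow> leaves t \<subseteq> {..<m} \<and> Suc c - d \<le> wt t \<and> wt t \<le> c" "d \<le> Suc c"
  shows "\<exists>zs. generate G (g ` Z) = nf_set G x zs \<and> nf_chain G x zs \<and>
    (\<forall>n\<le>c. words_span Z n \<subseteq> ncps.span (set (pbw zs n)) \<and> length (pbw zs n) \<le> cnt Z n) \<and>
    (\<forall>t\<in>set zs. leaves t \<subseteq> {..<m} \<and> wt t \<le> c)"
  using assms
proof (induction d arbitrary: Z)
  case 0
  then have Z: "Z = {}" by fastforce
  have "words_span {} n \<subseteq> ncps.span (set (pbw [] n))" for n
    unfolding words_span_def by (rule ncps.span_mono) auto
  then show ?case by (intro exI[of _ "[]"]) (auto simp: Z generate_empty cnt.simps)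
next
  case (Suc d)
  let ?w = "Suc c - Suc d"
  from Suc.prems show ?case
  \<comment> \<open>A lexicographic descent: \<open>d\<close> measures how far below
    \<open>Suc c\<close> the weights may reach, and the inner induction counts the letters of the
    smallest admissible weight.\<close>
  proof (induction "card {t \<in> Z. wt t = ?w}" arbitrary: Z)
    case 0
    then have "{t \<in> Z. wt t = ?w} = {}" by simp
    then have "Suc c - d \<le> wt t" if "t \<in> Z" for t using 0(3)[OF that] that by auto
    then show ?case using 0 by (intro Suc.IH) auto
  next
    case (Suc N)
    then have "{t \<in> Z. wt t = ?w} \<noteq> {}" by (metis card.empty nat.distinct(1))
    then obtain z where z: "z \<in> Z" "wt z = ?w" by blast
    let ?Z' = "elim c z Z"
    have lv: "leaves t \<subseteq> {..<m}" if "t \<in> Z" for t using Suc.prems(2)[OF that] by simp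
    have Z': "leaves t \<subseteq> {..<m} \<and> ?w \<le> wt t \<and> wt t \<le> c" if t: "t \<in> ?Z'" for t
    proof -
      obtain y k where "t = iter_node z y k" "y \<in> Z" "wt t \<le> c" using t by (auto simp: elim_def)
      then show ?thesis
        using leaves_iter_node[OF lv[OF z(1)] lv, of y k] Suc.prems(2)[of y] by (simp add: wt_iter_node)
    qed
    \<comment> \<open>Every proper bracket with \<open>z\<close> weighs more than \<open>?w\<close>,
      so elimination creates no new letter of that weight and removes \<open>z\<close>.\<close>
    have sub: "{t \<in> ?Z'. wt t = ?w} \<subseteq> {t \<in> Z. wt t = ?w} - {z}"
    proof
      fix t assume "t \<in> {t \<in> ?Z'. wt t = ?w}"
      then obtain y k where t: "t = iter_node z y k" "y \<in> Z - {z}" "wt t = ?w" by (auto simp: elim_def)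
      then have "k = 0" using wt_pos[of y] z(2) by (cases k) (auto simp: wt_iter_node)
      then show "t \<in> {t \<in> Z. wt t = ?w} - {z}" using t by simp
    qed
    have sup: "{t \<in> Z. wt t = ?w} - {z} \<subseteq> {t \<in> ?Z'. wt t = ?w}"
      using in_elim[of _ Z z c] Suc.prems(2) by auto
    have "card {t \<in> ?Z'. wt t = ?w} = N"
      using equalityI[OF sub sup] z Suc.hyps(2) Suc.prems(1) by simp
    then obtain zs where zs: "generate G (g ` ?Z') = nf_set G x zs" "nf_chain G x zs"
      "\<And>n. n \<le> c \<Longrightarrow> words_span ?Z' n \<subseteq> ncps.span (set (pbw zs n))"
      "\<And>n. n \<le> c \<Longrightarrow> length (pbw zs n) \<le> cnt ?Z' n"
      "\<forall>t\<in>set zs. leaves t \<subseteq> {..<m} \<and> wt t \<le> c"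
      using Suc.hyps(1)[of ?Z'] finite_elim[OF Suc.prems(1), of c z] Z' Suc.prems(3) by blast
    have "g ` ?Z' \<subseteq> carrier G" using Z' gv_closed by blast
    then have "subgroup (nf_set G x zs) G" using generate_is_subgroup zs(1) by metis
    then have "nf_chain G x (z # zs)"
      using zs(1,2) generate_elim(2)[of Z z, OF lv z(1)] by simp
    moreover have "generate G (g ` Z) = nf_set G x (z # zs)"
      using generate_elim(1)[of Z z, OF lv z(1)] zs(1) by simp
    moreover have "words_span Z n \<subseteq> ncps.span (set (pbw (z # zs) n))" if "n \<le> c" for n
      by (rule words_span_pbw_elim[OF zs(3) that])
    moreover have "length (pbw (z # zs) n) \<le> cnt Z n" if "n \<le> c" for n
      by (rule length_pbw_elim[OF Suc.prems(1) z(1) zs(4) that])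
    moreover have "\<forall>t\<in>set (z # zs). leaves t \<subseteq> {..<m} \<and> wt t \<le> c"
      using zs(5) Suc.prems(2)[OF z(1)] by simp
    ultimately show ?case by blast
  qed
qed

end

section \<open>Free nilpotent groups and power series\<close>

text \<open>Freeness enters in this form alone: the generators may be sent to arbitrary series with
  constant term 1.\<close>

locale free_nilpotent_group = nilpotent_generated +
  assumes universal: "(\<And>i. i < m \<Longrightarrow> vanish 1 (a i - 1)) \<Longrightarrow>
    \<exists>\<phi>. mhom G c \<phi> \<and> (\<forall>i<m. vanish (Suc c) (\<phi> (x i) - a i))"
begin

definition \<mu> :: "'a \<Rightarrow> ncps"
  where "\<mu> = (SOME \<phi>. mhom G c \<phi> \<and> (\<forall>i<m. vanish (Suc c) (\<phi> (x i) - (1 + var i))))"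

lemma \<mu>: "mhom G c \<mu>" "i < m \<Longrightarrow> vanish (Suc c) (\<mu> (x i) - (1 + var i))"
proof -
  have "vanish 1 (1 + var i - 1)" for i by (simp add: vanish_def var_eq_mon)
  then have "\<exists>\<phi>. mhom G c \<phi> \<and> (\<forall>i<m. vanish (Suc c) (\<phi> (x i) - (1 + var i)))"
    by (intro universal) blast
  from someI_ex[OF this]
  show "mhom G c \<mu>" "i < m \<Longrightarrow> vanish (Suc c) (\<mu> (x i) - (1 + var i))"
    unfolding \<mu>_def by blast+
qed

definition lead :: "nat \<Rightarrow> 'a \<Rightarrow> ncps"
  where "lead d a = hpart d (\<mu> a - 1)"

definition level :: "nat \<Rightarrow> 'a set"
  where "level d = {a \<in> carrier G. vanish d (\<mu> a - 1)}"

lemma level_subgroup': "d \<le> Suc c \<Longrightarrow> subgroup (level d) G"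
  unfolding level_def by (rule level_subgroup[OF \<mu>(1)])

lemma level_1: "level 1 = carrier G"
  using mhomD(1)[OF \<mu>(1)] by (auto simp: level_def)

lemma level_antimono: "d \<le> d' \<Longrightarrow> level d' \<subseteq> level d"
  by (auto simp: level_def elim: vanish_antimono)

lemma level_Suc_iff: "a \<in> level (Suc d) \<longleftrightarrow> a \<in> level d \<and> lead d a = 0"
  by (auto simp: level_def lead_def vanish_Suc_iff)

lemma lead_mult: "1 \<le> d \<Longrightarrow> d \<le> c \<Longrightarrow> a \<in> level d \<Longrightarrow> b \<in> level d \<Longrightarrow> lead d (a \<otimes> b) = lead d a + lead d b"
  unfolding level_def lead_def using lead_additive[OF \<mu>(1)] by simp

lemma lead_pow:
  assumes d: "1 \<le> d" "d \<le> c"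
  shows "lead d \<one> = 0" "a \<in> level d \<Longrightarrow> lead d (inv a) = - lead d a"
    "a \<in> level d \<Longrightarrow> lead d (a [^] (n::nat)) = sc (of_nat n) (lead d a)"
    "a \<in> level d \<Longrightarrow> lead d (a [^] (z::int)) = sc (of_int z) (lead d a)"
proof -
  have sub: "subgroup (level d) G" using d by (intro level_subgroup') simp
  note p = additive_int_pow[OF sub, of "lead d", OF lead_mult[OF d]]
  show "lead d \<one> = 0" by (rule p(1))
  show "a \<in> level d \<Longrightarrow> lead d (inv a) = - lead d a" by (rule p(2))
  show "a \<in> level d \<Longrightarrow> lead d (a [^] (n::nat)) = sc (of_nat n) (lead d a)"
    using p(3) of_int_mult_sc[of "int n" "lead d a"] by simp
  show "a \<in> level d \<Longrightarrow> lead d (a [^] (z::int)) = sc (of_int z) (lead d a)"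
    using p(4) of_int_mult_sc[of z "lead d a"] by simp
qed

lemma lead_gv:
  assumes "leaves t \<subseteq> {..<m}" "wt t \<le> c"
  shows "g t \<in> level (wt t) \<and> lead (wt t) (g t) = av t"
  using assms
proof (induction t)
  case (Leaf i)
  then have i: "i < m" by simp
  have "hpart 1 (\<mu> (x i) - 1) = hpart 1 (1 + var i - 1)"
  proof (rule hpart_cong)
    have "vanish (Suc 1) (\<mu> (x i) - (1 + var i))"
      by (rule vanish_antimono[OF \<mu>(2)[OF i]]) (use c_pos in simp)
    then show "vanish (Suc 1) (\<mu> (x i) - 1 - (1 + var i - 1))" by (simp add: algebra_simps)
  qed
  also have "\<dots> = var i" using hpart_var by simp
  finally show ?case using level_1 x_closed[OF i] by (simp add: lead_def)
next
  case (Node s t)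
  then have "g s \<in> carrier G" "g t \<in> carrier G" by (simp_all add: gv_closed)
  then show ?case
    using Node vanish_comm[OF \<mu>(1) wt_pos[of s] wt_pos[of t], of "g s" "g t"]
      lead_comm[OF \<mu>(1) wt_pos[of s] wt_pos[of t], of "g s" "g t"] by (simp add: level_def lead_def)
qed

text \<open>A letter heavier than \<open>d\<close> has no component in degree \<open>d\<close>, a
  lighter one has exponent 0, and the leading terms of the rest add up with their exponents as
  coefficients.\<close>

lemma lead_nf:
  assumes "length es = length zs" "\<forall>t\<in>set zs. leaves t \<subseteq> {..<m} \<and> wt t \<le> c" "1 \<le> d" "d \<le> c"
    "\<forall>(z, e)\<in>set (zip zs es). wt z < d \<longrightarrow> e = 0"
  shows "nf G x zs es \<in> level d \<and>
    lead d (nf G x zs es) = (\<Sum>(z, e)\<leftarrow>zip zs es. if wt z = d then sc (of_int e) (av z) else 0)"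
  using assms
proof (induction es zs rule: list_induct2)
  case Nil
  then show ?case using lead_pow(1)[OF Nil(2,3)] subgroup.one_closed[OF level_subgroup'] by simp
next
  case (Cons e es z zs)
  have z: "g z \<in> level (wt z)" "lead (wt z) (g z) = av z" using lead_gv Cons.prems(1) by simp_all
  have IH: "nf G x zs es \<in> level d"
    "lead d (nf G x zs es) = (\<Sum>(z, e)\<leftarrow>zip zs es. if wt z = d then sc (of_int e) (av z) else 0)"
    using Cons by simp_all
  have "g z [^] e \<in> level d \<and> lead d (g z [^] e) = (if wt z = d then sc (of_int e) (av z) else 0)"
  proof (cases "wt z < d")
    case True
    then have "g z [^] e = \<one>" using Cons.prems(4) by simp
    then show ?thesis using True lead_pow(1)[OF Cons.prems(2,3)] Cons.prems(3)
      subgroup.one_closed[OF level_subgroup'[of d]] by simp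
  next
    case False
    then have zd: "g z \<in> level d" using z(1) level_antimono[of d "wt z"] by auto
    have "lead d (g z) = (if wt z = d then av z else 0)"
    proof (cases "wt z = d")
      case neq: False
      then have "g z \<in> level (Suc d)" using False z(1) level_antimono[of "Suc d" "wt z"] by auto
      then show ?thesis using neq level_Suc_iff by simp
    qed (use z in simp)
    then show ?thesis
      using lead_pow(4)[OF Cons.prems(2,3) zd, of e] subgroup_int_pow_closed[OF level_subgroup' zd]
        Cons.prems(3) by simp
  qed
  then show ?case using IH lead_mult[OF Cons.prems(2,3) IH(1), of "g z [^] e"] Cons.prems(3)
    subgroup.m_closed[OF level_subgroup'[of d] IH(1)] by (simp add: add.commute)
qed

lemma normal_form:
  "\<exists>zs. carrier G = nf_set G x zs \<and> nf_chain G x zs \<and>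
    (\<forall>t\<in>set zs. leaves t \<subseteq> {..<m} \<and> wt t \<le> c) \<and>
    (\<forall>n. 1 \<le> n \<longrightarrow> n \<le> c \<longrightarrow> distinct (map av (filter (\<lambda>z. wt z = n) zs)) \<and>
      ncps.independent (set (map av (filter (\<lambda>z. wt z = n) zs))))"
proof -
  let ?X = "Leaf ` {..<m}"
  have "g ` ?X = x ` {..<m}" by (simp add: image_image)
  then have genX: "generate G (g ` ?X) = carrier G" using gen by simp
  obtain zs where zs: "carrier G = nf_set G x zs" "nf_chain G x zs"
    "\<forall>n\<le>c. words_span ?X n \<subseteq> ncps.span (set (pbw zs n)) \<and> length (pbw zs n) \<le> cnt ?X n"
    "\<forall>t\<in>set zs. leaves t \<subseteq> {..<m} \<and> wt t \<le> c"
  proof -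
    have X: "leaves t \<subseteq> {..<m} \<and> Suc c - c \<le> wt t \<and> wt t \<le> c" if "t \<in> ?X" for t
      using that c_pos by auto
    show ?thesis using elimination[of ?X c, OF _ X] genX that by auto
  qed
  have "distinct (map av (filter (\<lambda>z. wt z = n) zs)) \<and>
      ncps.independent (set (map av (filter (\<lambda>z. wt z = n) zs)))" if n: "1 \<le> n" "n \<le> c" for n
  proof -
    let ?B = "mon ` {w. set w \<subseteq> {..<m} \<and> length w = n}"
    have "?B \<subseteq> words_span ?X n"
    proof
      fix b assume "b \<in> ?B"
      then obtain w where w: "b = mon w" "set w \<subseteq> {..<m}" "length w = n" by blast
      have "avs (map Leaf w) = b" using w(1) prod_list_var[of w] by (simp add: comp_def)
      moreover have "wts (map Leaf w) = n" using w(3) by (simp add: comp_def sum_list_triv)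
      ultimately show "b \<in> words_span ?X n"
        unfolding words_span_def using w(2)
        by (intro ncps.span_base CollectI exI[of _ "map Leaf w"]) auto
    qed
    then have "?B \<subseteq> ncps.span (set (pbw zs n))" using zs(3) n by blast
    \<comment> \<open>Both numbers are compared with \<open>m ^ n\<close>: the monomials are at most
      as many as the independent words that they span, so none is repeated or redundant.\<close>
    moreover have "length (pbw zs n) \<le> card ?B"
      using zs(3)[rule_format, OF n(2)] cnt_Leaf[of m n] card_mon_words[of m n] by simp
    ultimately have d: "distinct (pbw zs n)" "ncps.independent (set (pbw zs n))"
      using ncps.spanning_list_basis[OF independent_mon] by blast+
    note sub = letters_in_pbw[OF n(1), of zs]
    obtain ys where "mset (pbw zs n) = mset (map av (filter (\<lambda>z. wt z = n) zs) @ ys)"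
      using sub by (metis ex_mset mset_append mset_subset_eq_exists_conv)
    then have "distinct (map av (filter (\<lambda>z. wt z = n) zs))"
      using d(1) mset_eq_imp_distinct_iff distinct_append by metis
    moreover have "set (map av (filter (\<lambda>z. wt z = n) zs)) \<subseteq> set (pbw zs n)"
      using set_mset_mono[OF sub] by simp
    ultimately show ?thesis using d(2) ncps.independent_mono by blast
  qed
  then show ?thesis using zs by blast
qed

text \<open>Magnus' theorem, truncated at degree \<open>c\<close>.\<close>

theorem level_gamma:
  assumes a: "a \<in> level (Suc n)" and n: "n \<le> c"
  shows "a \<in> \<gamma> (Suc n)"
proof -
  obtain zs where zs: "carrier G = nf_set G x zs" "\<forall>t\<in>set zs. leaves t \<subseteq> {..<m} \<and> wt t \<le> c"
    "\<And>n. 1 \<le> n \<Longrightarrow> n \<le> c \<Longrightarrow> distinct (map av (filter (\<lambda>z. wt z = n) zs)) \<and>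
      ncps.independent (set (map av (filter (\<lambda>z. wt z = n) zs)))"
    using normal_form by blast
  have "a \<in> nf_set G x zs" using a zs(1) by (simp add: level_def)
  then obtain es where es: "length es = length zs" "a = nf G x zs es" by (rule nf_setE)
  \<comment> \<open>The exponents are killed weight by weight: once those of weight below
    \<open>d\<close> vanish, the component of \<open>\<mu> a\<close> in degree \<open>d\<close> is a
    combination of independent vectors with the exponents of weight \<open>d\<close> as
    coefficients, and it is 0.\<close>
  have "\<forall>(z, e)\<in>set (zip zs es). wt z < d \<longrightarrow> e = 0" if "d \<le> Suc n" for d
    using that
  proof (induction d)
    case (Suc d)
    show ?case
    proof (cases "d = 0")
      case True
      have "\<not> wt z < Suc d" for z :: "nat ctree" using wt_pos[of z] True by simp
      then show ?thesis by auto
    next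
      case False
      then have d: "1 \<le> d" "d \<le> c" using Suc.prems n by auto
      have IH: "\<forall>(z, e)\<in>set (zip zs es). wt z < d \<longrightarrow> e = 0" using Suc by simp
      have "a \<in> level (Suc d)" using a Suc.prems level_antimono[of "Suc d" "Suc n"] by auto
      then have "(\<Sum>(z, e)\<leftarrow>zip zs es. if wt z = d then sc (of_int e) (av z) else 0) = 0"
        using lead_nf[OF es(1) zs(2) d IH] es(2) level_Suc_iff by simp
      then have "e = 0" if "(z, e) \<in> set (zip zs es)" "wt z = d" for z e
        using sum_independent_eq_0[OF es(1), of "\<lambda>z. wt z = d"] zs(3)[OF d] that by blast
      then show ?thesis using IH by (auto simp: less_Suc_eq)
    qed
  qed simp
  from this[OF order.refl]
  have "\<forall>(z, e)\<in>set (zip zs es). wt z \<le> n \<longrightarrow> e = 0" by (simp add: less_Suc_eq_le)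
  with es(1) zs(2) have "nf G x zs es \<in> \<gamma> (Suc n)"
  proof (induction es zs rule: list_induct2)
    case Nil
    then show ?case using subgroup.one_closed[OF gamma_subgroup] by simp
  next
    case (Cons e es z zs)
    have "g z [^] e \<in> \<gamma> (Suc n)"
    proof (cases "wt z \<le> n")
      case True
      then show ?thesis using Cons.prems subgroup.one_closed[OF gamma_subgroup] by simp
    next
      case False
      then have "g z \<in> \<gamma> (Suc n)"
        using gv_gamma[of z] Cons.prems(1) gamma_antimono[of "Suc n" "wt z"] by auto
      then show ?thesis by (rule subgroup_int_pow_closed[OF gamma_subgroup])
    qed
    then show ?case using Cons subgroup.m_closed[OF gamma_subgroup] by simp
  qed
  then show ?thesis using es(2) by simp
qed

lemma \<mu>_inj:
  assumes "a \<in> carrier G" "b \<in> carrier G" "vanish (Suc c) (\<mu> a - \<mu> b)"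
  shows "a = b"
proof -
  have 1: "vanish (Suc c) (\<mu> (a \<otimes> inv b) - \<mu> a * \<mu> (inv b))"
    using mhomD(2)[OF \<mu>(1)] assms by simp
  have 2: "vanish (Suc c) (\<mu> a * \<mu> (inv b) - \<mu> b * \<mu> (inv b))"
    using assms(3) by (intro vanish_mult_cong) simp_all
  have "vanish (Suc c) (\<mu> (a \<otimes> inv b) - 1)"
    using vanish_trans[OF vanish_trans[OF 1 2] mhom_inv(2)[OF \<mu>(1) assms(2)]] .
  then have "a \<otimes> inv b \<in> \<gamma> (Suc c)" using assms by (intro level_gamma) (simp_all add: level_def)
  then show ?thesis using nil assms by (metis inv_closed inv_equality inv_inv singletonD)
qed

text \<open>The first nonzero leading term of \<open>h\<close> is multiplied by \<open>n\<close> in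
  \<open>h [^] n\<close>, so the powers of \<open>h\<close> are pairwise distinct.\<close>

lemma infinite_subgroup:
  assumes H: "subgroup H G" and "H \<noteq> {\<one>}"
  shows "infinite H"
proof -
  interpret H: subgroup H G by (rule H)
  obtain h where h: "h \<in> H" "h \<noteq> \<one>" using assms(2) H.one_closed by blast
  have "h \<notin> level (Suc c)" using level_gamma[of h c] nil h(2) by auto
  then have ex: "\<exists>d. h \<notin> level d" by blast
  define d where "d = (LEAST d. h \<notin> level d)"
  have d: "h \<notin> level d" unfolding d_def by (rule LeastI_ex[OF ex])
  have "d \<noteq> 0" using d H.mem_carrier[OF h(1)] by (cases "d = 0") (auto simp: level_def)
  then obtain k where k: "d = Suc k" by (cases d) auto
  have hk: "h \<in> level k" using not_less_Least[of k "\<lambda>d. h \<notin> level d"] k by (auto simp: d_def)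
  have l: "lead k h \<noteq> 0" using d hk k level_Suc_iff by blast
  have "d \<le> Suc c" unfolding d_def by (rule Least_le) fact
  then have kc: "k \<le> c" using k by simp
  have k1: "1 \<le> k"
  proof (rule ccontr)
    assume "\<not> 1 \<le> k"
    then have "d = 1" using k by simp
    then show False using d level_1 h H.mem_carrier by blast
  qed
  have "inj (\<lambda>n::nat. h [^] n)"
  proof (rule injI)
    fix i j :: nat assume "h [^] i = h [^] j"
    then have "sc (of_nat i) (lead k h) = sc (of_nat j) (lead k h)"
      using lead_pow(3)[OF k1 kc hk] by metis
    then show "i = j" using l by simp
  qed
  then have "infinite (range (\<lambda>n::nat. h [^] n))" using finite_imageD infinite_UNIV_nat by blast
  moreover have "h [^] (n::nat) \<in> H" for n using h by (induction n) auto
  ultimately show ?thesis by (meson finite_subset image_subsetI)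
qed

text \<open>In a normal form every exponent matters only modulo some \<open>N\<close> with
  \<open>g z [^] N\<close> in \<open>K\<close>, which leaves finitely many cosets. The series of
  subgroups behind the normal form makes it possible to reduce one exponent at a time.\<close>

lemma finite_index_if_powers:
  assumes K: "subgroup K G" and pow: "\<And>a. a \<in> carrier G \<Longrightarrow> \<exists>N>0. a [^] (N::nat) \<in> K"
  shows "finite_index G K"
proof -
  interpret K: subgroup K G by (rule K)
  obtain zs where zs: "carrier G = nf_set G x zs" "nf_chain G x zs" "\<forall>t\<in>set zs. leaves t \<subseteq> {..<m} \<and> wt t \<le> c"
    using normal_form by blast
  \<comment> \<open>Right cosets absorb factors on the left, but the normal form has its outermost
    power on the right; hence the inverses.\<close>
  have "finite ((\<lambda>a. K #> inv a) ` nf_set G x zs)"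
    using zs(2,3)
  proof (induction zs)
    case (Cons z zs)
    let ?E = "nf_set G x zs"
    interpret E: subgroup ?E G using Cons.prems by simp
    have zc: "g z \<in> carrier G" using gv_closed Cons.prems by simp
    obtain N where N: "N > 0" "g z [^] (N::nat) \<in> K" using pow[OF zc] by blast
    have conj: "g z [^] (r::nat) \<otimes> n \<otimes> inv (g z [^] r) \<in> ?E" if "n \<in> ?E" for n r
    proof (induction r)
      case (Suc r)
      have "g z [^] Suc r \<otimes> n \<otimes> inv (g z [^] Suc r) = g z \<otimes> (g z [^] r \<otimes> n \<otimes> inv (g z [^] r)) \<otimes> inv g z"
        by (subst (1 2) nat_pow_Suc2) (use zc that in \<open>simp_all add: inv_mult_group m_assoc\<close>)
      then show ?case using Suc Cons.prems by simp
    qed (use that in simp)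
    have "(\<lambda>a. K #> inv a) ` nf_set G x (z # zs) \<subseteq>
      (\<lambda>(C, r). C #> g z [^] r) ` (((\<lambda>a. K #> inv a) ` ?E) \<times> {..<N})"
    proof
      fix C assume "C \<in> (\<lambda>a. K #> inv a) ` nf_set G x (z # zs)"
      then obtain n k where C: "C = K #> inv (n \<otimes> g z [^] (k::int))" "n \<in> ?E" by auto
      have nc: "n \<in> carrier G" using C E.mem_carrier by blast
      \<comment> \<open>The remainder is nonnegative, so that only conjugation by
        \<open>g z [^] r\<close> with natural \<open>r\<close> is involved.\<close>
      define r where "r = nat ((- k) mod int N)"
      define q where "q = (- k) div int N"
      have rN: "r < N" using N(1) by (simp add: r_def nat_less_iff)
      have "- k = int N * q + int r" using N(1) by (simp add: r_def q_def)
      then have "g z [^] (- k) = (g z [^] int N) [^] q \<otimes> g z [^] int r"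
        using zc by (simp add: int_pow_mult int_pow_pow)
      then have zk: "g z [^] (- k) = (g z [^] N) [^] q \<otimes> g z [^] r" by (simp add: int_pow_int)
      have "(g z [^] N) [^] q \<in> K" using N(2) by (rule subgroup_int_pow_closed[OF K])
      define n' where "n' = g z [^] r \<otimes> n \<otimes> inv (g z [^] r)"
      have n': "n' \<in> ?E" "n' \<in> carrier G" using conj[OF C(2)] E.mem_carrier by (auto simp: n'_def)
      \<comment> \<open>The first factor is absorbed by \<open>K\<close>, and \<open>n'\<close> is
        again in the smaller subgroup: the coset is one of the finitely many already known,
        translated by one of \<open>N\<close> powers.\<close>
      have "inv (n \<otimes> g z [^] k) = (g z [^] N) [^] q \<otimes> (inv n' \<otimes> g z [^] r)"
      proof -
        have "inv (n \<otimes> g z [^] k) = g z [^] (- k) \<otimes> inv n" using nc zc by (simp add: inv_mult_group int_pow_neg)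
        also have "\<dots> = (g z [^] N) [^] q \<otimes> (g z [^] r \<otimes> inv n)" using nc zc by (simp add: zk m_assoc)
        also have "g z [^] r \<otimes> inv n = inv n' \<otimes> g z [^] r"
          using nc zc by (simp add: n'_def inv_mult_group m_assoc)
        finally show ?thesis .
      qed
      then have "C = K #> (g z [^] N) [^] q #> (inv n' \<otimes> g z [^] r)"
        using C n' zc K.subset by (simp add: coset_mult_assoc)
      also have "K #> (g z [^] N) [^] q = K"
        using \<open>(g z [^] N) [^] q \<in> K\<close> K.rcos_const[OF is_group] by blast
      also have "K #> (inv n' \<otimes> g z [^] r) = (K #> inv n') #> g z [^] r"
        using n' zc K.subset by (simp add: coset_mult_assoc)
      finally show "C \<in> (\<lambda>(C, r). C #> g z [^] r) ` (((\<lambda>a. K #> inv a) ` ?E) \<times> {..<N})"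
        using n'(1) rN by force
    qed
    moreover have "finite (((\<lambda>a. K #> inv a) ` ?E) \<times> {..<N})" using Cons by simp
    ultimately show ?case by (meson finite_imageI finite_subset)
  qed simp
  moreover have "rcosets K \<subseteq> (\<lambda>a. K #> inv a) ` nf_set G x zs"
  proof
    fix C assume "C \<in> rcosets K"
    then obtain a where "a \<in> carrier G" "C = K #> inv (inv a)" by (auto simp: RCOSETS_def)
    then show "C \<in> (\<lambda>a. K #> inv a) ` nf_set G x zs" using zs(1) inv_closed by blast
  qed
  ultimately show ?thesis unfolding finite_index_def by (rule finite_subset[rotated])
qed

text \<open>Clearing denominators turns a rational combination of linear parts into the linear part
  of a product of powers.\<close>

lemma span_lead_power:
  assumes K: "subgroup K G" and B: "B \<subseteq> lead 1 ` K" and v: "v \<in> ncps.span B"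
  shows "\<exists>N>0. \<exists>k\<in>K. sc (of_nat N) v = lead 1 k"
  using v
proof (induction rule: ncps.span_induct_alt)
  case base
  then show ?case
    using lead_pow(1)[of 1] c_pos level_1 subgroup.one_closed[OF K]
    by (intro exI[of _ 1] conjI bexI[of _ \<one>]) auto
next
  case (step q b y)
  interpret K: subgroup K G by (rule K)
  note add = lead_mult[of 1, OF order.refl c_pos, unfolded level_1]
  note pow = lead_pow[of 1, OF order.refl c_pos, unfolded level_1]
  obtain kb where kb: "kb \<in> K" "b = lead 1 kb" using step(1) B by blast
  obtain N k where N: "N > 0" "k \<in> K" "sc (of_nat N) y = lead 1 k" using step(2) by blast
  obtain p r where q: "q = of_int p / of_int r" "r > 0" by (cases q) (auto simp: Fract_of_int_quotient)
  define s where "s = nat r"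
  have s: "s > 0" "q = of_int p / of_nat s" using q by (simp_all add: s_def)
  have mem: "kb [^] (int N * p) \<in> K" "k [^] s \<in> K"
    using kb(1) N(2) subgroup_int_pow_closed[OF K, of _ "int s"]
    by (simp_all add: subgroup_int_pow_closed[OF K] int_pow_int)
  have "sc (of_nat (N * s)) (sc q b + y) = sc (of_int (int N * p)) b + sc (of_nat s) (sc (of_nat N) y)"
    using s by (simp add: ncps.scale_right_distrib ac_simps)
  also have "\<dots> = lead 1 (kb [^] (int N * p)) + lead 1 (k [^] s)"
    using pow(3)[of k s] pow(4)[of kb "int N * p"] kb N K.mem_carrier by simp
  also have "\<dots> = lead 1 (kb [^] (int N * p) \<otimes> k [^] s)" using add mem K.mem_carrier by simp
  finally have "sc (of_nat (N * s)) (sc q b + y) = lead 1 (kb [^] (int N * p) \<otimes> k [^] s)" .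
  then show ?case using N(1) s(1) K.m_closed[OF mem] by (intro exI[of _ "N * s"]) auto
qed

end

section \<open>Distortion and additive functions\<close>

context group
begin

lemma undistorted_length_bound:
  assumes "undistorted G H"
  obtains T S C where "finite_generators G (carrier G) T" "finite_generators G H S"
    "\<And>w. w \<in> H \<Longrightarrow> word_length G S w \<le> C * (C * word_length G T w + C)"
proof -
  obtain T S where T: "finite_generators G (carrier G) T" and S: "finite_generators G H S"
    and d: "distortion G T H S \<preceq>\<^sub>g (\<lambda>n. n)"
    using assms by (auto simp: undistorted_def growth_equiv_def)
  obtain C where C: "\<And>n. distortion G T H S n \<le> C * (C * n + C)"
    using d by (auto simp: dominated_def)
  have "word_length G S w \<le> C * (C * word_length G T w + C)" if w: "w \<in> H" for w
  proof -
    have "word_length G S w \<le> distortion G T H S (word_length G T w)"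
      unfolding distortion_def using w by (intro Max_ge distortion_set(1)[OF T S]) blast
    then show ?thesis using C le_trans by blast
  qed
  then show thesis using that T S by blast
qed

lemma finite_generators_subgroup: "finite_generators G H S \<Longrightarrow> subgroup H G"
  using generate_is_subgroup by (auto simp: finite_generators_def)

lemma letters_in_subgroup: "finite_generators G H S \<Longrightarrow> letters_of S \<subseteq> H"
  unfolding finite_generators_def by (auto intro: generate.incl generate.inv)

lemma wprod_in_subgroup: "subgroup H G \<Longrightarrow> set ws \<subseteq> H \<Longrightarrow> wprod ws \<in> H"
  by (induction ws) (auto intro: subgroup.one_closed subgroup.m_closed)

lemma finite_generators_word:
  assumes "finite_generators G H S" "w \<in> H"
  obtains ws where "length ws = word_length G S w" "set ws \<subseteq> letters_of S" "wprod ws = w"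
  using assms word_length_word[of S w] unfolding finite_generators_def by blast

lemma additive_length_bound:
  fixes f :: "'a \<Rightarrow> rat"
  assumes S: "finite_generators G H S" and f: "\<And>a b. a \<in> H \<Longrightarrow> b \<in> H \<Longrightarrow> f (a \<otimes> b) = f a + f b"
  shows "\<exists>M\<ge>0. \<forall>w\<in>H. \<bar>f w\<bar> \<le> M * of_nat (word_length G S w)"
proof -
  have H: "subgroup H G" using S by (rule finite_generators_subgroup)
  note lets = letters_in_subgroup[OF S]
  define M where "M = Max (insert 0 ((\<lambda>s. \<bar>f s\<bar>) ` letters_of S))"
  have fin: "finite (insert 0 ((\<lambda>s. \<bar>f s\<bar>) ` letters_of S))" using S by (simp add: finite_generators_def)
  have M: "M \<ge> 0" "\<And>s. s \<in> letters_of S \<Longrightarrow> \<bar>f s\<bar> \<le> M"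
    unfolding M_def using fin by (auto intro!: Max_ge)
  have one: "f \<one> = 0" using f[of \<one> \<one>] subgroup.one_closed[OF H] by simp
  have bound: "\<bar>f (wprod ws)\<bar> \<le> M * of_nat (length ws)" if "set ws \<subseteq> letters_of S" for ws
    using that
  proof (induction ws)
    case (Cons s ws)
    have "wprod ws \<in> H" using wprod_in_subgroup[OF H, of ws] Cons.prems lets by auto
    then have "f (wprod (s # ws)) = f s + f (wprod ws)" using f[of s "wprod ws"] Cons.prems lets by auto
    then have "\<bar>f (wprod (s # ws))\<bar> \<le> \<bar>f s\<bar> + \<bar>f (wprod ws)\<bar>" by simp
    also have "\<dots> \<le> M + M * of_nat (length ws)"
      using M(2)[of s] Cons by (intro add_mono) simp_all
    finally show ?case by (simp add: algebra_simps)
  qed (simp add: one)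
  show ?thesis
  proof (intro exI[of _ M] conjI ballI M(1))
    fix w assume "w \<in> H"
    then obtain ws where "length ws = word_length G S w" "set ws \<subseteq> letters_of S" "wprod ws = w"
      by (rule finite_generators_word[OF S])
    then show "\<bar>f w\<bar> \<le> M * of_nat (word_length G S w)" using bound[of ws] by simp
  qed
qed

text \<open>An additive function grows linearly along the powers of \<open>h\<close>, whereas their length in
  \<open>G\<close>, hence in \<open>H\<close>, is sublinear.\<close>

lemma undistorted_additive_eq_0:
  fixes f :: "'a \<Rightarrow> rat"
  assumes nil: "\<gamma> (Suc c) = {\<one>}" and u: "undistorted G H"
    and f: "\<And>a b. a \<in> H \<Longrightarrow> b \<in> H \<Longrightarrow> f (a \<otimes> b) = f a + f b"
    and h: "h \<in> H" "h \<in> \<gamma> 2"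
  shows "f h = 0"
proof (rule ccontr)
  assume "f h \<noteq> 0"
  obtain T S C where T: "finite_generators G (carrier G) T" and S: "finite_generators G H S"
    and C: "\<And>w. w \<in> H \<Longrightarrow> word_length G S w \<le> C * (C * word_length G T w + C)"
    using u by (rule undistorted_length_bound) blast
  obtain M where M: "M \<ge> 0" "\<And>w. w \<in> H \<Longrightarrow> \<bar>f w\<bar> \<le> M * of_nat (word_length G S w)"
    using additive_length_bound[OF S f] by blast
  have H: "subgroup H G" using S by (rule finite_generators_subgroup)
  have hc: "h \<in> carrier G" using h gamma_carrier by blast
  \<comment> \<open>For the \<open>n\<close> obtained next, \<open>h [^] (n * l)\<close> has length
    at most \<open>n\<close> in \<open>G\<close>, hence at most \<open>2 * C * C * n\<close> in
    \<open>H\<close>, while \<open>f\<close> takes the value \<open>n * l * f h\<close> on it. This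
    \<open>l\<close> makes the two bounds contradict each other.\<close>
  obtain l where l: "M * of_nat (2 * C * C) < of_nat l * \<bar>f h\<bar>"
    using ex_less_of_nat_mult[of "\<bar>f h\<bar>" "M * of_nat (2 * C * C)"] \<open>f h \<noteq> 0\<close> by auto
  obtain n where n: "n > 0" "l * word_length G T (h [^] (n::nat)) \<le> n"
    using derived_sublinear_powers[OF T nil h(2)] by blast
  have pow: "h [^] (k::nat) \<in> H" for k
    using h(1) H by (induction k) (auto intro: subgroup.one_closed subgroup.m_closed)
  have "word_length G T (h [^] (n * l)) \<le> l * word_length G T (h [^] n)"
    using word_length_pow_le[OF T, of "h [^] n" l] hc by (simp add: nat_pow_pow)
  then have "word_length G T (h [^] (n * l)) \<le> n" using n(2) by simp
  then have "C * (C * word_length G T (h [^] (n * l)) + C) \<le> C * (C * n + C * n)"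
    using n(1) by (intro mult_le_mono2 add_mono) simp_all
  then have "word_length G S (h [^] (n * l)) \<le> 2 * C * C * n"
    using C[OF pow, of "n * l"] by (simp add: algebra_simps)
  then have "M * of_nat (word_length G S (h [^] (n * l))) \<le> M * of_nat (2 * C * C * n)"
    using M(1) by (intro mult_left_mono) (simp_all only: of_nat_le_iff)
  then have "\<bar>f (h [^] (n * l))\<bar> \<le> M * of_nat (2 * C * C * n)" using M(2)[OF pow, of "n * l"] by linarith
  moreover have "f (h [^] (n * l)) = of_nat (n * l) * f h"
    by (rule additive_int_pow(3)[OF H f h(1)])
  ultimately have "of_nat n * (of_nat l * \<bar>f h\<bar>) \<le> of_nat n * (M * of_nat (2 * C * C))"
    by (simp add: abs_mult algebra_simps)
  then have "of_nat l * \<bar>f h\<bar> \<le> M * of_nat (2 * C * C)" using n(1) by simp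
  then show False using l by simp
qed

section \<open>Virtual retracts are undistorted\<close>

text \<open>Reading a word letter by letter along the cosets of \<open>K\<close> replaces each
  letter by one Schreier generator, so the length is kept.\<close>

lemma finite_index_generators:
  assumes T: "finite_generators G (carrier G) T" and K: "subgroup K G" and fi: "finite_index G K"
  shows "\<exists>S. finite_generators G K S \<and> (\<forall>k\<in>K. word_length G S k \<le> word_length G T k)"
proof -
  interpret K: subgroup K G by (rule K)
  have Tc: "T \<subseteq> carrier G" "letters_of T \<subseteq> carrier G" "finite T"
    using T by (auto simp: finite_generators_def)
  \<comment> \<open>With representative \<open>\<one>\<close> for \<open>K\<close> itself, the
    telescoping product for a word in \<open>K\<close> has nothing left at either end.\<close>
  define r where "r = (\<lambda>C. if C = K then \<one> else SOME a. a \<in> C)"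
  have r: "r C \<in> C" if C: "C \<in> rcosets K" for C
    using K.rcosets_non_empty[OF C] some_in_eq[of C] by (simp add: r_def)
  have act: "C #> t \<in> rcosets K" "(C #> t) #> u = C #> (t \<otimes> u)"
    if "C \<in> rcosets K" "t \<in> carrier G" "u \<in> carrier G" for C t u
  proof -
    obtain a where "a \<in> carrier G" "C = K #> a" using \<open>C \<in> rcosets K\<close> unfolding RCOSETS_def by blast
    then show "C #> t \<in> rcosets K" "(C #> t) #> u = C #> (t \<otimes> u)"
      using that K.subset by (auto simp: coset_mult_assoc m_assoc RCOSETS_def)
  qed
  have rc: "r C \<in> carrier G" if "C \<in> rcosets K" for C
    using r[OF that] K.rcosets_carrier[OF is_group that] by blast
  \<comment> \<open>\<open>t\<close> will range over the generators and their inverses, so an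
    inverse letter also costs exactly one element of \<open>S\<close>.\<close>
  define s where "s = (\<lambda>(C, t). r C \<otimes> t \<otimes> inv r (C #> t))"
  define S where "S = s ` ((rcosets K) \<times> letters_of T)"
  have "S \<subseteq> K"
  proof
    fix y assume "y \<in> S"
    then obtain C t where y: "y = s (C, t)" "C \<in> rcosets K" "t \<in> letters_of T" by (auto simp: S_def)
    have t: "t \<in> carrier G" using y(3) Tc(2) by blast
    obtain a where a: "a \<in> carrier G" "C #> t = K #> a"
      using act(1)[OF y(2) t one_closed] by (auto simp: RCOSETS_def)
    have "r C \<otimes> t \<in> K #> a" using r[OF y(2)] a(2) by (auto simp: r_coset_def)
    moreover have "r (C #> t) \<in> K #> a" using r[OF act(1)[OF y(2) t one_closed]] a(2) by simp
    ultimately obtain k k' where k: "k \<in> K" "k' \<in> K" "r C \<otimes> t = k \<otimes> a" "r (C #> t) = k' \<otimes> a"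
      by (auto simp: r_coset_def)
    have "y = k \<otimes> a \<otimes> inv (k' \<otimes> a)" using y(1) k(3,4) by (simp add: s_def)
    also have "\<dots> = k \<otimes> inv k'" using k a(1) by (simp add: inv_mult_group m_assoc inv_mult_cancel)
    finally show "y \<in> K" using k by simp
  qed
  have word: "\<exists>vs. set vs \<subseteq> S \<and> length vs = length ws \<and> wprod vs = r C \<otimes> wprod ws \<otimes> inv r (C #> wprod ws)"
    if "set ws \<subseteq> letters_of T" "C \<in> rcosets K" for ws C
    using that
  proof (induction ws arbitrary: C)
    case Nil
    obtain a where "a \<in> carrier G" "C = K #> a" using Nil(2) unfolding RCOSETS_def by blast
    then have "C #> \<one> = C" using K.subset by (simp add: coset_mult_assoc)
    then show ?case using rc[OF Nil(2)] by (intro exI[of _ "[]"]) simp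
  next
    case (Cons t ws)
    have t: "t \<in> letters_of T" "t \<in> carrier G" using Cons.prems Tc by auto
    have "set ws \<subseteq> letters_of T" using Cons.prems(1) by simp
    then have w: "wprod ws \<in> carrier G" using Tc(2) by (intro wprod_closed) blast
    note C' = act(1)[OF Cons.prems(2) t(2) one_closed]
    obtain vs where vs: "set vs \<subseteq> S" "length vs = length ws"
      "wprod vs = r (C #> t) \<otimes> wprod ws \<otimes> inv r (C #> t #> wprod ws)"
      using Cons.IH[OF _ C'] Cons.prems by auto
    note C'' = act(1)[OF C' w one_closed]
    have "s (C, t) \<otimes> wprod vs = r C \<otimes> (t \<otimes> wprod ws) \<otimes> inv r (C #> t #> wprod ws)"
      using rc[OF Cons.prems(2)] rc[OF C'] rc[OF C''] t w
      by (simp add: vs(3) s_def m_assoc inv_mult_cancel)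
    also have "C #> t #> wprod ws = C #> (t \<otimes> wprod ws)" using act(2)[OF Cons.prems(2) t(2) w] .
    finally have "wprod (s (C, t) # vs) = r C \<otimes> wprod (t # ws) \<otimes> inv r (C #> wprod (t # ws))" by simp
    moreover have "s (C, t) \<in> S" using Cons.prems(2) t(1) by (auto simp: S_def)
    ultimately show ?case using vs(1,2) by (intro exI[of _ "s (C, t) # vs"]) simp
  qed
  have KK: "K \<in> rcosets K" using K.subgroup_in_rcosets[OF is_group] .
  have wordK: "\<exists>vs. set vs \<subseteq> S \<and> length vs = word_length G T k \<and> wprod vs = k" if k: "k \<in> K" for k
  proof -
    have kc: "k \<in> carrier G" using k by simp
    obtain ws where ws: "length ws = word_length G T k" "set ws \<subseteq> letters_of T" "wprod ws = k"
      using finite_generators_word[OF T kc] .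
    have "r K \<otimes> k \<otimes> inv r (K #> k) = k" using K.rcos_const[OF is_group k] kc by (simp add: r_def)
    then show ?thesis using word[OF ws(2) KK] ws by simp
  qed
  have "finite S" unfolding S_def using fi Tc by (simp add: finite_index_def)
  moreover have "generate G S = K"
  proof
    show "generate G S \<subseteq> K" using \<open>S \<subseteq> K\<close> K by (rule generate_subgroup_incl)
    show "K \<subseteq> generate G S"
    proof
      fix k assume "k \<in> K"
      then obtain vs where "set vs \<subseteq> S" "wprod vs = k" using wordK by blast
      moreover have "S \<subseteq> generate G S" by (auto intro: generate.incl)
      ultimately show "k \<in> generate G S"
        using wprod_in_subgroup[OF generate_is_subgroup, of S vs] \<open>S \<subseteq> K\<close> K.subset by blast
    qed
  qed
  ultimately have "finite_generators G K S" using \<open>S \<subseteq> K\<close> K.subset by (auto simp: finite_generators_def)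
  moreover have "word_length G S k \<le> word_length G T k" if "k \<in> K" for k
  proof -
    obtain vs where vs: "set vs \<subseteq> S" "length vs = word_length G T k" "wprod vs = k"
      using wordK[OF \<open>k \<in> K\<close>] by blast
    then show ?thesis using word_length_le[of vs S] by auto
  qed
  ultimately show ?thesis by blast
qed

text \<open>The images of the generators of \<open>K\<close> generate \<open>H\<close>: applying
  \<open>\<rho>\<close> letter by letter to a word for \<open>h\<close> gives a word of the same
  length whose value is \<open>\<rho> h = h\<close>.\<close>

lemma retract_generators:
  assumes S: "finite_generators G K S" and H: "subgroup H G" and ret: "retract_of G H K"
  shows "\<exists>S'. finite_generators G H S' \<and> (\<forall>h\<in>H. word_length G S' h \<le> word_length G S h)"
proof -
  have K: "subgroup K G" using S by (rule finite_generators_subgroup)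
  interpret K: subgroup K G by (rule K)
  interpret H: subgroup H G by (rule H)
  obtain \<rho> where HK: "H \<subseteq> K" and \<rho>: "\<rho> \<in> hom (G\<lparr>carrier := K\<rparr>) (G\<lparr>carrier := H\<rparr>)" "\<And>h. h \<in> H \<Longrightarrow> \<rho> h = h"
    using ret by (auto simp: retract_of_def)
  have \<rho>H: "\<rho> k \<in> H" if "k \<in> K" for k using \<rho>(1) that by (auto simp: hom_def)
  have \<rho>m: "\<rho> (a \<otimes> b) = \<rho> a \<otimes> \<rho> b" if "a \<in> K" "b \<in> K" for a b
    using \<rho>(1) that by (auto simp: hom_def)
  have one: "\<rho> \<one> = \<one>" using \<rho>(2) by simp
  have inv: "\<rho> (inv a) = inv (\<rho> a)" if "a \<in> K" for a
    using \<rho>m[of "inv a" a] one that \<rho>H H.mem_carrier by (intro inv_equality[symmetric]) auto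
  note lets = letters_in_subgroup[OF S]
  have SK: "S \<subseteq> K" using lets by blast
  define S' where "S' = \<rho> ` S"
  have S'H: "S' \<subseteq> H" using SK \<rho>H by (auto simp: S'_def)
  have word: "set (map \<rho> ws) \<subseteq> letters_of S' \<and> wprod (map \<rho> ws) = \<rho> (wprod ws)"
    if "set ws \<subseteq> letters_of S" for ws
    using that
  proof (induction ws)
    case (Cons s ws)
    have "\<rho> s \<in> letters_of S'" using Cons.prems inv SK by (auto simp: S'_def)
    moreover have "wprod ws \<in> K" using wprod_in_subgroup[OF K] Cons.prems lets by auto
    moreover have "s \<in> K" using Cons.prems lets by auto
    ultimately show ?case using Cons \<rho>m by simp
  qed (simp add: one)
  have wordH: "\<exists>vs. set vs \<subseteq> letters_of S' \<and> length vs = word_length G S h \<and> wprod vs = h" if h: "h \<in> H" for h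
  proof -
    obtain ws where "length ws = word_length G S h" "set ws \<subseteq> letters_of S" "wprod ws = h"
      using finite_generators_word[OF S] h HK by blast
    then show ?thesis using word[of ws] \<rho>(2)[OF h] by (intro exI[of _ "map \<rho> ws"]) simp
  qed
  have S'c: "S' \<subseteq> carrier G" using S'H H.subset by blast
  have "generate G S' = H"
  proof
    show "generate G S' \<subseteq> H" using S'H H by (rule generate_subgroup_incl)
    show "H \<subseteq> generate G S'"
    proof
      fix h assume "h \<in> H"
      then obtain vs where "set vs \<subseteq> letters_of S'" "wprod vs = h" using wordH by blast
      moreover have "letters_of S' \<subseteq> generate G S'" by (auto intro: generate.incl generate.inv)
      ultimately show "h \<in> generate G S'"
        using wprod_in_subgroup[OF generate_is_subgroup[OF S'c], of vs] by blast
    qed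
  qed
  then have "finite_generators G H S'" using S S'c by (simp add: finite_generators_def S'_def)
  moreover have "word_length G S' h \<le> word_length G S h" if hH: "h \<in> H" for h
  proof -
    obtain vs where vs: "set vs \<subseteq> letters_of S'" "length vs = word_length G S h" "wprod vs = h"
      using wordH[OF hH] by blast
    then show ?thesis using word_length_le[of vs S'] by auto
  qed
  ultimately show ?thesis by blast
qed

text \<open>A shortest word longer than \<open>n\<close> exists, and its prefix of length
  \<open>n\<close> is again shortest, since a shorter word for the prefix would shorten the
  whole.\<close>

lemma infinite_word_length_eq:
  assumes S: "finite_generators G H S" and H: "infinite H"
  shows "\<exists>w\<in>H. word_length G S w = n"
proof -
  have Sc: "S \<subseteq> carrier G" "finite S" "generate G S = H" using S by (auto simp: finite_generators_def)
  have sub: "subgroup H G" using S by (rule finite_generators_subgroup)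
  have "finite {w \<in> H. word_length G S w \<le> n}" using finite_word_ball[OF Sc(2,1), of n] Sc(3) by simp
  then have "\<not> H \<subseteq> {w \<in> H. word_length G S w \<le> n}" using H finite_subset by blast
  then obtain w where "w \<in> H" "\<not> word_length G S w \<le> n" by blast
  then have w: "w \<in> H" "word_length G S w > n" by simp_all
  obtain ws where ws: "length ws = word_length G S w" "set ws \<subseteq> letters_of S" "wprod ws = w"
    using finite_generators_word[OF S w(1)] .
  let ?u = "wprod (take n ws)" and ?v = "wprod (drop n ws)"
  have sets: "set (take n ws) \<subseteq> letters_of S" "set (drop n ws) \<subseteq> letters_of S"
    using ws(2) set_take_subset[of n ws] set_drop_subset[of n ws] by blast+
  have "wprod (take n ws @ drop n ws) = ?u \<otimes> ?v"
    using sets letters_closed[OF Sc(1)] by (intro wprod_append) blast+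
  then have uv: "w = ?u \<otimes> ?v" using ws(3) by simp
  have uvH: "?u \<in> H" "?v \<in> H"
    using sets letters_in_subgroup[OF S] by (blast intro: wprod_in_subgroup[OF sub])+
  have "word_length G S w \<le> word_length G S ?u + word_length G S ?v"
    unfolding uv using uvH Sc by (intro word_length_mult_le) auto
  moreover have "word_length G S ?u \<le> n" "word_length G S ?v \<le> word_length G S w - n"
    using word_length_le[OF sets(1)] word_length_le[OF sets(2)] ws(1) by simp_all
  ultimately have "word_length G S ?u = n" using w(2) by simp
  then show ?thesis using uvH by blast
qed

text \<open>An element of length \<open>n\<close> over \<open>S\<close> has length at most
  \<open>D * n\<close> over \<open>T\<close>. Infiniteness of \<open>H\<close> supplies such an
  element for every \<open>n\<close>.\<close>

lemma linear_dominated_distortion: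
  assumes T: "finite_generators G (carrier G) T" and S: "finite_generators G H S" and H: "infinite H"
  shows "(\<lambda>n. n) \<preceq>\<^sub>g distortion G T H S"
proof -
  have Hc: "H \<subseteq> carrier G" using finite_generators_subgroup[OF S] subgroup.subset by blast
  have Sc: "letters_of S \<subseteq> carrier G" using letters_in_subgroup[OF S] Hc by blast
  have fin: "finite (letters_of S)" using S by (simp add: finite_generators_def)
  define D where "D = Max (insert 0 (word_length G T ` letters_of S))"
  have D: "word_length G T s \<le> D" if "s \<in> letters_of S" for s
    unfolding D_def using that fin by (intro Max_ge) auto
  have bound: "word_length G T (wprod ws) \<le> D * length ws" if "set ws \<subseteq> letters_of S" for ws
    using that
  proof (induction ws)
    case Nil
    then show ?case using word_length_le[of "[]" T] by simp
  next
    case (Cons s ws)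
    have "wprod ws \<in> carrier G" "s \<in> carrier G" using Cons.prems Sc by (auto intro!: wprod_closed)
    then have "word_length G T (wprod (s # ws)) \<le> word_length G T s + word_length G T (wprod ws)"
      using word_length_mult_le'[OF T, of s "wprod ws"] by simp
    then show ?case using Cons D[of s] by simp
  qed
  have "n \<le> (D + 1) * distortion G T H S ((D + 1) * n + (D + 1))" for n
  proof -
    obtain w where w: "w \<in> H" "word_length G S w = n" using infinite_word_length_eq[OF S H] by blast
    obtain ws where ws: "length ws = word_length G S w" "set ws \<subseteq> letters_of S" "wprod ws = w"
      using finite_generators_word[OF S w(1)] .
    have "word_length G T w \<le> D * n" using bound[OF ws(2)] ws w by simp
    then have "word_length G T w \<le> (D + 1) * n + (D + 1)" by simp
    then have "n \<le> distortion G T H S ((D + 1) * n + (D + 1))"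
      unfolding distortion_def using w by (intro Max_ge distortion_set(1)[OF T S]) blast
    then show ?thesis by simp
  qed
  then show ?thesis unfolding dominated_def by (intro exI[of _ "D + 1"]) simp
qed

lemma virtual_retract_undistorted:
  assumes T: "finite_generators G (carrier G) T" and H: "subgroup H G" "infinite H"
    and K: "subgroup K G" "finite_index G K" "retract_of G H K"
  shows "undistorted G H"
proof -
  obtain S where S: "finite_generators G K S" "\<And>k. k \<in> K \<Longrightarrow> word_length G S k \<le> word_length G T k"
    using finite_index_generators[OF T K(1,2)] by blast
  obtain S' where S': "finite_generators G H S'" "\<And>h. h \<in> H \<Longrightarrow> word_length G S' h \<le> word_length G S h"
    using retract_generators[OF S(1) H(1) K(3)] by blast
  have HK: "H \<subseteq> K" using K(3) by (simp add: retract_of_def)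
  have "distortion G T H S' n \<le> 1 * (1 * n + 1)" for n
    unfolding distortion_def
  proof (rule Max.boundedI[OF distortion_set[OF T S'(1)]])
    fix k assume "k \<in> {word_length G S' w | w. w \<in> H \<and> word_length G T w \<le> n}"
    then obtain w where "k = word_length G S' w" "w \<in> H" "word_length G T w \<le> n" by blast
    then show "k \<le> 1 * (1 * n + 1)" using S(2)[of w] S'(2)[of w] HK by fastforce
  qed
  then have "distortion G T H S' \<preceq>\<^sub>g (\<lambda>n. n)" unfolding dominated_def by (intro exI[of _ 1]) simp
  then show ?thesis
    using linear_dominated_distortion[OF T S'(1) H(2)] T S'(1)
    by (auto simp: undistorted_def growth_equiv_def)
qed

end

section \<open>Undistorted subgroups are virtual retracts\<close>

context free_nilpotent_group
begin

lemma lead1_mult: "a \<in> carrier G \<Longrightarrow> b \<in> carrier G \<Longrightarrow> lead 1 (a \<otimes> b) = lead 1 a + lead 1 b"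
  using lead_mult[of 1 a b] c_pos level_1 by simp

lemma lead1_pow:
  "lead 1 \<one> = 0" "a \<in> carrier G \<Longrightarrow> lead 1 (inv a) = - lead 1 a"
  "a \<in> carrier G \<Longrightarrow> lead 1 (a [^] (n::nat)) = sc (of_nat n) (lead 1 a)"
  using lead_pow[of 1] c_pos level_1 by simp_all

lemma lead1_x: "i < m \<Longrightarrow> lead 1 (x i) = var i"
  using lead_gv[of "Leaf i"] c_pos by simp

text \<open>The case of degree 1 of \<open>level_gamma\<close>: the linear part determines the class
  in the abelianization.\<close>

lemma lead1_eq_0: "a \<in> carrier G \<Longrightarrow> lead 1 a = 0 \<Longrightarrow> a \<in> \<gamma> 2"
  using level_gamma[of a 1] c_pos level_Suc_iff[of a 1] level_1 by (simp add: numeral_2_eq_2)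

lemma lead1_span:
  assumes "a \<in> carrier G"
  shows "lead 1 a \<in> ncps.span (var ` {..<m})"
proof -
  have "a \<in> generate G (x ` {..<m})" using assms gen by simp
  then have "a \<in> carrier G \<and> lead 1 a \<in> ncps.span (var ` {..<m})"
  proof (induction rule: generate.induct)
    case one
    then show ?case using lead1_pow(1) ncps.span_zero by simp
  next
    case (incl h)
    then show ?case using lead1_x x_closed by (auto intro: ncps.span_base)
  next
    case (inv h)
    then obtain i where i: "h = x i" "i < m" by auto
    have "- var i \<in> ncps.span (var ` {..<m})" using i by (intro ncps.span_neg ncps.span_base) simp
    then show ?case using i lead1_x[OF i(2)] x_closed[OF i(2)] lead1_pow(2)[of "x i"] by simp
  next
    case (eng h1 h2)
    then show ?case using lead1_mult by (auto intro: ncps.span_add)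
  qed
  then show ?thesis by simp
qed

text \<open>Adding a linear function of the linear part in degree \<open>d\<close> keeps the map
  multiplicative up to degree \<open>d\<close>, since all cross terms have order above
  \<open>d\<close>. Freeness then extends the new values on the generators to a map multiplicative
  up to degree \<open>c\<close>, which agrees with the sum up to degree \<open>d\<close>.\<close>

lemma correct_mhom:
  assumes d: "1 \<le> d" "d \<le> c" and \<phi>: "mhom G c \<phi>"
    and \<Lambda>: "Vector_Spaces.linear sc sc \<Lambda>" "\<And>v. vanish d (\<Lambda> v)"
  shows "\<exists>\<phi>'. mhom G c \<phi>' \<and> (\<forall>a\<in>carrier G. vanish (Suc d) (\<phi>' a - (\<phi> a + \<Lambda> (lead 1 a))))"
proof -
  interpret \<Lambda>: Vector_Spaces.linear sc sc \<Lambda> by fact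
  define \<psi> where "\<psi> = (\<lambda>a. \<phi> a + \<Lambda> (lead 1 a))"
  have v1: "vanish 1 (\<Lambda> v)" for v using vanish_antimono[OF \<Lambda>(2) d(1)] .
  have \<psi>1: "vanish 1 (\<psi> a - 1)" if "a \<in> carrier G" for a
    using vanish_add[OF mhomD(1)[OF \<phi> that] v1[of "lead 1 a"]] by (simp add: \<psi>_def algebra_simps)
  have "mhom G d \<psi>"
    unfolding mhom_def
  proof (intro conjI ballI \<psi>1)
    fix a b assume a: "a \<in> carrier G" and b: "b \<in> carrier G"
    let ?A = "\<Lambda> (lead 1 a)" and ?B = "\<Lambda> (lead 1 b)"
    have 1: "vanish (Suc d) (\<phi> (a \<otimes> b) - \<phi> a * \<phi> b)"
      by (rule vanish_antimono[OF mhomD(2)[OF \<phi> a b]]) (use d in simp)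
    have 2: "vanish (Suc d) ((\<phi> a - 1) * ?B)" "vanish (Suc d) (?A * (\<phi> b - 1))" "vanish (Suc d) (?A * ?B)"
      using vanish_mult[OF mhomD(1)[OF \<phi> a] \<Lambda>(2)[of "lead 1 b"]] vanish_mult[OF \<Lambda>(2)[of "lead 1 a"] mhomD(1)[OF \<phi> b]]
        vanish_mult[OF \<Lambda>(2)[of "lead 1 a"] v1[of "lead 1 b"]] by simp_all
    have "\<psi> (a \<otimes> b) - \<psi> a * \<psi> b = (\<phi> (a \<otimes> b) - \<phi> a * \<phi> b) - (\<phi> a - 1) * ?B - ?A * (\<phi> b - 1) - ?A * ?B"
      using lead1_mult[OF a b] by (simp add: \<psi>_def \<Lambda>.add algebra_simps)
    then show "vanish (Suc d) (\<psi> (a \<otimes> b) - \<psi> a * \<psi> b)" using 1 2 by (simp add: vanish_diff)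
  qed
  obtain \<phi>' where \<phi>': "mhom G c \<phi>'" "\<And>i. i < m \<Longrightarrow> vanish (Suc c) (\<phi>' (x i) - \<psi> (x i))"
    using universal[of "\<lambda>i. \<psi> (x i)"] \<psi>1 x_closed by blast
  have "vanish (Suc d) (\<phi>' a - \<psi> a)" if "a \<in> carrier G" for a
  proof (rule mhom_agree[OF mhom_antimono[OF \<phi>'(1) d(2)] \<open>mhom G d \<psi>\<close>])
    show "x ` {..<m} \<subseteq> carrier G" using x_closed by auto
    show "a \<in> generate G (x ` {..<m})" using that gen by simp
    fix y assume "y \<in> x ` {..<m}"
    then obtain i where i: "y = x i" "i < m" by auto
    show "vanish (Suc d) (\<phi>' y - \<psi> y)"
      unfolding i(1) by (rule vanish_antimono[OF \<phi>'(2)[OF i(2)]]) (use d in simp)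
  qed
  then show ?thesis using \<phi>'(1) by (auto simp: \<psi>_def)
qed

text \<open>Building the retraction degree by degree: on \<open>H\<close> the next defect is additive and vanishes on
  \<open>\<gamma>\<^sub>2\<close>, hence is a linear function of the linear part, and a linear defect can be corrected on the
  generators.\<close>

lemma approximate_retraction:
  assumes H: "subgroup H G"
    and add: "\<And>(f :: 'a \<Rightarrow> rat) h. (\<And>a b. a \<in> H \<Longrightarrow> b \<in> H \<Longrightarrow> f (a \<otimes> b) = f a + f b) \<Longrightarrow>
      h \<in> H \<Longrightarrow> h \<in> \<gamma> 2 \<Longrightarrow> f h = 0"
    and B: "B \<subseteq> lead 1 ` H" "lead 1 ` H \<subseteq> ncps.span B"
    and B': "B \<subseteq> B'" "B' \<subseteq> B \<union> var ` {..<m}" "ncps.independent B'"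
    and n: "n \<le> c"
  shows "\<exists>\<phi>. mhom G c \<phi> \<and> (\<forall>h\<in>H. vanish (Suc n) (\<phi> h - \<mu> h)) \<and>
    (\<forall>j<m. var j \<in> B' - B \<longrightarrow> vanish (Suc n) (\<phi> (x j) - 1))"
  using n
proof (induction n)
  case 0
  \<comment> \<open>All constant terms are 1, so in degree 0 there is nothing to arrange.\<close>
  show ?case using \<mu>(1) mhomD(1)[OF \<mu>(1)] x_closed by (intro exI[of _ \<mu>]) simp
next
  case (Suc n)
  interpret H: subgroup H G by (rule H)
  define d where "d = Suc n"
  have d: "1 \<le> d" "d \<le> c" using Suc.prems by (auto simp: d_def)
  obtain \<phi> where \<phi>: "mhom G c \<phi>" "\<And>h. h \<in> H \<Longrightarrow> vanish d (\<phi> h - \<mu> h)"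
    "\<And>j. j < m \<Longrightarrow> var j \<in> B' - B \<Longrightarrow> vanish d (\<phi> (x j) - 1)"
    using Suc by (auto simp: d_def)
  define D where "D = (\<lambda>h. hpart d (\<mu> h - \<phi> h))"
  have D_add: "D (a \<otimes> b) = D a + D b" if a: "a \<in> H" and b: "b \<in> H" for a b
  proof -
    have c: "a \<in> carrier G" "b \<in> carrier G" using a b by auto
    have 1: "vanish (Suc d) (\<mu> (a \<otimes> b) - \<mu> a * \<mu> b)" "vanish (Suc d) (\<phi> (a \<otimes> b) - \<phi> a * \<phi> b)"
      using vanish_antimono[OF mhomD(2)[OF \<mu>(1) c]] vanish_antimono[OF mhomD(2)[OF \<phi>(1) c]] d by simp_all
    have v: "vanish d (\<mu> a - \<phi> a)" "vanish d (\<mu> b - \<phi> b)"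
      using \<phi>(2)[OF a] \<phi>(2)[OF b] by (simp_all add: vanish_diff_commute)
    have 2: "vanish (Suc d) ((\<mu> a - \<phi> a) * (\<mu> b - 1))" "vanish (Suc d) ((\<phi> a - 1) * (\<mu> b - \<phi> b))"
      using vanish_mult[OF v(1) mhomD(1)[OF \<mu>(1) c(2)]] vanish_mult[OF mhomD(1)[OF \<phi>(1) c(1)] v(2)] by simp_all
    have "(\<mu> (a \<otimes> b) - \<phi> (a \<otimes> b)) - ((\<mu> a - \<phi> a) + (\<mu> b - \<phi> b)) =
      (\<mu> (a \<otimes> b) - \<mu> a * \<mu> b) - (\<phi> (a \<otimes> b) - \<phi> a * \<phi> b) + (\<mu> a - \<phi> a) * (\<mu> b - 1) + (\<phi> a - 1) * (\<mu> b - \<phi> b)"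
      by (simp add: algebra_simps)
    moreover have "vanish (Suc d) \<dots>" using 1 2 by (simp add: vanish_add vanish_diff)
    ultimately have "vanish (Suc d) ((\<mu> (a \<otimes> b) - \<phi> (a \<otimes> b)) - ((\<mu> a - \<phi> a) + (\<mu> b - \<phi> b)))"
      by (simp only:)
    from hpart_cong[OF this] show ?thesis by (simp add: D_def hpart_simps)
  qed
  \<comment> \<open>The hypothesis concerns rational-valued functions and is applied to each
    coefficient of the defect.\<close>
  have D_gamma: "D h = 0" if "h \<in> H" "h \<in> \<gamma> 2" for h
  proof (rule ncps_eqI)
    fix w
    show "coeff (D h) w = coeff 0 w"
      using add[of "\<lambda>h. coeff (D h) w" h] that by (simp add: D_add)
  qed
  \<comment> \<open>The correction wanted on the basis: on \<open>B\<close> it is the defect of a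
    chosen element of \<open>H\<close>, and on a complementary variable it moves
    \<open>\<phi> (x j)\<close> to 1 in degree \<open>d\<close>.\<close>
  define val where "val = (\<lambda>b. if b \<in> B then D (SOME h. h \<in> H \<and> lead 1 h = b)
    else hpart d (1 - \<phi> (x (SOME j. b = var j))))"
  obtain g where g: "Vector_Spaces.linear sc sc g" "\<And>b. b \<in> B' \<Longrightarrow> g b = val b"
    using ncps2.linear_independent_extend[OF B'(3), of val] by blast
  interpret g: Vector_Spaces.linear sc sc g by fact
  \<comment> \<open>The linear extension is arbitrary outside the span of \<open>B'\<close>;
    projecting to degree \<open>d\<close> makes all its values homogeneous and leaves the prescribed
    ones unchanged.\<close>
  define \<Lambda> where "\<Lambda> = (\<lambda>v. hpart d (g v))"
  have \<Lambda>_lin: "Vector_Spaces.linear sc sc \<Lambda>"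
    by unfold_locales (simp_all add: \<Lambda>_def g.add g.scale hpart_simps)
  interpret \<Lambda>: Vector_Spaces.linear sc sc \<Lambda> by fact
  have hD: "hpart d (D h) = D h" for h by (simp add: D_def hpart_simps)
  have \<Lambda>_val: "\<Lambda> b = val b" if "b \<in> B'" for b
    using g(2)[OF that] by (auto simp: \<Lambda>_def val_def hD hpart_simps)
  \<comment> \<open>What remains of the defect after the correction. It is additive, vanishes on the
    elements chosen for \<open>B\<close> and, like \<open>D\<close>, on those with linear part
    0.\<close>
  define E where "E = (\<lambda>h. D h - \<Lambda> (lead 1 h))"
  have E_add: "E (a \<otimes> b) = E a + E b" if "a \<in> H" "b \<in> H" for a b
    using that D_add lead1_mult by (simp add: E_def \<Lambda>.add)
  have E_one: "E \<one> = 0" and E_inv: "a \<in> H \<Longrightarrow> E (inv a) = - E a"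
    and E_pow: "a \<in> H \<Longrightarrow> E (a [^] (n::nat)) = of_nat n * E a" for a n
    using additive_int_pow[OF H, of E] E_add by blast+
  have H0: "subgroup {h \<in> H. E h = 0} G"
  proof (rule subgroupI)
    show "{h \<in> H. E h = 0} \<noteq> {}" using H.one_closed E_one by blast
  qed (use E_add E_inv in auto)
  have BH0: "B \<subseteq> lead 1 ` {h \<in> H. E h = 0}"
  proof
    fix b assume b: "b \<in> B"
    then have "\<exists>h. h \<in> H \<and> lead 1 h = b" using B(1) by blast
    from someI_ex[OF this] obtain h where h: "h \<in> H" "lead 1 h = b" "val b = D h"
      using b by (auto simp: val_def)
    then have "E h = 0" using \<Lambda>_val[of b] b B'(1) by (auto simp: E_def)
    then show "b \<in> lead 1 ` {h \<in> H. E h = 0}" using h by blast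
  qed
  \<comment> \<open>Some power of \<open>h\<close> differs from an element on which \<open>E\<close>
    vanishes by an element with linear part 0, so a positive multiple of \<open>E h\<close> is 0,
    and the coefficients are rational.\<close>
  have E0: "E h = 0" if h: "h \<in> H" for h
  proof -
    have "lead 1 h \<in> ncps.span B" using B(2) h by blast
    then obtain N k where N: "N > 0" "k \<in> H" "E k = 0" "sc (of_nat N) (lead 1 h) = lead 1 k"
      using span_lead_power[OF H0 BH0] by blast
    let ?u = "h [^] N \<otimes> inv k"
    have hN: "h [^] N \<in> H" using h by (induction N) auto
    have uH: "?u \<in> H" using hN N(2) by simp
    have "lead 1 ?u = 0"
      using lead1_mult[of "h [^] N" "inv k"] lead1_pow(2)[of k] lead1_pow(3)[of h N] h N by simp
    then have "?u \<in> \<gamma> 2" using uH by (intro lead1_eq_0) auto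
    then have "E ?u = 0" using D_gamma[OF uH] \<open>lead 1 ?u = 0\<close> by (simp add: E_def \<Lambda>.zero)
    moreover have "E ?u = of_nat N * E h"
      using E_add[OF hN] E_inv[OF N(2)] E_pow[OF h, of N] N(2,3) by simp
    ultimately have "sc (of_nat N) (E h) = 0" using of_int_mult_sc[of "int N" "E h"] by simp
    then show ?thesis using N(1) by simp
  qed
  have "vanish d (\<Lambda> v)" for v using vanish_hpart by (simp add: \<Lambda>_def)
  from correct_mhom[OF d \<phi>(1) \<Lambda>_lin this]
  obtain \<phi>' where \<phi>': "mhom G c \<phi>'" "\<And>a. a \<in> carrier G \<Longrightarrow> vanish (Suc d) (\<phi>' a - (\<phi> a + \<Lambda> (lead 1 a)))"
    by blast
  have "vanish (Suc d) (\<phi>' h - \<mu> h)" if h: "h \<in> H" for h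
  proof -
    have "vanish d (\<mu> h - \<phi> h)" using \<phi>(2)[OF h] by (simp add: vanish_diff_commute)
    from vanish_Suc_hpart[OF this] have "vanish (Suc d) ((\<mu> h - \<phi> h) - \<Lambda> (lead 1 h))"
      using E0[OF h] by (simp add: E_def D_def)
    then have "vanish (Suc d) (\<phi> h + \<Lambda> (lead 1 h) - \<mu> h)"
      by (subst vanish_diff_commute) (simp add: algebra_simps)
    then show ?thesis by (rule vanish_trans[OF \<phi>'(2)[OF H.mem_carrier[OF h]]])
  qed
  moreover have "vanish (Suc d) (\<phi>' (x j) - 1)" if j: "j < m" "var j \<in> B' - B" for j
  proof -
    have "(SOME i. var j = var i) = j" using inj_var by (auto simp: inj_eq)
    then have "\<Lambda> (lead 1 (x j)) = hpart d (1 - \<phi> (x j))"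
      using \<Lambda>_val[of "var j"] j lead1_x by (simp add: val_def)
    moreover have "vanish d (1 - \<phi> (x j))" using \<phi>(3)[OF j] by (simp add: vanish_diff_commute)
    ultimately have "vanish (Suc d) ((1 - \<phi> (x j)) - \<Lambda> (lead 1 (x j)))" using vanish_Suc_hpart by metis
    then have "vanish (Suc d) (\<phi> (x j) + \<Lambda> (lead 1 (x j)) - 1)"
      by (subst vanish_diff_commute) (simp add: algebra_simps)
    then show ?thesis by (rule vanish_trans[OF \<phi>'(2)[OF x_closed[OF j(1)]]])
  qed
  ultimately show ?case using \<phi>'(1) by (auto simp: d_def)
qed

lemma virtual_retract_if_additive_eq_0:
  assumes H: "subgroup H G"
    and add: "\<And>(f :: 'a \<Rightarrow> rat) h. (\<And>a b. a \<in> H \<Longrightarrow> b \<in> H \<Longrightarrow> f (a \<otimes> b) = f a + f b) \<Longrightarrow>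
      h \<in> H \<Longrightarrow> h \<in> \<gamma> 2 \<Longrightarrow> f h = 0"
  shows "\<exists>K. subgroup K G \<and> finite_index G K \<and> retract_of G H K"
proof -
  interpret H: subgroup H G by (rule H)
  obtain B where B: "B \<subseteq> lead 1 ` H" "ncps.independent B" "lead 1 ` H \<subseteq> ncps.span B"
    by (rule ncps.maximal_independent_subset)
  \<comment> \<open>A basis of the linear parts of \<open>H\<close>, completed by variables to one
    whose span contains all variables.\<close>
  obtain B' where B': "B \<subseteq> B'" "B' \<subseteq> B \<union> var ` {..<m}" "ncps.independent B'" "B \<union> var ` {..<m} \<subseteq> ncps.span B'"
    using B(2) by (rule ncps.maximal_independent_subset_extend[of B "B \<union> var ` {..<m}", rotated]) auto
  obtain \<phi> where \<phi>: "mhom G c \<phi>" "\<And>h. h \<in> H \<Longrightarrow> vanish (Suc c) (\<phi> h - \<mu> h)"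
    "\<And>j. j < m \<Longrightarrow> var j \<in> B' - B \<Longrightarrow> vanish (Suc c) (\<phi> (x j) - 1)"
  proof -
    have "\<exists>\<phi>. mhom G c \<phi> \<and> (\<forall>h\<in>H. vanish (Suc c) (\<phi> h - \<mu> h)) \<and>
      (\<forall>j<m. var j \<in> B' - B \<longrightarrow> vanish (Suc c) (\<phi> (x j) - 1))"
      by (rule approximate_retraction[OF H _ B(1,3) B'(1-3) order.refl]) (rule add)
    then show ?thesis using that by blast
  qed
  define K where "K = {a \<in> carrier G. \<exists>h\<in>H. vanish (Suc c) (\<phi> a - \<mu> h)}"
  have Km: "vanish (Suc c) (\<phi> (a \<otimes> b) - \<mu> (h \<otimes> h'))"
    if "a \<in> carrier G" "b \<in> carrier G" "h \<in> H" "h' \<in> H" "vanish (Suc c) (\<phi> a - \<mu> h)" "vanish (Suc c) (\<phi> b - \<mu> h')"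
    for a b h h'
  proof -
    have 1: "vanish (Suc c) (\<phi> (a \<otimes> b) - \<phi> a * \<phi> b)" by (rule mhomD(2)[OF \<phi>(1) that(1,2)])
    have 2: "vanish (Suc c) (\<phi> a * \<phi> b - \<mu> h * \<mu> h')" using that(5,6) by (rule vanish_mult_cong)
    have "vanish (Suc c) (\<mu> (h \<otimes> h') - \<mu> h * \<mu> h')"
      using that by (intro mhomD(2)[OF \<mu>(1)]) simp_all
    then have 3: "vanish (Suc c) (\<mu> h * \<mu> h' - \<mu> (h \<otimes> h'))" by (simp add: vanish_diff_commute)
    show ?thesis using vanish_trans[OF vanish_trans[OF 1 2] 3] .
  qed
  have HK: "H \<subseteq> K" using \<phi>(2) H.mem_carrier by (auto simp: K_def)
  have K: "subgroup K G"
  proof (rule subgroupI)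
    show "K \<subseteq> carrier G" by (auto simp: K_def)
    show "K \<noteq> {}" using HK H.one_closed by blast
    fix a assume "a \<in> K"
    then obtain h where h: "a \<in> carrier G" "h \<in> H" "vanish (Suc c) (\<phi> a - \<mu> h)" by (auto simp: K_def)
    show "inv a \<in> K" using mhom_inv_cong[OF \<phi>(1) \<mu>(1) h(1) _ h(3)] h by (auto simp: K_def)
    fix b assume "b \<in> K"
    then obtain h' where "b \<in> carrier G" "h' \<in> H" "vanish (Suc c) (\<phi> b - \<mu> h')" by (auto simp: K_def)
    then show "a \<otimes> b \<in> K" using Km[OF h(1) _ h(2) _ h(3)] h unfolding K_def by blast
  qed
  interpret K: subgroup K G by (rule K)
  \<comment> \<open>By injectivity of \<open>\<mu>\<close> the chosen element is the only possible
    one, which makes \<open>\<rho>\<close> multiplicative and the identity on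
    \<open>H\<close>.\<close>
  define \<rho> where "\<rho> = (\<lambda>a. SOME h. h \<in> H \<and> vanish (Suc c) (\<phi> a - \<mu> h))"
  have \<rho>: "\<rho> a \<in> H \<and> vanish (Suc c) (\<phi> a - \<mu> (\<rho> a))" if "a \<in> K" for a
  proof -
    have "\<exists>h. h \<in> H \<and> vanish (Suc c) (\<phi> a - \<mu> h)" using that unfolding K_def by blast
    from someI_ex[OF this] show ?thesis unfolding \<rho>_def .
  qed
  have \<rho>_eq: "\<rho> a = h" if "a \<in> K" "h \<in> H" "vanish (Suc c) (\<phi> a - \<mu> h)" for a h
  proof -
    have "vanish (Suc c) (\<mu> (\<rho> a) - \<phi> a)"
      using \<rho>[OF that(1)] by (simp add: vanish_diff_commute)
    from vanish_trans[OF this that(3)] show ?thesis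
      using \<rho>[OF that(1)] that(2) by (intro \<mu>_inj) simp_all
  qed
  have "\<rho> \<in> hom (G\<lparr>carrier := K\<rparr>) (G\<lparr>carrier := H\<rparr>)"
  proof (rule homI)
    fix a b assume "a \<in> carrier (G\<lparr>carrier := K\<rparr>)" "b \<in> carrier (G\<lparr>carrier := K\<rparr>)"
    then have ab: "a \<in> K" "b \<in> K" by simp_all
    then have "\<rho> (a \<otimes> b) = \<rho> a \<otimes> \<rho> b"
      using \<rho>[of a] \<rho>[of b] by (intro \<rho>_eq Km) auto
    then show "\<rho> (a \<otimes>\<^bsub>G\<lparr>carrier := K\<rparr>\<^esub> b) = \<rho> a \<otimes>\<^bsub>G\<lparr>carrier := H\<rparr>\<^esub> \<rho> b" by simp
  qed (use \<rho> in simp)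
  moreover have "\<rho> h = h" if "h \<in> H" for h using \<rho>_eq \<phi>(2) that HK by blast
  ultimately have ret: "retract_of G H K" using HK by (auto simp: retract_of_def)
  \<comment> \<open>\<open>K\<close> contains \<open>H\<close>, and it contains the complementary
    generators because \<open>\<phi>\<close> sends them to 1.\<close>
  have B'K: "B' \<subseteq> lead 1 ` K"
  proof
    fix b assume b: "b \<in> B'"
    show "b \<in> lead 1 ` K"
    proof (cases "b \<in> B")
      case True
      then show ?thesis using B(1) HK by blast
    next
      case False
      then obtain j where j: "b = var j" "j < m" using b B'(2) by auto
      have "vanish (Suc c) (1 - \<mu> \<one>)" using mhom_one[OF \<mu>(1)] by (simp add: vanish_diff_commute)
      moreover have "vanish (Suc c) (\<phi> (x j) - 1)" using \<phi>(3)[OF j(2)] b False j(1) by simp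
      ultimately have "vanish (Suc c) (\<phi> (x j) - \<mu> \<one>)" by (rule vanish_trans[rotated])
      then have "x j \<in> K"
        unfolding K_def using x_closed[OF j(2)] by (intro CollectI conjI bexI[of _ \<one>]) simp_all
      from imageI[OF this, of "lead 1"] show ?thesis unfolding lead1_x[OF j(2)] j(1) .
    qed
  qed
  have "\<exists>N>0. \<exists>k\<in>K. a [^] (N::nat) \<otimes> inv k \<in> \<gamma> 2" if a: "a \<in> carrier G" for a
  proof -
    have "ncps.span (var ` {..<m}) \<subseteq> ncps.span B'" using B'(4) by (intro ncps.span_minimal ncps.subspace_span) auto
    then have "lead 1 a \<in> ncps.span B'" using lead1_span[OF a] by blast
    then obtain N k where N: "N > 0" "k \<in> K" "sc (of_nat N) (lead 1 a) = lead 1 k"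
      using span_lead_power[OF K B'K] by blast
    have "lead 1 (a [^] N \<otimes> inv k) = 0"
      using lead1_mult[of "a [^] N" "inv k"] lead1_pow(2)[of k] lead1_pow(3)[of a N] a N by simp
    then have "a [^] N \<otimes> inv k \<in> \<gamma> 2" using a N by (intro lead1_eq_0) auto
    then show ?thesis using N by blast
  qed
  then have "finite_index G K"
    using power_in_subgroup[OF K nil] by (intro finite_index_if_powers[OF K]) blast
  then show ?thesis using K ret by blast
qed

theorem undistorted_iff_virtual_retract:
  assumes H: "subgroup H G" "H \<noteq> {\<one>}"
  shows "undistorted G H \<longleftrightarrow> (\<exists>K. subgroup K G \<and> finite_index G K \<and> retract_of G H K)"
proof
  assume u: "undistorted G H"
  show "\<exists>K. subgroup K G \<and> finite_index G K \<and> retract_of G H K"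
    by (rule virtual_retract_if_additive_eq_0[OF H(1)]) (rule undistorted_additive_eq_0[OF nil u])
next
  assume "\<exists>K. subgroup K G \<and> finite_index G K \<and> retract_of G H K"
  moreover have "finite_generators G (carrier G) (x ` {..<m})"
    using gen x_closed by (auto simp: finite_generators_def)
  ultimately show "undistorted G H"
    using virtual_retract_undistorted H(1) infinite_subgroup[OF H] by blast
qed

end

section \<open>The free nilpotent group\<close>

abbreviation gclass :: "nat \<Rightarrow> nat \<Rightarrow> nat fword set"
  where "gclass m i \<equiv> free_rel {..<m} `` {[(i, True)]}"

fun letter_val :: "nat \<Rightarrow> (nat \<Rightarrow> ncps) \<Rightarrow> nat \<times> bool \<Rightarrow> ncps" where
  "letter_val c a (i, b) = (if b then a i else tinv c (a i))"

definition word_val :: "nat \<Rightarrow> (nat \<Rightarrow> ncps) \<Rightarrow> nat fword \<Rightarrow> ncps"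
  where "word_val c a w = prod_list (map (letter_val c a) w)"

lemma word_val_append: "word_val c a (u @ v) = word_val c a u * word_val c a v"
  by (simp add: word_val_def)

lemma vanish_word_val:
  assumes "\<And>i. i < m \<Longrightarrow> vanish 1 (a i - 1)" "w \<in> fwords {..<m}"
  shows "vanish 1 (word_val c a w - 1)"
  using assms(2)
proof (induction w)
  case (Cons l w)
  obtain i b where l: "l = (i, b)" by (cases l)
  have i: "i < m" using Cons.hyps l by auto
  have "vanish 1 (letter_val c a l - 1)" using assms(1)[OF i] tinv(3)[OF assms(1)[OF i]] l by simp
  from group.vanish_mult_cong[OF free_group_is_group this Cons.IH]
  show ?case by (simp add: word_val_def)
qed (simp add: word_val_def)

lemma word_val_free_eq:
  assumes a: "\<And>i. i < m \<Longrightarrow> vanish 1 (a i - 1)" and uv: "free_eq {..<m} u v"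
  shows "vanish (Suc c) (word_val c a u - word_val c a v)"
  using uv
proof (induction rule: free_eq.induct)
  case (cancel u v i b)
  have "vanish (Suc c) (letter_val c a (i, b) * letter_val c a (i, \<not> b) - 1)"
    using tinv[OF a, of i c] cancel by auto
  then have "vanish (Suc c) (word_val c a u * (letter_val c a (i, b) * letter_val c a (i, \<not> b) - 1) * word_val c a v)"
    by (intro vanish_mult_right vanish_mult_left)
  moreover have "word_val c a (u @ [(i, b), (i, \<not> b)] @ v) - word_val c a (u @ v) =
    word_val c a u * (letter_val c a (i, b) * letter_val c a (i, \<not> b) - 1) * word_val c a v"
    by (simp add: word_val_def algebra_simps)
  ultimately show ?case by simp
next
  case (sym u v)
  then show ?case by (simp add: vanish_diff_commute)
next
  case (trans u v w)
  then show ?case by (blast intro: vanish_trans)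
qed simp

text \<open>Words are evaluated with \<open>tinv\<close> for inverse letters, so equivalent words
  agree only modulo degree above \<open>c\<close>; the value at a class is that of a chosen
  representative and matters only up to this congruence.\<close>

lemma free_group_mhom:
  assumes a: "\<And>i. i < m \<Longrightarrow> vanish 1 (a i - 1)"
  shows "\<exists>\<phi>. mhom (free_group {..<m}) c \<phi> \<and> (\<forall>i<m. vanish (Suc c) (\<phi> (gclass m i) - a i))"
proof -
  define \<phi> where "\<phi> = (\<lambda>A. word_val c a (SOME u. u \<in> fwords {..<m} \<and> A = free_rel {..<m} `` {u}))"
  have \<phi>: "vanish (Suc c) (\<phi> (free_rel {..<m} `` {u}) - word_val c a u)" if u: "u \<in> fwords {..<m}" for u
  proof -
    have "\<exists>v. v \<in> fwords {..<m} \<and> free_rel {..<m} `` {u} = free_rel {..<m} `` {v}" using u by blast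
    from someI_ex[OF this] obtain v where v: "v \<in> fwords {..<m}" "free_rel {..<m} `` {u} = free_rel {..<m} `` {v}"
      "\<phi> (free_rel {..<m} `` {u}) = word_val c a v" unfolding \<phi>_def by blast
    have "(v, u) \<in> free_rel {..<m}"
      using eq_equiv_class[OF v(2)[symmetric] equiv_free_rel u] .
    then have "vanish (Suc c) (word_val c a v - word_val c a u)"
      using word_val_free_eq[OF a] by (simp add: free_rel_def)
    then show ?thesis by (simp add: v(3))
  qed
  have "mhom (free_group {..<m}) c \<phi>"
    unfolding mhom_def
  proof (intro conjI ballI)
    fix A assume "A \<in> carrier (free_group {..<m})"
    then obtain u where u: "u \<in> fwords {..<m}" "A = free_rel {..<m} `` {u}" by (rule free_carrierE)
    have "vanish 1 (\<phi> A - word_val c a u)" unfolding u(2) by (rule vanish_antimono[OF \<phi>[OF u(1)]]) simp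
    then show "vanish 1 (\<phi> A - 1)" using vanish_word_val[where a = a and c = c, OF a u(1)] by (rule vanish_trans)
    fix B assume "B \<in> carrier (free_group {..<m})"
    then obtain v where v: "v \<in> fwords {..<m}" "B = free_rel {..<m} `` {v}" by (rule free_carrierE)
    have 1: "vanish (Suc c) (\<phi> (A \<otimes>\<^bsub>free_group {..<m}\<^esub> B) - word_val c a u * word_val c a v)"
      using \<phi>[of "u @ v"] u v by (simp add: free_mult_class word_val_append)
    have "vanish (Suc c) (\<phi> A * \<phi> B - word_val c a u * word_val c a v)"
      using group.vanish_mult_cong[OF free_group_is_group \<phi>[OF u(1)] \<phi>[OF v(1)]] u v by simp
    then show "vanish (Suc c) (\<phi> (A \<otimes>\<^bsub>free_group {..<m}\<^esub> B) - \<phi> A * \<phi> B)"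
      using 1 by (simp add: vanish_def)
  qed
  moreover have "vanish (Suc c) (\<phi> (gclass m i) - a i)" if "i < m" for i
    using \<phi>[of "[(i, True)]"] that by (simp add: word_val_def)
  ultimately show ?thesis by blast
qed

lemma free_group_generated: "generate (free_group {..<m}) (gclass m ` {..<m}) = carrier (free_group {..<m})"
proof
  interpret R: group "free_group {..<m}" by (rule free_group_is_group)
  have cl: "gclass m ` {..<m} \<subseteq> carrier (free_group {..<m})" by (auto intro: free_class_in)
  then show "generate (free_group {..<m}) (gclass m ` {..<m}) \<subseteq> carrier (free_group {..<m})"
    by (rule R.generate_incl)
  interpret S: subgroup "generate (free_group {..<m}) (gclass m ` {..<m})" "free_group {..<m}"
    using cl by (rule R.generate_is_subgroup)
  have letter: "free_rel {..<m} `` {[(i, b)]} \<in> generate (free_group {..<m}) (gclass m ` {..<m})" if "i < m" for i b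
  proof -
    have g: "gclass m i \<in> generate (free_group {..<m}) (gclass m ` {..<m})"
      using that by (auto intro: generate.incl)
    have "free_eq {..<m} ([] @ [(i, False), (i, \<not> False)] @ []) ([] @ [])"
      by (rule free_eq.cancel) (use that in auto)
    then have "free_rel {..<m} `` {[(i, False), (i, True)]} = free_rel {..<m} `` {[]}"
      by (intro equiv_class_eq[OF equiv_free_rel]) (simp add: free_rel_def)
    then have "free_rel {..<m} `` {[(i, False)]} \<otimes>\<^bsub>free_group {..<m}\<^esub> gclass m i = \<one>\<^bsub>free_group {..<m}\<^esub>"
      using that by (simp add: free_mult_class) (simp add: free_group_def)
    then have "inv\<^bsub>free_group {..<m}\<^esub> gclass m i = free_rel {..<m} `` {[(i, False)]}"
      using that by (intro R.inv_equality free_class_in) auto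
    then show ?thesis using S.m_inv_closed[OF g] g by (cases b) simp_all
  qed
  show "carrier (free_group {..<m}) \<subseteq> generate (free_group {..<m}) (gclass m ` {..<m})"
  proof
    fix A assume "A \<in> carrier (free_group {..<m})"
    then obtain u where u: "u \<in> fwords {..<m}" "A = free_rel {..<m} `` {u}" by (rule free_carrierE)
    from u(1) have "free_rel {..<m} `` {u} \<in> generate (free_group {..<m}) (gclass m ` {..<m})"
    proof (induction u)
      case Nil
      then show ?case using S.one_closed by (simp add: free_group_def)
    next
      case (Cons l u)
      obtain i b where l: "l = (i, b)" by (cases l)
      have "free_rel {..<m} `` {l # u} = free_rel {..<m} `` {[(i, b)]} \<otimes>\<^bsub>free_group {..<m}\<^esub> free_rel {..<m} `` {u}"
        using Cons.hyps l free_mult_class[of "[(i, b)]" "{..<m}" u] by simp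
      moreover have "i < m" using Cons.hyps l by auto
      ultimately show ?case using letter Cons.IH l by simp
    qed
    then show "A \<in> generate (free_group {..<m}) (gclass m ` {..<m})" using u(2) by simp
  qed
qed

section \<open>Passing to the nilpotent quotient\<close>

lemma (in group_hom) lower_central_img:
  assumes "h ` carrier G = carrier H"
  shows "lower_central H i \<subseteq> h ` lower_central G i"
proof (cases "i = 0")
  case False
  then have "i \<ge> 1" by simp
  then show ?thesis
  proof (induction i rule: nat_induct_at_least)
    case base
    then show ?case using assms by simp
  next
    case (Suc i)
    have "{comm H a b | a b. a \<in> carrier H \<and> b \<in> lower_central H i} \<subseteq> h ` lower_central G (Suc i)"
    proof clarify
      fix a b assume "a \<in> carrier H" "b \<in> lower_central H i"
      then obtain a' b' where ab: "a' \<in> carrier G" "a = h a'" "b' \<in> lower_central G i" "b = h b'"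
        using assms Suc.IH by blast
      then have "b' \<in> carrier G" using G.gamma_carrier by blast
      then have "comm H a b = h (comm G a' b')" using ab by (simp add: comm_def)
      moreover have "comm G a' b' \<in> lower_central G (Suc i)"
        using ab Suc.hyps by (intro G.comm_in_gamma_Suc) auto
      ultimately show "comm H a b \<in> h ` lower_central G (Suc i)" by blast
    qed
    then show ?case
      unfolding H.gamma_Suc[OF Suc.hyps]
      using H.generate_subgroup_incl subgroup_img_is_subgroup[OF G.gamma_subgroup] by blast
  qed
qed (use assms in simp)

lemma free_nilpotent_group_free_nilpotent:
  fixes m c :: nat
  assumes "c \<ge> 1"
  defines "N \<equiv> lower_central (free_group {..<m}) (c + 1)"
  shows "free_nilpotent_group (free_nilpotent m c) (\<lambda>i. N #>\<^bsub>free_group {..<m}\<^esub> gclass m i) m c"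
proof -
  let ?R = "free_group {..<m}"
  interpret R: group ?R by (rule free_group_is_group)
  interpret N: normal N ?R unfolding N_def by (rule R.lower_central_normal)
  have F: "free_nilpotent m c = ?R Mod N" by (simp add: free_nilpotent_def N_def)
  interpret Q: group "?R Mod N" by (rule N.Mod_group)
  interpret h: group_hom ?R "?R Mod N" "\<lambda>a. N #>\<^bsub>?R\<^esub> a" by (rule N.Mod_hom)
  have surj: "(\<lambda>a. N #>\<^bsub>?R\<^esub> a) ` carrier ?R = carrier (?R Mod N)"
    using N.Mod_closed N.Mod_carrierE by blast
  have gc: "gclass m i \<in> carrier ?R" if "i < m" for i using that by (intro free_class_in) simp
  show ?thesis
    unfolding F
  proof unfold_locales
    show "c \<ge> 1" by fact
    show "N #>\<^bsub>?R\<^esub> gclass m i \<in> carrier (?R Mod N)" if "i < m" for i using gc[OF that] by (rule N.Mod_closed)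
    have "generate (?R Mod N) ((\<lambda>a. N #>\<^bsub>?R\<^esub> a) ` gclass m ` {..<m}) = (\<lambda>a. N #>\<^bsub>?R\<^esub> a) ` generate ?R (gclass m ` {..<m})"
      using gc by (intro h.generate_img) auto
    then show "generate (?R Mod N) ((\<lambda>i. N #>\<^bsub>?R\<^esub> gclass m i) ` {..<m}) = carrier (?R Mod N)"
      by (simp add: free_group_generated surj image_image)
    have "lower_central (?R Mod N) (Suc c) \<subseteq> (\<lambda>a. N #>\<^bsub>?R\<^esub> a) ` N"
      using h.lower_central_img[OF surj, of "Suc c"] by (simp add: N_def)
    also have "\<dots> \<subseteq> {\<one>\<^bsub>?R Mod N\<^esub>}" using N.Mod_eq_one_iff N.mem_carrier by blast
    finally show "lower_central (?R Mod N) (Suc c) = {\<one>\<^bsub>?R Mod N\<^esub>}"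
      using subgroup.one_closed[OF Q.gamma_subgroup] by blast
    fix a :: "nat \<Rightarrow> ncps" assume a: "\<And>i. i < m \<Longrightarrow> vanish 1 (a i - 1)"
    obtain \<phi> where \<phi>: "mhom ?R c \<phi>" "\<And>i. i < m \<Longrightarrow> vanish (Suc c) (\<phi> (gclass m i) - a i)"
      using free_group_mhom[of m a c, OF a] by blast
    \<comment> \<open>The kernel of the quotient map is sent to 1 up to degree \<open>c\<close>, so
      \<open>\<phi>\<close> is well defined on cosets up to this congruence.\<close>
    have N1: "vanish (Suc c) (\<phi> u - 1)" if "u \<in> N" for u
      using R.vanish_gamma[OF \<phi>(1), of "Suc c" u] that by (simp add: N_def)
    define \<psi> where "\<psi> = (\<lambda>A. \<phi> (SOME u. u \<in> carrier ?R \<and> A = N #>\<^bsub>?R\<^esub> u))"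
    have \<psi>: "vanish (Suc c) (\<psi> (N #>\<^bsub>?R\<^esub> u) - \<phi> u)" if u: "u \<in> carrier ?R" for u
    proof -
      have "\<exists>v. v \<in> carrier ?R \<and> N #>\<^bsub>?R\<^esub> u = N #>\<^bsub>?R\<^esub> v" using u by blast
      from someI_ex[OF this] obtain v where v: "v \<in> carrier ?R" "N #>\<^bsub>?R\<^esub> u = N #>\<^bsub>?R\<^esub> v"
        "\<psi> (N #>\<^bsub>?R\<^esub> u) = \<phi> v" unfolding \<psi>_def by blast
      have "v \<in> N #>\<^bsub>?R\<^esub> u" using v(1,2) R.rcos_self[OF v(1) N.is_subgroup] by simp
      then obtain n where n: "n \<in> N" "v = n \<otimes>\<^bsub>?R\<^esub> u" by (auto simp: r_coset_def)
      have "vanish (Suc c) (\<phi> v - \<phi> n * \<phi> u)"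
        using R.mhomD(2)[OF \<phi>(1), of n u] n u by simp
      moreover have "vanish (Suc c) (\<phi> n * \<phi> u - 1 * \<phi> u)"
        using N1[OF n(1)] by (intro R.vanish_mult_cong) simp_all
      ultimately have "vanish (Suc c) (\<phi> v - 1 * \<phi> u)" by (rule vanish_trans)
      then show ?thesis using v(3) by simp
    qed
    have "mhom (?R Mod N) c \<psi>"
      unfolding mhom_def
    proof (intro conjI ballI)
      fix A assume "A \<in> carrier (?R Mod N)"
      then obtain u where u: "u \<in> carrier ?R" "A = N #>\<^bsub>?R\<^esub> u" by (rule N.Mod_carrierE)
      have "vanish 1 (\<psi> A - \<phi> u)" unfolding u(2) by (rule vanish_antimono[OF \<psi>[OF u(1)]]) simp
      then show "vanish 1 (\<psi> A - 1)" using R.mhomD(1)[OF \<phi>(1) u(1)] by (blast intro: vanish_trans)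
      fix B assume "B \<in> carrier (?R Mod N)"
      then obtain v where v: "v \<in> carrier ?R" "B = N #>\<^bsub>?R\<^esub> v" by (rule N.Mod_carrierE)
      have 1: "vanish (Suc c) (\<psi> (A \<otimes>\<^bsub>?R Mod N\<^esub> B) - \<phi> (u \<otimes>\<^bsub>?R\<^esub> v))"
        unfolding u(2) v(2) N.Mod_mult[OF u(1) v(1)] by (rule \<psi>[OF R.m_closed[OF u(1) v(1)]])
      have 2: "vanish (Suc c) (\<psi> A * \<psi> B - \<phi> u * \<phi> v)"
        unfolding u(2) v(2) by (rule R.vanish_mult_cong[OF \<psi>[OF u(1)] \<psi>[OF v(1)]])
      have 3: "vanish (Suc c) (\<phi> (u \<otimes>\<^bsub>?R\<^esub> v) - \<phi> u * \<phi> v)" by (rule R.mhomD(2)[OF \<phi>(1) u(1) v(1)])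
      show "vanish (Suc c) (\<psi> (A \<otimes>\<^bsub>?R Mod N\<^esub> B) - \<psi> A * \<psi> B)"
        using vanish_trans[OF 1 3] 2 by (simp add: vanish_def)
    qed
    moreover have "vanish (Suc c) (\<psi> (N #>\<^bsub>?R\<^esub> gclass m i) - a i)" if "i < m" for i
      using \<psi>[OF gc[OF that]] \<phi>(2)[OF that] by (rule vanish_trans)
    ultimately show "\<exists>\<phi>. mhom (?R Mod N) c \<phi> \<and> (\<forall>i<m. vanish (Suc c) (\<phi> (N #>\<^bsub>?R\<^esub> gclass m i) - a i))"
      by (intro exI[of _ \<psi>]) simp
  qed
qed

theorem theorem1p7:
  fixes m c :: nat and H :: "nat fword set set set"
  defines "F \<equiv> free_nilpotent m c"
  assumes "m \<ge> 1" and "c \<ge> 1"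
    and "subgroup H F" and "H \<noteq> {\<one>\<^bsub>F\<^esub>}"
  shows "undistorted F H \<longleftrightarrow>
    (\<exists>K. subgroup K F \<and> finite_index F K \<and> retract_of F H K)"
  using free_nilpotent_group.undistorted_iff_virtual_retract[OF free_nilpotent_group_free_nilpotent[OF \<open>c \<ge> 1\<close>]]
    assms(4,5) unfolding F_def by blast

end
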